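(* Let $u(\mathbf c)$ be an infinite totally positive upper-triangular unipotent Toeplitz matrix whose Schoenberg parameters $\boldsymbol\alpha=(\alpha_i)_{i\in\mathbb N}$, $\boldsymbol\beta=(\beta_j)_{j\in\mathbb N}$ are all nonzero and satisfy $\alpha_i>\alpha_{i+1}$ and $\beta_j>\beta_{j+1}$ for all $i,j$. For each $n\ge1$ let $u^{(n+1)}$ be a totally positive $(n+1)\times(n+1)$ upper-triangular unipotent Toeplitz matrix, and suppose that $(u^{(n+1)})_n$ converges uniformly to $u(\mathbf c)$. Let $w\in S_\infty$, and for $n$ large enough that $w\in S_{n+1}$ let $w^{(n+1)}$ be the conjugate of $w$ by the longest element of $S_{n+1}$. Then $$\lim_{n\to\infty}\mathfrak S^w(u^{(n+1)})=\mathcal S_w\Big(\frac1{\alpha_1},\frac1{\alpha_2},\frac1{\alpha_3},\dots\Big),\qquad \lim_{n\to\infty}\mathfrak S^{w^{(n+1)}}(u^{(n+1)})=\mathcal S_w\Big(\frac1{\beta_1},\frac1{\beta_2},\frac1{\beta_3},\dots\Big),$$ where $\mathcal S_w$ is the classical Schubert polynomial associated to $w$, and $\mathfrak S^w,\mathfrak S^{w^{(n+1)}}$ are the functions on $(n+1)\times(n+1)$ Toeplitz matrices corresponding to the quantum Schubert classes $\sigma^w,\sigma^{w^{(n+1)}}$ of $\mathcal Fl_{n+1}$ under the Peterson isomorphism.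
   Context: **Matrices.** For a real sequence $\mathbf c=(1,c_1,c_2,\dots)$ let $u(\mathbf c)$ be the infinite upper-triangular unipotent Toeplitz matrix with $(i,j)$ entry $c_{j-i}$ ($c_0=1$, $c_k=0$ for $k<0$). A finite or infinite upper-triangular unipotent matrix is *totally positive* if every minor that does not vanish identically on upper-triangular unipotent matrices is strictly positive. $\operatorname{Minor}^I_J(u)$ is the minor with row set $I$ and column set $J$; $[i]=\{1,\dots,i\}$ and $[i]+j=\{1+j,\dots,i+j\}$. For an $(n+1)\times(n+1)$ matrix, $\Delta_i=\operatorname{Minor}^{[i]}_{[i]+n-i+1}$ is the minor with rows $1,\dots,i$ and the last $i$ columns; $\Delta_0=\Delta_{n+1}=1$ on unipotent upper-triangular matrices. **Schoenberg parameters.** By Edrei's theorem, if $u(\mathbf c)$ is totally positive then $$1+c_1x+c_2x^2+\dots=e^{\gamma x}\prod_{i=1}^\infty\frac{1+\beta_ix}{1-\alpha_ix}$$ for unique $\gamma\ge0$ and weakly decreasing nonnegative summable sequences $(\alpha_i)$, $(\beta_j)$, called the Schoenberg parameters of $u(\mathbf c)$. **Uniform convergence.** Let $\mathrm{UToep}_{n+1}(\mathbb R)\cong\mathbb R^n$ be the space of real upper-triangular unipotent $(n+1)\times(n+1)$ Toeplitz matrices, identified with $\mathbb R^n$ by the entries $(c_1,\dots,c_n)$ of the first row after the initial $1$. The truncation $u^{[n+1]}$ of $u(\mathbf c)$ is its upper-left $(n+1)\times(n+1)$ block. The sequence $(u^{(n+1)})_n$ converges uniformly to $u(\mathbf c)$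 if for every $\varepsilon>0$ there is an $N$ such that $u^{(n+1)}$ lies in the $\varepsilon$-neighbourhood of $u^{[n+1]}$ in $\mathrm{UToep}_{n+1}(\mathbb R)\cong\mathbb R^n$ whenever $n>N$. **Quantum cohomology and the Peterson isomorphism.** $\mathcal Fl_{n+1}$ is the variety of full flags $V_1\subset\dots\subset V_n\subset\mathbb C^{n+1}$. Its small quantum cohomology ring $qH^*(\mathcal Fl_{n+1},\mathbb C)$ has $\mathbb C[q_1,\dots,q_n]$-basis the Schubert classes $\{\sigma^w\mid w\in S_{n+1}\}$ and presentation $\mathbb C[x_1,\dots,x_{n+1};q_1,\dots,q_n]/(E_1^q,\dots,E_{n+1}^q)$, where $x_k=-c_1(V_k/V_{k-1})$ and $\sigma^{s_k}=x_1+\dots+x_k$ for the simple transposition $s_k$. Here $E_i^q=E_i^{(n+1)}$, and $E_i^{(k)}$ is the coefficient of $\lambda^i$ in $\det(1+\lambda G_k)$, with $G_k$ the $k\times k$ tridiagonal matrix with diagonal $x_1,\dots,x_k$, superdiagonal $q_1,\dots,q_{k-1}$ and all subdiagonal entries $-1$. In this presentation $\sigma^w$ is represented by the Fomin–Gelfand–Postnikov quantum Schubert polynomial $\mathcal S_w^q$, obtained from the classical Schubert polynomial $\mathcal S_w$ by expanding it uniquely as a linear combination of products $e_{i_1}(x_1)e_{i_2}(x_1,x_2)e_{i_3}(x_1,x_2,x_3)\cdots$ with $0\le i_k\le k$, and replacing each $e_{i}(x_1,\dots,x_k)$ by $E_{i}^{(k)}$. Let $\mathrm{UToep}_{n+1}(\mathbb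 C)$ be the variety of upper-triangular unipotent $(n+1)\times(n+1)$ complex Toeplitz matrices. The Peterson isomorphism is the $\mathbb{C}$-algebra isomorphism $$qH^*(\mathcal Fl_{n+1},\mathbb C)[q_1^{-1},\dots,q_n^{-1}]\ \overset{\sim}{\longrightarrow}\ \mathbb C[\mathrm{UToep}_{n+1}(\mathbb C)][\Delta_1^{-1},\dots,\Delta_n^{-1}],$$ $$\sigma^{s_k}\mapsto \frac{\operatorname{Minor}^{[k-1]\cup\{k+1\}}_{[k]+n-k+1}}{\Delta_k},\qquad q_k\mapsto\frac{\Delta_{k+1}\Delta_{k-1}}{\Delta_k^2}.$$ $\mathfrak S^w$ denotes the image of $\sigma^w$. $S_\infty=\bigcup_kS_k$. Classical Schubert polynomials $\mathcal S_w$, $w\in S_\infty$, are those of Lascoux–Schützenberger (so $\mathcal S_{s_k}=x_1+\dots+x_k$). *)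

theory Defs
  imports
    "HOL-Analysis.L2_Norm"
    "HOL-Analysis.Infinite_Products"
    "HOL-Algebra.QuotRing"
    "HOL-Combinatorics.Permutations"
    "HOL-Computational_Algebra.Polynomial"
    "HOL-Library.Poly_Mapping"
    "Jordan_Normal_Form.Determinant"
begin

section \<open>Toeplitz matrices, minors and total positivity\<close>

text \<open>Rows and columns are numbered from 0, as in the matrix library.  So the index set
  \<open>[i] + j = {1+j,\<dots>,i+j}\<close> of the 1-based convention is \<open>{j..<i+j}\<close> here.  Infinite matrices are
  functions \<open>nat \<Rightarrow> nat \<Rightarrow> 'a\<close>; a finite matrix \<open>A\<close> is viewed as the function \<open>entries A\<close>.\<close>

definition toeplitz :: "(nat \<Rightarrow> 'a::zero) \<Rightarrow> nat \<Rightarrow> nat \<Rightarrow> 'a" where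
  "toeplitz c i j = (if i \<le> j then c (j - i) else 0)"

definition entries :: "'a mat \<Rightarrow> nat \<Rightarrow> nat \<Rightarrow> 'a" where
  "entries A i j = A $$ (i, j)"

definition truncation :: "nat \<Rightarrow> (nat \<Rightarrow> nat \<Rightarrow> 'a) \<Rightarrow> 'a mat" where
  "truncation N U = mat N N (\<lambda>(i, j). U i j)"

definition UToep :: "nat \<Rightarrow> 'a::{zero,one} mat set" where
  "UToep N = {truncation N (toeplitz c) | c. c 0 = 1}"

definition Minor :: "(nat \<Rightarrow> nat \<Rightarrow> 'a::comm_ring_1) \<Rightarrow> nat set \<Rightarrow> nat set \<Rightarrow> 'a" where
  "Minor U I J =
     Determinant.det (mat (card I) (card J)
       (\<lambda>(a, b). U (sorted_list_of_set I ! a) (sorted_list_of_set J ! b)))"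

text \<open>The index set \<open>D\<close> is \<open>UNIV\<close> for infinite matrices and \<open>{..<N}\<close> for \<open>N \<times> N\<close> matrices.\<close>

definition upper_unipotent :: "nat set \<Rightarrow> (nat \<Rightarrow> nat \<Rightarrow> real) \<Rightarrow> bool" where
  "upper_unipotent D U \<longleftrightarrow> (\<forall>i\<in>D. U i i = 1) \<and> (\<forall>i\<in>D. \<forall>j\<in>D. j < i \<longrightarrow> U i j = 0)"

definition totally_positive :: "nat set \<Rightarrow> (nat \<Rightarrow> nat \<Rightarrow> real) \<Rightarrow> bool" where
  "totally_positive D U \<longleftrightarrow> upper_unipotent D U \<and>
     (\<forall>I J. finite I \<and> finite J \<and> I \<subseteq> D \<and> J \<subseteq> D \<and> card I = card J
        \<and> (\<exists>B. upper_unipotent D B \<and> Minor B I J \<noteq> 0) \<longrightarrow> Minor U I J > 0)"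

text \<open>\<open>\<alpha> i\<close> and \<open>\<beta> i\<close> stand for the parameters with subscript \<open>i + 1\<close>.  The generating function
  identity is required on some disc around 0, i.e. as an identity of germs.\<close>

definition schoenberg_parameters ::
    "(nat \<Rightarrow> real) \<Rightarrow> real \<Rightarrow> (nat \<Rightarrow> real) \<Rightarrow> (nat \<Rightarrow> real) \<Rightarrow> bool" where
  "schoenberg_parameters c \<gamma> \<alpha> \<beta> \<longleftrightarrow>
     0 \<le> \<gamma> \<and>
     (\<forall>i. 0 \<le> \<alpha> i) \<and> decseq \<alpha> \<and> summable \<alpha> \<and>
     (\<forall>i. 0 \<le> \<beta> i) \<and> decseq \<beta> \<and> summable \<beta> \<and>
     (\<exists>r>0. \<forall>z::complex. norm z < r \<longrightarrow>
        (\<exists>P. (\<lambda>i. (1 + of_real (\<beta> i) * z) / (1 - of_real (\<alpha> i) * z)) has_prod P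
           \<and> (\<lambda>k. of_real (c k) * z ^ k) sums (exp (of_real \<gamma> * z) * P)))"

definition utoep_dist :: "nat \<Rightarrow> real mat \<Rightarrow> real mat \<Rightarrow> real" where
  "utoep_dist n A B = L2_set (\<lambda>k. A $$ (0, k) - B $$ (0, k)) {1..n}"

definition converges_uniformly :: "(nat \<Rightarrow> real mat) \<Rightarrow> (nat \<Rightarrow> nat \<Rightarrow> real) \<Rightarrow> bool" where
  "converges_uniformly u U \<longleftrightarrow>
     (\<forall>\<epsilon>>0. \<exists>N. \<forall>n>N. utoep_dist n (u n) (truncation (n + 1) U) < \<epsilon>)"

section \<open>Multivariate polynomials\<close>

type_synonym 'v cpoly = "('v \<Rightarrow>\<^sub>0 nat) \<Rightarrow>\<^sub>0 complex"

definition cvar :: "'v \<Rightarrow> 'v cpoly" where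
  "cvar v = Poly_Mapping.single (Poly_Mapping.single v 1) 1"

definition cconst :: "complex \<Rightarrow> 'v cpoly" where
  "cconst a = Poly_Mapping.single 0 a"

definition cvars :: "'v cpoly \<Rightarrow> 'v set" where
  "cvars p = (\<Union>m\<in>Poly_Mapping.keys p. Poly_Mapping.keys m)"

definition cpoly_eval :: "('v \<Rightarrow> complex) \<Rightarrow> 'v cpoly \<Rightarrow> complex" where
  "cpoly_eval f p =
     (\<Sum>m\<in>Poly_Mapping.keys p. Poly_Mapping.lookup p m *
        (\<Prod>v\<in>Poly_Mapping.keys m. f v ^ Poly_Mapping.lookup m v))"

section \<open>Classical Schubert polynomials\<close>

text \<open>The classical variables are \<open>cvar 1, cvar 2, \<dots> :: nat cpoly\<close>.  Elements of the infinite
  symmetric group are functions \<open>nat \<Rightarrow> nat\<close> permuting some \<open>{1..N}\<close>.\<close>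

definition swap_vars :: "nat \<Rightarrow> nat cpoly \<Rightarrow> nat cpoly" where
  "swap_vars i p =
     Poly_Mapping.map_key (Poly_Mapping.map_key (Transposition.transpose i (Suc i))) p"

definition divdiff :: "nat \<Rightarrow> nat cpoly \<Rightarrow> nat cpoly" where
  "divdiff i p = (THE g. (cvar i - cvar (Suc i)) * g = p - swap_vars i p)"

definition longest :: "nat \<Rightarrow> nat \<Rightarrow> nat" where
  "longest N i = (if i \<in> {1..N} then N + 1 - i else i)"

inductive schubert_in :: "nat \<Rightarrow> (nat \<Rightarrow> nat) \<Rightarrow> nat cpoly \<Rightarrow> bool" for N where
  longest: "schubert_in N (longest N) (\<Prod>i\<in>{1..N}. cvar i ^ (N - i))"
| descent: "\<lbrakk>schubert_in N w p; 1 \<le> i; i < N; w i > w (Suc i)\<rbrakk>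
    \<Longrightarrow> schubert_in N (w \<circ> Transposition.transpose i (Suc i)) (divdiff i p)"

definition schubert :: "(nat \<Rightarrow> nat) \<Rightarrow> nat cpoly" where
  "schubert w = (THE p. \<exists>N. w permutes {1..N} \<and> schubert_in N w p)"

section \<open>Quantum Schubert polynomials\<close>

text \<open>\<open>QInv k\<close> is the inverse of the quantum parameter \<open>Q k\<close>; it occurs only in the localised
  quantum cohomology ring.\<close>

datatype qvar = X nat | Q nat | QInv nat

definition esym :: "nat \<Rightarrow> nat \<Rightarrow> nat cpoly" where
  "esym i k = (\<Sum>S | S \<subseteq> {1..k} \<and> card S = i. \<Prod>j\<in>S. cvar j)"

definition Gmat :: "nat \<Rightarrow> qvar cpoly mat" where
  "Gmat k = mat k k (\<lambda>(a, b).
     if a = b then cvar (X (a + 1))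
     else if b = a + 1 then cvar (Q (a + 1))
     else if a = b + 1 then - 1
     else 0)"

definition qesym :: "nat \<Rightarrow> nat \<Rightarrow> qvar cpoly" where
  "qesym i k =
     Polynomial.coeff
       (Determinant.det (1\<^sub>m k + [:0, 1:] \<cdot>\<^sub>m map_mat (\<lambda>g. [:g:]) (Gmat k))) i"

text \<open>A linear combination of the products \<open>e_{i_1}(x_1) e_{i_2}(x_1,x_2) \<cdots>\<close> is encoded by its
  finitely supported coefficient family, indexed by the finitely supported sequences
  \<open>\<iota> = (i_1, i_2, \<dots>)\<close> with \<open>i_k \<le> k\<close>; the factors with \<open>i_k = 0\<close> equal 1.\<close>

definition e_indices :: "(nat \<Rightarrow>\<^sub>0 nat) set" where
  "e_indices = {\<iota>. \<forall>k. Poly_Mapping.lookup \<iota> k \<le> k}"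

definition e_combination ::
    "(nat \<Rightarrow> nat \<Rightarrow> 'v cpoly) \<Rightarrow> ((nat \<Rightarrow>\<^sub>0 nat) \<Rightarrow>\<^sub>0 complex) \<Rightarrow> 'v cpoly" where
  "e_combination e a =
     (\<Sum>\<iota>\<in>Poly_Mapping.keys a. cconst (Poly_Mapping.lookup a \<iota>) *
        (\<Prod>k\<in>Poly_Mapping.keys \<iota>. e (Poly_Mapping.lookup \<iota> k) k))"

definition e_coeffs :: "nat cpoly \<Rightarrow> (nat \<Rightarrow>\<^sub>0 nat) \<Rightarrow>\<^sub>0 complex" where
  "e_coeffs p = (THE a. Poly_Mapping.keys a \<subseteq> e_indices \<and> e_combination esym a = p)"

definition quantum_schubert :: "(nat \<Rightarrow> nat) \<Rightarrow> qvar cpoly" where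
  "quantum_schubert w = e_combination qesym (e_coeffs (schubert w))"

section \<open>Quantum cohomology of the flag variety\<close>

text \<open>The ring \<open>qH*(Fl_{n+1})[q_1\<inverse>,\<dots>,q_n\<inverse>]\<close> as the quotient of
  \<open>C[x_1,\<dots>,x_{n+1}; q_1,\<dots>,q_n; t_1,\<dots>,t_n]\<close> by the ideal generated by the
  \<open>E_i^{(n+1)}\<close> and \<open>q_k t_k - 1\<close>, where \<open>t_k = QInv k\<close>.\<close>

definition qpoly_ring :: "nat \<Rightarrow> qvar cpoly ring" where
  "qpoly_ring n =
     \<lparr>carrier = {p. cvars p \<subseteq> X ` {1..n+1} \<union> Q ` {1..n} \<union> QInv ` {1..n}},
      monoid.mult = (*), one = 1, zero = 0, add = (+)\<rparr>"

definition qH_ideal :: "nat \<Rightarrow> qvar cpoly set" where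
  "qH_ideal n = genideal (qpoly_ring n)
     ((\<lambda>i. qesym i (n + 1)) ` {1..n+1} \<union> (\<lambda>k. cvar (Q k) * cvar (QInv k) - 1) ` {1..n})"

definition qH_loc :: "nat \<Rightarrow> qvar cpoly set ring" where
  "qH_loc n = qpoly_ring n Quot qH_ideal n"

definition schubert_class :: "nat \<Rightarrow> (nat \<Rightarrow> nat) \<Rightarrow> qvar cpoly set" where
  "schubert_class n w = qH_ideal n +>\<^bsub>qpoly_ring n\<^esub> quantum_schubert w"

section \<open>The Peterson isomorphism\<close>

definition Delta :: "nat \<Rightarrow> nat \<Rightarrow> 'a::comm_ring_1 mat \<Rightarrow> 'a" where
  "Delta n i u = Minor (entries u) {..<i} {n + 1 - i..<n + 1}"

text \<open>Elements of \<open>C[UToep_{n+1}(C)][\<Delta>_1\<inverse>,\<dots>,\<Delta>_n\<inverse>]\<close> are represented by functions on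
  the following open set.\<close>

definition UToep_open :: "nat \<Rightarrow> complex mat set" where
  "UToep_open n = {u \<in> UToep (n + 1). \<forall>i\<in>{1..n}. Delta n i u \<noteq> 0}"

text \<open>The value at \<open>u\<close> of the image of \<open>\<sigma>\<close> of the \<open>k\<close>-th simple transposition, extended by 0 to
  \<open>k = 0\<close> and to \<open>k = n + 1\<close>: the latter because \<open>x_1 + \<cdots> + x_{n+1} = E_1^{(n+1)}\<close>
  vanishes in the quantum cohomology ring.\<close>

definition divisor_image :: "nat \<Rightarrow> complex mat \<Rightarrow> nat \<Rightarrow> complex" where
  "divisor_image n u k =
     (if k \<in> {1..n}
      then Minor (entries u) ({..<k - 1} \<union> {k}) {n + 1 - k..<n + 1} / Delta n k u
      else 0)"

fun gen_image :: "nat \<Rightarrow> complex mat \<Rightarrow> qvar \<Rightarrow> complex" where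
  "gen_image n u (X k) = divisor_image n u k - divisor_image n u (k - 1)"
| "gen_image n u (Q k) = Delta n (k + 1) u * Delta n (k - 1) u / (Delta n k u)\<^sup>2"
| "gen_image n u (QInv k) = inverse (Delta n (k + 1) u * Delta n (k - 1) u / (Delta n k u)\<^sup>2)"

definition peterson_lift :: "nat \<Rightarrow> qvar cpoly \<Rightarrow> complex mat \<Rightarrow> complex" where
  "peterson_lift n p = restrict (\<lambda>u. cpoly_eval (gen_image n u) p) (UToep_open n)"

text \<open>The map induced by \<open>peterson_lift n\<close> on the cosets that form the carrier of \<open>qH_loc n\<close>.\<close>

definition peterson :: "nat \<Rightarrow> qvar cpoly set \<Rightarrow> complex mat \<Rightarrow> complex" where
  "peterson n A = the_elem (peterson_lift n ` A)"

definition schubert_fun :: "nat \<Rightarrow> (nat \<Rightarrow> nat) \<Rightarrow> complex mat \<Rightarrow> complex" where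
  "schubert_fun n w = peterson n (schubert_class n w)"

end

theory Submission
  imports Defs "HOL-Complex_Analysis.Complex_Analysis"
begin

text \<open>
  Let \<open>Z k m\<close> be the \<open>k \<times> k\<close> minor of a Toeplitz matrix with entries \<open>c_{m+b-a}\<close>.  On the locus
  where the Peterson isomorphism lives, \<open>\<Delta>_k = Z k (n+1-k)\<close>, the characteristic polynomials \<open>G_k\<close>
  of the tridiagonal matrices in the \<open>x_i, q_i\<close> are orthogonal polynomials for the moments \<open>c_{n-m}\<close>,
  and \<open>G_k(0) = Z k (n-k) / Z k (n+1-k)\<close>.  So the quantum generators are controlled by the ratios
  \<open>Z k (m+1) / Z k m\<close>.  For the limit matrix, comparison of the poles of the generating function at
  \<open>1/\<alpha>_1, 1/\<alpha>_2, \<dots>\<close> shows that these ratios tend to \<open>\<alpha>_1 \<cdots> \<alpha>_k\<close> as \<open>m \<rightarrow> \<infinity>\<close>.  For the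
  approximating matrices they decrease in \<open>m\<close> up to the corner, and Desnanot--Jacobi together with the strict
  inequality \<open>\<alpha>_k > \<alpha>_{k+1}\<close> forces their decrements to decay geometrically, so the ratio at the
  corner has the same limit.  Hence \<open>q_k \<rightarrow> 0\<close> and \<open>x_k \<rightarrow> 1/\<alpha>_k\<close>, and the quantum Schubert polynomials become
  the classical ones.

  For the conjugate permutation, the expansion of a Schubert polynomial in products of elementary
  symmetric polynomials is obtained by applying divided differences to a top double Schubert polynomial.
  Modulo the relation \<open>G_{n+1} = t^{n+1}\<close>, replacing the word \<open>s_j\<close> by \<open>s_{n+1-j}\<close> has the same effect as
  the substitution \<open>x_k \<mapsto> -x_{n+2-k}\<close>, \<open>q_k \<mapsto> q_{n+1-k}\<close>.  This exchanges \<open>Z k m\<close> with \<open>Z m k\<close>,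
  that is, \<open>\<alpha>\<close> with \<open>\<beta>\<close>.
\<close>

section \<open>Evaluation and divided differences\<close>

text \<open>Convergence to the limit matrix controls \<open>Z k m\<close> for fixed \<open>k\<close>
  and \<open>m\<close> only, while the Peterson generators live at the corner, where
  \<open>k + m\<close> is about \<open>n + 1\<close> and \<open>m\<close> grows with
  \<open>n\<close>. Positivity of the finite matrices bridges this gap: it makes the decrements of
  the ratios nonnegative, and the quotient of successive decrements is close to \<alpha>_{k+1} /
  \<alpha>_k < 1. So an index where the limit ratios have settled is fixed first, and
  \<open>n\<close> tends to infinity afterwards. The value of q_k is the last decrement times
  bounded ratios, which is why it tends to 0. The conjugates of \<open>w\<close>, and with them
  their expansions, vary with \<open>n\<close>; duality rewrites their values through the fixed
  expansion of \<open>w\<close>. Working modulo t^(n+1) is legitimate since the functional "divided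
  differences in y_1, ..., y_{n+1}, then y = 0" kills the ideal of symmetric polynomials without
  constant term, which contains every y_j^(n+1). Analytically \<alpha> and \<beta> change places
  because 1 / C(-z) has the same product form as the generating function C(z), with the parameters
  exchanged, and its coefficients are the minors \<open>Z m 1\<close>.\<close>

definition mon_eval :: "('v \<Rightarrow> complex) \<Rightarrow> ('v \<Rightarrow>\<^sub>0 nat) \<Rightarrow> complex" where
  "mon_eval f m = (\<Prod>v\<in>Poly_Mapping.keys m. f v ^ Poly_Mapping.lookup m v)"

lemma mon_eval_superset:
  assumes "finite V" "Poly_Mapping.keys m \<subseteq> V"
  shows "mon_eval f m = (\<Prod>v\<in>V. f v ^ Poly_Mapping.lookup m v)"
  unfolding mon_eval_def
  by (rule prod.mono_neutral_left) (use assms in \<open>auto simp: in_keys_iff\<close>)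

lemma mon_eval_0 [simp]: "mon_eval f 0 = 1"
  by (simp add: mon_eval_def)

lemma mon_eval_single [simp]: "mon_eval f (Poly_Mapping.single v n) = f v ^ n"
  by (simp add: mon_eval_def)

lemma mon_eval_add: "mon_eval f (m + m') = mon_eval f m * mon_eval f m'"
proof -
  let ?V = "Poly_Mapping.keys m \<union> Poly_Mapping.keys m'"
  have "mon_eval f (m + m') = (\<Prod>v\<in>?V. f v ^ Poly_Mapping.lookup (m + m') v)"
    by (rule mon_eval_superset) (auto simp: keys_add)
  also have "\<dots> = (\<Prod>v\<in>?V. f v ^ Poly_Mapping.lookup m v) * (\<Prod>v\<in>?V. f v ^ Poly_Mapping.lookup m' v)"
    by (simp add: lookup_add power_add prod.distrib)
  also have "\<dots> = mon_eval f m * mon_eval f m'"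
    by (simp add: mon_eval_superset[of ?V])
  finally show ?thesis .
qed

lemma cpoly_eval_superset:
  assumes "finite K" "Poly_Mapping.keys p \<subseteq> K"
  shows "cpoly_eval f p = (\<Sum>m\<in>K. Poly_Mapping.lookup p m * mon_eval f m)"
  unfolding cpoly_eval_def mon_eval_def
  by (rule sum.mono_neutral_left) (use assms in \<open>auto simp: in_keys_iff\<close>)

lemma cpoly_eval_0 [simp]: "cpoly_eval f 0 = 0"
  by (simp add: cpoly_eval_def)

lemma cpoly_eval_single [simp]: "cpoly_eval f (Poly_Mapping.single m a) = a * mon_eval f m"
  by (simp add: cpoly_eval_def mon_eval_def)

lemma cpoly_eval_cvar [simp]: "cpoly_eval f (cvar v) = f v"
  by (simp add: cvar_def)

lemma cpoly_eval_cconst [simp]: "cpoly_eval f (cconst a) = a"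
  by (simp add: cconst_def)

lemma cpoly_eval_add [simp]: "cpoly_eval f (p + q) = cpoly_eval f p + cpoly_eval f q"
proof -
  let ?K = "Poly_Mapping.keys p \<union> Poly_Mapping.keys q"
  show ?thesis
    using cpoly_eval_superset[of ?K "p + q" f] cpoly_eval_superset[of ?K p f]
      cpoly_eval_superset[of ?K q f]
    by (simp add: keys_add lookup_add ring_distribs sum.distrib)
qed

lemma cpoly_eval_uminus [simp]: "cpoly_eval f (- p) = - cpoly_eval f p"
  using cpoly_eval_add[of f p "- p"] by (simp add: eq_neg_iff_add_eq_0 add.commute del: cpoly_eval_add)

lemma cpoly_eval_diff [simp]: "cpoly_eval f (p - q) = cpoly_eval f p - cpoly_eval f q"
  using cpoly_eval_add[of f p "- q"] by simp

lemma cpoly_eval_sum [simp]: "cpoly_eval f (\<Sum>i\<in>I. p i) = (\<Sum>i\<in>I. cpoly_eval f (p i))"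
  by (induction I rule: infinite_finite_induct) auto

lemma poly_mapping_sum_single:
  "p = (\<Sum>m\<in>Poly_Mapping.keys p. Poly_Mapping.single m (Poly_Mapping.lookup p m))"
  by (rule poly_mapping_eqI) (auto simp: lookup_sum lookup_single when_def in_keys_iff)

lemma cpoly_eval_mult [simp]: "cpoly_eval f (p * q) = cpoly_eval f p * cpoly_eval f q"
proof -
  have "cpoly_eval f (p * q)
      = cpoly_eval f ((\<Sum>m\<in>Poly_Mapping.keys p. Poly_Mapping.single m (Poly_Mapping.lookup p m))
          * (\<Sum>m\<in>Poly_Mapping.keys q. Poly_Mapping.single m (Poly_Mapping.lookup q m)))"
    using poly_mapping_sum_single[of p] poly_mapping_sum_single[of q] by simp
  also have "\<dots> = (\<Sum>m\<in>Poly_Mapping.keys p. \<Sum>m'\<in>Poly_Mapping.keys q.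
      (Poly_Mapping.lookup p m * mon_eval f m) * (Poly_Mapping.lookup q m' * mon_eval f m'))"
    by (simp add: sum_product mult_single mon_eval_add algebra_simps)
  also have "\<dots> = cpoly_eval f p * cpoly_eval f q"
    by (simp add: cpoly_eval_def mon_eval_def sum_product)
  finally show ?thesis .
qed

lemma cpoly_eval_1 [simp]: "cpoly_eval f 1 = 1"
  using cpoly_eval_single[of f 0 1] by simp

lemma cpoly_eval_prod [simp]: "cpoly_eval f (\<Prod>i\<in>I. p i) = (\<Prod>i\<in>I. cpoly_eval f (p i))"
  by (induction I rule: infinite_finite_induct) auto

lemma cpoly_eval_power [simp]: "cpoly_eval f (p ^ n) = cpoly_eval f p ^ n"
  by (induction n) auto

lemma cvar_power: "cvar v ^ n = Poly_Mapping.single (Poly_Mapping.single v n) 1"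
  by (induction n) (auto simp: cvar_def mult_single simp flip: single_add)

lemma cpoly_induct [case_names const var add mult]:
  assumes const: "\<And>a. P (cconst a)" and var: "\<And>v. P (cvar v)"
    and add: "\<And>p q. P p \<Longrightarrow> P q \<Longrightarrow> P (p + q)"
    and mult: "\<And>p q. P p \<Longrightarrow> P q \<Longrightarrow> P (p * q)"
  shows "P p"
proof -
  have one: "P 1" using const[of 1] by (simp add: cconst_def)
  have zero: "P 0" using const[of 0] by (simp add: cconst_def)
  have pow: "P (cvar v ^ n)" for v n
    by (induction n) (auto intro: one var mult)
  have prd: "P (\<Prod>v\<in>V. g v)" if "\<And>v. P (g v)" for V :: "'a set" and g
    by (induction V rule: infinite_finite_induct) (auto intro: one mult that)
  have sm: "P (\<Sum>m\<in>K. g m)" if "\<And>m. P (g m)" for K :: "('a \<Rightarrow>\<^sub>0 nat) set" and g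
    by (induction K rule: infinite_finite_induct) (auto intro: zero add that)
  have mon: "Poly_Mapping.single (\<Sum>v\<in>V. Poly_Mapping.single v (g v)) 1
      = (\<Prod>v\<in>V. cvar v ^ g v)" for V :: "'a set" and g
  proof (induction V rule: infinite_finite_induct)
    case (insert x F)
    have "Poly_Mapping.single (Poly_Mapping.single x (g x) + (\<Sum>v\<in>F. Poly_Mapping.single v (g v))) 1
        = Poly_Mapping.single (Poly_Mapping.single x (g x)) 1
          * (Poly_Mapping.single (\<Sum>v\<in>F. Poly_Mapping.single v (g v)) 1 :: 'a cpoly)"
      by (simp add: mult_single)
    with insert show ?case by (simp add: cvar_power)
  qed auto
  have "Poly_Mapping.single m a = cconst a * (\<Prod>v\<in>Poly_Mapping.keys m. cvar v ^ Poly_Mapping.lookup m v)"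
    for m :: "'a \<Rightarrow>\<^sub>0 nat" and a
    by (simp add: cconst_def mult_single flip: mon poly_mapping_sum_single)
  then have "P (Poly_Mapping.single m a)" for m a
    by (auto intro!: mult const prd pow)
  then show ?thesis
    by (subst poly_mapping_sum_single) (rule sm)
qed

text \<open>Over an infinite field a polynomial function determines its coefficients. With all
  variables but \<open>v\<close> fixed, the univariate polynomial \<open>q\<close> vanishes
  everywhere, so each degree in \<open>v\<close> can be treated separately.\<close>

lemma mon_sum_eq_0_imp_coeff_eq_0:
  assumes "finite V" "finite K"
    and "\<And>m m'. \<lbrakk>m \<in> K; m' \<in> K; \<And>v. v \<in> V \<Longrightarrow> Poly_Mapping.lookup m v = Poly_Mapping.lookup m' v\<rbrakk> \<Longrightarrow> m = m'"
    and "\<And>f. (\<Sum>m\<in>K. c m * (\<Prod>v\<in>V. f v ^ Poly_Mapping.lookup m v)) = (0::complex)"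
    and "m \<in> K"
  shows "c m = 0"
  using assms
proof (induction V arbitrary: K m rule: finite_induct)
  case empty
  then have "K = {m}" by blast
  with empty.prems(3)[of undefined] show ?case by simp
next
  case (insert v V)
  let ?d = "Poly_Mapping.lookup m v"
  let ?K = "{m'\<in>K. Poly_Mapping.lookup m' v = ?d}"
  have "(\<Sum>m\<in>?K. c m * (\<Prod>v\<in>V. f v ^ Poly_Mapping.lookup m v)) = 0" for f
  proof -
    define q where "q = (\<Sum>m\<in>K. Polynomial.monom (c m * (\<Prod>v\<in>V. f v ^ Poly_Mapping.lookup m v)) (Poly_Mapping.lookup m v))"
    have "poly q t = 0" for t
    proof -
      have "(\<Prod>w\<in>V. (f(v := t)) w ^ Poly_Mapping.lookup m w) = (\<Prod>w\<in>V. f w ^ Poly_Mapping.lookup m w)" for m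
        by (rule prod.cong) (use insert.hyps in auto)
      with insert.prems(3)[of "f(v := t)"] insert.hyps show ?thesis
        by (simp add: q_def poly_sum poly_monom mult_ac)
    qed
    then have "q = 0" using poly_all_0_iff_0 by blast
    then have "Polynomial.coeff q ?d = 0" by simp
    then have "(\<Sum>m\<in>K. if Poly_Mapping.lookup m v = ?d then c m * (\<Prod>v\<in>V. f v ^ Poly_Mapping.lookup m v) else 0) = 0"
      by (simp add: q_def coeff_sum)
    then show ?thesis
      using insert.prems(1) by (simp add: sum.inter_filter)
  qed
  note sum0 = this
  show ?case
  proof (rule insert.IH[OF _ _ sum0])
    show "m = m'" if "m \<in> ?K" "m' \<in> ?K"
      "\<And>v. v \<in> V \<Longrightarrow> Poly_Mapping.lookup m v = Poly_Mapping.lookup m' v" for m m'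
      by (rule insert.prems(2)) (use that in auto)
  qed (use insert.prems in auto)
qed

lemma cpoly_eval_eq_0_imp_eq_0:
  assumes "\<And>f. cpoly_eval f p = 0"
  shows "p = 0"
proof (rule poly_mapping_eqI)
  fix m
  define V where "V = (\<Union>m\<in>Poly_Mapping.keys p. Poly_Mapping.keys m)"
  have V: "finite V" "\<And>m. m \<in> Poly_Mapping.keys p \<Longrightarrow> Poly_Mapping.keys m \<subseteq> V"
    by (auto simp: V_def)
  have "Poly_Mapping.lookup p m = 0" if "m \<in> Poly_Mapping.keys p"
  proof (rule mon_sum_eq_0_imp_coeff_eq_0[of V "Poly_Mapping.keys p"])
    show "m = m'" if "m \<in> Poly_Mapping.keys p" "m' \<in> Poly_Mapping.keys p"
      "\<And>v. v \<in> V \<Longrightarrow> Poly_Mapping.lookup m v = Poly_Mapping.lookup m' v" for m m'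
    proof (rule poly_mapping_eqI)
      fix v
      show "Poly_Mapping.lookup m v = Poly_Mapping.lookup m' v"
        using that V(2)[OF that(1)] V(2)[OF that(2)]
        by (metis not_in_keys_iff_lookup_eq_zero subsetD)
    qed
    show "(\<Sum>m\<in>Poly_Mapping.keys p. Poly_Mapping.lookup p m * (\<Prod>v\<in>V. f v ^ Poly_Mapping.lookup m v)) = 0" for f
    proof -
      have "cpoly_eval f p = (\<Sum>m\<in>Poly_Mapping.keys p. Poly_Mapping.lookup p m * mon_eval f m)"
        by (rule cpoly_eval_superset) auto
      also have "\<dots> = (\<Sum>m\<in>Poly_Mapping.keys p. Poly_Mapping.lookup p m * (\<Prod>v\<in>V. f v ^ Poly_Mapping.lookup m v))"
        by (rule sum.cong) (auto simp: mon_eval_superset[OF V])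
      finally show ?thesis using assms by simp
    qed
  qed (use V that in auto)
  then show "Poly_Mapping.lookup p m = Poly_Mapping.lookup 0 m"
    by (auto simp: in_keys_iff)
qed

text \<open>Lets polynomial identities be checked pointwise, where \<open>swap_vars\<close> is just
  composition of the point with a transposition.\<close>

lemma cpoly_eqI:
  assumes "\<And>f. cpoly_eval f p = cpoly_eval f q"
  shows "p = q"
  using cpoly_eval_eq_0_imp_eq_0[of "p - q"] assms by simp

text \<open>Substitution of polynomials for variables, stated as existence of a polynomial with the
  substituted values; it supplies the reflected quotient in
  \<open>foldr_divdiff_reflect\<close>.\<close>

lemma cpoly_subst_exists:
  assumes "\<And>v. \<exists>q. \<forall>f. cpoly_eval f q = \<sigma> f v"
  shows "\<exists>q. \<forall>f. cpoly_eval f q = cpoly_eval (\<sigma> f) p"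
proof (induction p rule: cpoly_induct)
  case (const a)
  show ?case by (rule exI[of _ "cconst a"]) simp
next
  case (var v)
  show ?case using assms by simp
next
  case (add p q)
  then obtain p' q' where "\<forall>f. cpoly_eval f p' = cpoly_eval (\<sigma> f) p"
    "\<forall>f. cpoly_eval f q' = cpoly_eval (\<sigma> f) q" by blast
  then show ?case by (intro exI[of _ "p' + q'"]) simp
next
  case (mult p q)
  then obtain p' q' where "\<forall>f. cpoly_eval f p' = cpoly_eval (\<sigma> f) p"
    "\<forall>f. cpoly_eval f q' = cpoly_eval (\<sigma> f) q" by blast
  then show ?case by (intro exI[of _ "p' * q'"]) simp
qed

section \<open>Divided differences and their commutation and braid relations\<close>

abbreviation adj_transp :: "nat \<Rightarrow> nat \<Rightarrow> nat" where
  "adj_transp i \<equiv> Transposition.transpose i (Suc i)"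

lemma lookup_map_key_transp:
  "Poly_Mapping.lookup (Poly_Mapping.map_key (adj_transp i) m) v = Poly_Mapping.lookup m (adj_transp i v)"
  by (simp add: map_key.rep_eq)

lemma map_key_transp_involution [simp]:
  "Poly_Mapping.map_key (adj_transp i) (Poly_Mapping.map_key (adj_transp i) m) = m"
  by (rule poly_mapping_eqI) (simp add: lookup_map_key_transp)

lemma inj_map_key_transp:
  "inj (Poly_Mapping.map_key (adj_transp i) :: (nat \<Rightarrow>\<^sub>0 nat) \<Rightarrow> (nat \<Rightarrow>\<^sub>0 nat))"
  by (rule inj_on_inverseI[where g = "Poly_Mapping.map_key (adj_transp i)"]) simp

lemma mon_eval_map_key_transp:
  "mon_eval f (Poly_Mapping.map_key (adj_transp i) m) = mon_eval (f \<circ> adj_transp i) m"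
  unfolding mon_eval_def
  by (rule prod.reindex_bij_witness[of _ "adj_transp i" "adj_transp i"])
     (auto simp: in_keys_iff lookup_map_key_transp)

lemma cpoly_eval_swap_vars [simp]:
  "cpoly_eval f (swap_vars i p) = cpoly_eval (f \<circ> adj_transp i) p"
proof -
  let ?t = "Poly_Mapping.map_key (adj_transp i) :: (nat \<Rightarrow>\<^sub>0 nat) \<Rightarrow> (nat \<Rightarrow>\<^sub>0 nat)"
  have lk: "Poly_Mapping.lookup (swap_vars i p) m = Poly_Mapping.lookup p (?t m)" for m
    using inj_map_key_transp[of i] by (simp add: swap_vars_def map_key.rep_eq)
  have "cpoly_eval f (swap_vars i p)
      = (\<Sum>m\<in>Poly_Mapping.keys (swap_vars i p). Poly_Mapping.lookup (swap_vars i p) m * mon_eval f m)"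
    by (rule cpoly_eval_superset) auto
  also have "\<dots> = (\<Sum>m\<in>Poly_Mapping.keys p. Poly_Mapping.lookup p m * mon_eval (f \<circ> adj_transp i) m)"
    by (rule sum.reindex_bij_witness[of _ ?t ?t])
       (auto simp: in_keys_iff lk simp flip: mon_eval_map_key_transp)
  also have "\<dots> = cpoly_eval (f \<circ> adj_transp i) p"
    by (rule cpoly_eval_superset[symmetric]) auto
  finally show ?thesis .
qed

lemma swap_vars_add: "swap_vars i (p + q) = swap_vars i p + swap_vars i q"
  by (rule cpoly_eqI) simp

lemma swap_vars_diff: "swap_vars i (p - q) = swap_vars i p - swap_vars i q"
  by (rule cpoly_eqI) simp

lemma swap_vars_mult: "swap_vars i (p * q) = swap_vars i p * swap_vars i q"
  by (rule cpoly_eqI) simp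

lemma swap_vars_cvar: "swap_vars i (cvar v) = cvar (adj_transp i v)"
  by (rule cpoly_eqI) simp

lemma cvar_eq_iff [simp]: "cvar v = cvar w \<longleftrightarrow> v = w"
proof
  assume "cvar v = cvar w"
  then have "cpoly_eval (\<lambda>x. if x = v then 1 else 0) (cvar v) = cpoly_eval (\<lambda>x. if x = v then 1 else 0) (cvar w)"
    by simp
  then show "v = w" by (simp split: if_splits)
qed auto

text \<open>Divisibility is clear for constants and variables, additive, and passes to products by
  the twisted Leibniz rule d(pq) = d(p) q + s(p) d(q).\<close>

lemma divdiff_exists: "\<exists>g. (cvar i - cvar (Suc i)) * g = p - swap_vars i p"
proof (induction p rule: cpoly_induct)
  case (const a)
  have "swap_vars i (cconst a) = cconst a" by (rule cpoly_eqI) simp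
  then show ?case by (intro exI[of _ 0]) simp
next
  case (var v)
  show ?case
  proof (cases "v = i \<or> v = Suc i")
    case True
    then show ?thesis
    proof
      assume "v = i" then show ?thesis by (intro exI[of _ 1]) (simp add: swap_vars_cvar)
    next
      assume "v = Suc i" then show ?thesis by (intro exI[of _ "- 1"]) (simp add: swap_vars_cvar)
    qed
  next
    case False
    then show ?thesis by (intro exI[of _ 0]) (simp add: swap_vars_cvar transpose_eq_iff)
  qed
next
  case (add p q)
  then obtain g h where "(cvar i - cvar (Suc i)) * g = p - swap_vars i p"
    "(cvar i - cvar (Suc i)) * h = q - swap_vars i q" by blast
  then show ?case by (intro exI[of _ "g + h"]) (simp add: swap_vars_add distrib_left)
next
  case (mult p q)
  then obtain g h where gh: "(cvar i - cvar (Suc i)) * g = p - swap_vars i p"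
    "(cvar i - cvar (Suc i)) * h = q - swap_vars i q" by blast
  have "(cvar i - cvar (Suc i)) * (g * q + swap_vars i p * h)
      = ((cvar i - cvar (Suc i)) * g) * q + swap_vars i p * ((cvar i - cvar (Suc i)) * h)"
    by (simp add: algebra_simps)
  also have "\<dots> = p * q - swap_vars i (p * q)"
    unfolding gh by (simp add: swap_vars_mult algebra_simps)
  finally show ?case by blast
qed

lemma cvar_diff_mult_cancel:
  fixes g h :: "nat cpoly"
  assumes "(cvar i - cvar (Suc i)) * g = (cvar i - cvar (Suc i)) * h"
  shows "g = h"
  using assms by simp

text \<open>Justifies the definite description in \<open>divdiff\<close>: existence is the previous
  construction, uniqueness is cancellation in an integral domain.\<close>

lemma divdiff_eq: "(cvar i - cvar (Suc i)) * divdiff i p = p - swap_vars i p"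
  unfolding divdiff_def
  by (rule theI', rule ex_ex1I, rule divdiff_exists, rule cvar_diff_mult_cancel[of i]) simp

lemma divdiff_unique:
  assumes "(cvar i - cvar (Suc i)) * g = p - swap_vars i p"
  shows "divdiff i p = g"
  using assms divdiff_eq[of i p] cvar_diff_mult_cancel by metis

lemma divdiff_eval:
  "(f i - f (Suc i)) * cpoly_eval f (divdiff i p) = cpoly_eval f p - cpoly_eval (f \<circ> adj_transp i) p"
  using arg_cong[OF divdiff_eq[of i p], of "cpoly_eval f"] by simp

lemma divdiff_unique_eval:
  assumes "\<And>f. (f i - f (Suc i)) * cpoly_eval f g = cpoly_eval f p - cpoly_eval (f \<circ> adj_transp i) p"
  shows "divdiff i p = g"
  by (rule divdiff_unique, rule cpoly_eqI) (use assms in simp)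

lemma divdiff_add: "divdiff i (p + q) = divdiff i p + divdiff i q"
  by (rule divdiff_unique_eval) (simp add: distrib_left divdiff_eval)

lemma divdiff_mult_sym:
  assumes "swap_vars i s = s"
  shows "divdiff i (s * p) = s * divdiff i p"
proof (rule divdiff_unique_eval)
  fix f
  have "cpoly_eval (f \<circ> adj_transp i) s = cpoly_eval f s"
    using arg_cong[OF assms, of "cpoly_eval f"] by simp
  moreover have "(f i - f (Suc i)) * cpoly_eval f (s * divdiff i p)
      = cpoly_eval f s * ((f i - f (Suc i)) * cpoly_eval f (divdiff i p))"
    by simp
  ultimately show "(f i - f (Suc i)) * cpoly_eval f (s * divdiff i p)
      = cpoly_eval f (s * p) - cpoly_eval (f \<circ> adj_transp i) (s * p)"
    unfolding divdiff_eval by (simp add: right_diff_distrib)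
qed

lemma divdiff_0 [simp]: "divdiff i 0 = 0"
  by (rule divdiff_unique_eval) simp

lemma divdiff_sum: "divdiff i (\<Sum>j\<in>J. p j) = (\<Sum>j\<in>J. divdiff i (p j))"
  by (induction J rule: infinite_finite_induct) (auto simp: divdiff_add)

lemma swap_vars_divdiff: "swap_vars i (divdiff i p) = divdiff i p"
proof -
  have "(cvar i - cvar (Suc i)) * swap_vars i (divdiff i p) = (cvar i - cvar (Suc i)) * divdiff i p"
  proof (rule cpoly_eqI)
    fix f
    show "cpoly_eval f ((cvar i - cvar (Suc i)) * swap_vars i (divdiff i p))
        = cpoly_eval f ((cvar i - cvar (Suc i)) * divdiff i p)"
      using divdiff_eval[of f i p] divdiff_eval[of "f \<circ> adj_transp i" i p]
        minus_mult_left[of "f (Suc i) - f i" "cpoly_eval (f \<circ> adj_transp i) (divdiff i p)"]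
      by (auto simp: comp_assoc)
  qed
  then show ?thesis by simp
qed

lemma divdiff_commute:
  assumes "Suc i < j"
  shows "divdiff i (divdiff j p) = divdiff j (divdiff i p)"
proof (rule divdiff_unique)
  have s: "swap_vars i (swap_vars j p) = swap_vars j (swap_vars i p)"
  proof (rule cpoly_eqI)
    fix f
    have "adj_transp i \<circ> adj_transp j = adj_transp j \<circ> adj_transp i"
      using assms by (auto simp: fun_eq_iff Transposition.transpose_def)
    then show "cpoly_eval f (swap_vars i (swap_vars j p)) = cpoly_eval f (swap_vars j (swap_vars i p))"
      by (simp add: comp_assoc)
  qed
  define d e where "d = (cvar i - cvar (Suc i) :: nat cpoly)" and "e = (cvar j - cvar (Suc j) :: nat cpoly)"
  have e: "swap_vars i e = e" and d: "swap_vars j d = d"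
    using assms by (auto simp: d_def e_def swap_vars_diff swap_vars_cvar transpose_eq_iff)
  have dd: "d * divdiff i q = q - swap_vars i q" and de: "e * divdiff j q = q - swap_vars j q" for q
    by (simp_all add: d_def e_def divdiff_eq)
  have "e * (d * divdiff j (divdiff i p)) = d * (e * divdiff j (divdiff i p))"
    by (rule mult.left_commute)
  also have "\<dots> = d * divdiff i p - swap_vars j (d * divdiff i p)"
    by (simp add: de swap_vars_mult d right_diff_distrib)
  also have "\<dots> = (p - swap_vars j p) - swap_vars i (p - swap_vars j p)"
    by (simp add: dd swap_vars_diff s)
  also have "\<dots> = e * (divdiff j p - swap_vars i (divdiff j p))"
    by (simp flip: de add: swap_vars_mult e right_diff_distrib)
  finally have "d * divdiff j (divdiff i p) = divdiff j p - swap_vars i (divdiff j p)"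
    using assms by (simp add: e_def)
  then show "(cvar i - cvar (Suc i)) * divdiff j (divdiff i p) = divdiff j p - swap_vars i (divdiff j p)"
    by (simp add: d_def)
qed

text \<open>Both sides of the braid relation are the alternating sum \<open>A\<close> over S_3,
  divided by the Vandermonde product \<open>D1 * D2 * D3\<close> of the three variables.\<close>

lemma divdiff_triple:
  fixes i :: nat and p :: "nat cpoly"
  defines "j \<equiv> Suc i" and "k \<equiv> Suc (Suc i)"
  defines "D1 \<equiv> cvar i - cvar j" and "D2 \<equiv> cvar j - cvar k" and "D3 \<equiv> cvar i - cvar k"
  defines "A \<equiv> p - swap_vars i p - swap_vars j p + swap_vars i (swap_vars j p)
      + swap_vars j (swap_vars i p) - swap_vars i (swap_vars j (swap_vars i p))"
  shows "D1 * D2 * D3 * divdiff i (divdiff j (divdiff i p)) = A"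
    and "D1 * D2 * D3 * divdiff j (divdiff i (divdiff j p)) = A"
proof -
  have i1: "swap_vars i D1 = - D1" and i2: "swap_vars i D2 = D3" and i3: "swap_vars i D3 = D2"
    and j1: "swap_vars j D1 = D3" and j2: "swap_vars j D2 = - D2" and j3: "swap_vars j D3 = D1"
    by (auto simp: D1_def D2_def D3_def j_def k_def swap_vars_diff swap_vars_cvar transpose_eq_iff)
  have D3: "D3 = D1 + D2" by (simp add: D1_def D2_def D3_def)
  have br: "swap_vars i (swap_vars j (swap_vars i q)) = swap_vars j (swap_vars i (swap_vars j q))" for q
  proof (rule cpoly_eqI)
    fix f
    have "adj_transp i \<circ> (adj_transp j \<circ> adj_transp i) = adj_transp j \<circ> (adj_transp i \<circ> adj_transp j)"
      by (auto simp: fun_eq_iff Transposition.transpose_def j_def)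
    then show "cpoly_eval f (swap_vars i (swap_vars j (swap_vars i q))) = cpoly_eval f (swap_vars j (swap_vars i (swap_vars j q)))"
      by (simp add: comp_assoc)
  qed
  have Xd: "D1 * divdiff i q = q - swap_vars i q" for q
    using divdiff_eq[of i q] by (simp add: D1_def j_def)
  have Yd: "D2 * divdiff j q = q - swap_vars j q" for q
    using divdiff_eq[of j q] by (simp add: D2_def j_def k_def)
  define a where "a = divdiff i p"
  have a: "swap_vars i a = a" by (simp add: a_def swap_vars_divdiff)
  have "D1 * D2 * D3 * divdiff i (divdiff j a) = (D2 * D3) * (D1 * divdiff i (divdiff j a))"
    by (simp add: algebra_simps)
  also have "\<dots> = D3 * (D2 * divdiff j a) - swap_vars i (D3 * (D2 * divdiff j a))"
    by (simp add: Xd swap_vars_mult i2 i3 algebra_simps)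
  also have "\<dots> = D3 * (a - swap_vars j a) - D2 * (a - swap_vars i (swap_vars j a))"
    by (simp add: Yd swap_vars_mult i3 swap_vars_diff a)
  also have "\<dots> = D1 * a - D3 * swap_vars j a + D2 * swap_vars i (swap_vars j a)"
    by (simp add: D3 algebra_simps)
  also have "\<dots> = D1 * a - swap_vars j (D1 * a) + swap_vars i (swap_vars j (D1 * a))"
    by (simp add: swap_vars_mult j1 i3)
  also have "\<dots> = A"
    by (simp add: a_def Xd A_def swap_vars_diff)
  finally show "D1 * D2 * D3 * divdiff i (divdiff j (divdiff i p)) = A"
    by (simp add: a_def)
  define b where "b = divdiff j p"
  have b: "swap_vars j b = b" by (simp add: b_def swap_vars_divdiff)
  have "D1 * D2 * D3 * divdiff j (divdiff i b) = (D1 * D3) * (D2 * divdiff j (divdiff i b))"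
    by (simp add: algebra_simps)
  also have "\<dots> = D3 * (D1 * divdiff i b) - swap_vars j (D3 * (D1 * divdiff i b))"
    by (simp add: Yd swap_vars_mult j1 j3 algebra_simps)
  also have "\<dots> = D3 * (b - swap_vars i b) - D1 * (b - swap_vars j (swap_vars i b))"
    by (simp add: Xd swap_vars_mult j3 swap_vars_diff b)
  also have "\<dots> = D2 * b - D3 * swap_vars i b + D1 * swap_vars j (swap_vars i b)"
    by (simp add: D3 algebra_simps)
  also have "\<dots> = D2 * b - swap_vars i (D2 * b) + swap_vars j (swap_vars i (D2 * b))"
    by (simp add: swap_vars_mult i2 j3)
  also have "\<dots> = A"
    by (simp add: b_def Yd A_def swap_vars_diff br)
  finally show "D1 * D2 * D3 * divdiff j (divdiff i (divdiff j p)) = A"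
    by (simp add: b_def)
qed

lemma divdiff_braid:
  "divdiff i (divdiff (Suc i) (divdiff i p)) = divdiff (Suc i) (divdiff i (divdiff (Suc i) p))"
proof -
  let ?D = "(cvar i - cvar (Suc i)) * (cvar (Suc i) - cvar (Suc (Suc i))) * (cvar i - cvar (Suc (Suc i))) :: nat cpoly"
  have "?D * divdiff i (divdiff (Suc i) (divdiff i p)) = ?D * divdiff (Suc i) (divdiff i (divdiff (Suc i) p))"
    using divdiff_triple[of i p] by simp
  moreover have "?D \<noteq> 0" by simp
  ultimately show ?thesis by (simp del: mult_eq_0_iff)
qed

section \<open>Schubert polynomials\<close>

lemma longest_involution [simp]: "longest N (longest N i) = i"
  by (auto simp: longest_def)

lemma longest_comp_longest [simp]: "longest N \<circ> longest N = id"
  by (simp add: fun_eq_iff)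

lemma longest_permutes: "longest N permutes {1..N}"
proof (rule bij_imp_permutes)
  show "bij_betw (longest N) {1..N} {1..N}"
    by (rule bij_betw_byWitness[of _ "longest N"]) (auto simp: longest_def)
qed (auto simp: longest_def)

lemma schubert_in_permutes:
  "schubert_in N w p \<Longrightarrow> w permutes {1..N}"
proof (induction rule: schubert_in.induct)
  case longest
  show ?case by (rule longest_permutes)
next
  case (descent w p i)
  then show ?case by (intro permutes_compose permutes_swap_id) auto
qed

lemma descentI:
  assumes "schubert_in N v q" "1 \<le> i" "i < N" "v i > v (Suc i)" "w = v \<circ> adj_transp i"
  shows "schubert_in N w (divdiff i q)"
  unfolding assms(5) by (rule schubert_in.descent) (use assms in auto)

text \<open>Stands in for colength as induction measure: exchanging an ascent lowers it by the size
  of the jump, so it falls on the way up to the longest element.\<close>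

definition perm_weight :: "nat \<Rightarrow> (nat \<Rightarrow> nat) \<Rightarrow> nat" where
  "perm_weight N w = (\<Sum>i\<in>{1..N}. i * w i)"

lemma perm_weight_ascent:
  assumes "1 \<le> i" "i < N" "w i < w (Suc i)"
  shows "perm_weight N (w \<circ> adj_transp i) < perm_weight N w"
proof -
  have split: "perm_weight N v = (\<Sum>j\<in>{1..N} - {i, Suc i}. j * v j) + (i * v i + Suc i * v (Suc i))" for v
  proof -
    have "perm_weight N v = (\<Sum>j\<in>({1..N} - {i, Suc i}) \<union> {i, Suc i}. j * v j)"
      unfolding perm_weight_def by (rule sum.cong) (use assms in auto)
    then show ?thesis by (subst (asm) sum.union_disjoint) auto
  qed
  have "(\<Sum>j\<in>{1..N} - {i, Suc i}. j * (w \<circ> adj_transp i) j) = (\<Sum>j\<in>{1..N} - {i, Suc i}. j * w j)"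
    by (rule sum.cong) (auto simp: transpose_apply_other)
  with assms show ?thesis by (simp add: split)
qed

lemma permutes_no_ascent_eq_longest:
  assumes w: "w permutes {1..N}" and no: "\<And>i. \<lbrakk>1 \<le> i; i < N\<rbrakk> \<Longrightarrow> \<not> w i < w (Suc i)"
  shows "w = longest N"
proof
  fix i
  have inj: "inj w" using w by (rule permutes_inj)
  have dec: "Suc (w (Suc i)) \<le> w i" if "1 \<le> i" "i < N" for i
    using no[OF that] injD[OF inj, of i "Suc i"] by (auto simp: not_less le_less Suc_le_eq)
  have mono: "w j + j \<le> w i + i" if "1 \<le> i" "i \<le> j" "j \<le> N" for i j
    using that(2,3)
  proof (induction j rule: dec_induct)
    case (step j)
    with dec[of j] that(1) show ?case by simp
  qed simp
  show "w i = longest N i"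
  proof (cases "i \<in> {1..N}")
    case True
    then have "w 1 \<in> {1..N}" "w N \<in> {1..N}" using permutes_in_image[OF w] by auto
    with mono[of 1 i] mono[of i N] True show ?thesis by (auto simp: longest_def)
  next
    case False
    then show ?thesis using permutes_not_in[OF w] by (auto simp: longest_def)
  qed
qed

lemma schubert_in_exists:
  assumes "w permutes {1..N}"
  shows "\<exists>p. schubert_in N w p"
  using assms
proof (induction "perm_weight N w" arbitrary: w rule: less_induct)
  case less
  show ?case
  proof (cases "\<exists>i. 1 \<le> i \<and> i < N \<and> w i < w (Suc i)")
    case True
    then obtain i where i: "1 \<le> i" "i < N" "w i < w (Suc i)" by blast
    have "w \<circ> adj_transp i permutes {1..N}"
      using less.prems i by (intro permutes_compose permutes_swap_id) auto
    with less.hyps[of "w \<circ> adj_transp i"] perm_weight_ascent[of i N w] i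
    obtain p where "schubert_in N (w \<circ> adj_transp i) p" by blast
    from descentI[OF this i(1,2), of w] i show ?thesis by (auto simp: comp_assoc)
  next
    case False
    with permutes_no_ascent_eq_longest[OF less.prems] have "w = longest N" by blast
    with schubert_in.longest show ?thesis by metis
  qed
qed

text \<open>Local confluence. Both derivations of \<open>w\<close> are traced back to a common
  longer permutation \<open>?x\<close>, namely w s_i s_j or w s_i s_j s_i; the induction hypothesis
  writes \<open>q\<close> and \<open>q'\<close> as divided differences of its polynomial
  \<open>r\<close>, and the commutation or braid relation concludes.\<close>

lemma schubert_in_diamond:
  assumes w: "w permutes {1..N}"
    and IH: "\<And>v p p'. \<lbrakk>perm_weight N v < perm_weight N w; schubert_in N v p; schubert_in N v p'\<rbrakk> \<Longrightarrow> p = p'"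
    and i: "1 \<le> i" "i < N" "w i < w (Suc i)" and j: "1 \<le> j" "j < N" "w j < w (Suc j)"
    and q: "schubert_in N (w \<circ> adj_transp i) q" and q': "schubert_in N (w \<circ> adj_transp j) q'"
    and ij: "i < j"
  shows "divdiff i q = divdiff j q'"
proof (cases "j = Suc i")
  case False
  with ij have ij': "Suc i < j" by simp
  let ?x = "w \<circ> adj_transp i \<circ> adj_transp j"
  have comm: "adj_transp i \<circ> adj_transp j = adj_transp j \<circ> adj_transp i"
    using ij' by (auto simp: fun_eq_iff Transposition.transpose_def)
  have "?x permutes {1..N}"
    using w i j by (intro permutes_compose permutes_swap_id) auto
  then obtain r where r: "schubert_in N ?x r" using schubert_in_exists by blast
  have "schubert_in N (w \<circ> adj_transp i) (divdiff j r)"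
    by (rule descentI[OF r j(1,2)]) (use j(3) ij' in \<open>auto simp: comp_assoc transpose_apply_other\<close>)
  with IH[OF perm_weight_ascent[OF i] q] have 1: "q = divdiff j r" by blast
  have "schubert_in N (w \<circ> adj_transp j) (divdiff i r)"
    by (rule descentI[OF r i(1,2)])
       (use i(3) ij' in \<open>auto simp: comp_assoc comm transpose_apply_other\<close>)
  with IH[OF perm_weight_ascent[OF j] q'] have 2: "q' = divdiff i r" by blast
  show ?thesis by (simp add: 1 2 divdiff_commute[OF ij'])
next
  case True
  let ?x = "w \<circ> adj_transp i \<circ> adj_transp j \<circ> adj_transp i"
  have br: "adj_transp i \<circ> (adj_transp j \<circ> adj_transp i) = adj_transp j \<circ> (adj_transp i \<circ> adj_transp j)"
    using True by (auto simp: fun_eq_iff Transposition.transpose_def)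
  have "?x permutes {1..N}"
    using w i j by (intro permutes_compose permutes_swap_id) auto
  then obtain r where r: "schubert_in N ?x r" using schubert_in_exists by blast
  have asc: "w i < w (Suc (Suc i))" using i(3) j(3) True by simp
  have "schubert_in N (w \<circ> adj_transp i \<circ> adj_transp j) (divdiff i r)"
    by (rule descentI[OF r i(1,2)])
       (use j(3) True in \<open>auto simp: comp_assoc Transposition.transpose_def\<close>)
  from descentI[OF this j(1,2), of "w \<circ> adj_transp i"]
  have "schubert_in N (w \<circ> adj_transp i) (divdiff j (divdiff i r))"
    using asc True by (auto simp: comp_assoc Transposition.transpose_def)
  with IH[OF perm_weight_ascent[OF i] q] have 1: "q = divdiff j (divdiff i r)" by blast
  have "schubert_in N (w \<circ> adj_transp j \<circ> adj_transp i) (divdiff j r)"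
    by (rule descentI[OF r j(1,2)])
       (use i(3) True br in \<open>auto simp: comp_assoc Transposition.transpose_def\<close>)
  from descentI[OF this i(1,2), of "w \<circ> adj_transp j"]
  have "schubert_in N (w \<circ> adj_transp j) (divdiff i (divdiff j r))"
    using asc True by (auto simp: comp_assoc Transposition.transpose_def)
  with IH[OF perm_weight_ascent[OF j] q'] have 2: "q' = divdiff i (divdiff j r)" by blast
  show ?thesis unfolding 1 2 True by (rule divdiff_braid)
qed

lemma schubert_in_cases':
  assumes "schubert_in N w p"
  obtains "w = longest N" "p = (\<Prod>i\<in>{1..N}. cvar i ^ (N - i))"
    | q i where "1 \<le> i" "i < N" "w i < w (Suc i)" "schubert_in N (w \<circ> adj_transp i) q" "p = divdiff i q"
  using assms
proof (cases rule: schubert_in.cases)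
  case (descent v q i)
  have "w \<circ> adj_transp i = v" using descent(1) by (simp add: comp_assoc)
  with descent show ?thesis by (intro that(2)[of i q]) auto
qed (use that(1) in auto)

lemma schubert_in_unique:
  assumes "schubert_in N w p" "schubert_in N w p'"
  shows "p = p'"
  using assms
proof (induction "perm_weight N w" arbitrary: w p p' rule: less_induct)
  case less
  have no: "\<not> longest N i < longest N (Suc i)" if "1 \<le> i" "i < N" for i
    using that by (auto simp: longest_def)
  have w: "w permutes {1..N}" using less.prems(1) by (rule schubert_in_permutes)
  from less.prems(1) show ?case
  proof (cases rule: schubert_in_cases')
    case 1
    from less.prems(2) show ?thesis
      by (cases rule: schubert_in_cases') (use 1 no in auto)
  next
    case (2 q i)
    note i = this
    from less.prems(2) show ?thesis
    proof (cases rule: schubert_in_cases')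
      case 1
      with i no show ?thesis by auto
    next
      case (2 q' j)
      note j = this
      consider "i = j" | "i < j" | "j < i" by linarith
      then show ?thesis
      proof cases
        case 1
        with less.hyps[OF perm_weight_ascent[OF i(1-3)] i(4)] i j show ?thesis by auto
      next
        case 2
        with schubert_in_diamond[OF w less.hyps i(1-3) j(1-3) i(4) j(4)] i j show ?thesis by simp
      next
        case 3
        with schubert_in_diamond[OF w less.hyps j(1-3) i(1-3) j(4) i(4)] i j show ?thesis by simp
      qed
    qed
  qed
qed

text \<open>Stability of Schubert polynomials under enlarging the symmetric group. Descents at
  positions 1, ..., N carry the value N+1 from the first place of the longest element to the
  last.\<close>

lemma schubert_in_Suc_longest:
  "schubert_in (Suc N) (longest N) (\<Prod>i\<in>{1..N}. cvar i ^ (N - i))"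
proof -
  \<comment> \<open>The word reached after \<open>k\<close> descents is N, ..., N-k+1, N+1, N-k,
    ..., 1; its polynomial is the monomial \<open>p k\<close>.\<close>
  define w where "w k i = (if i \<in> {1..k} then N + 1 - i else if i = k + 1 then N + 1
      else if i \<in> {k+2..N+1} then N + 2 - i else i)" for k i
  define p :: "nat \<Rightarrow> nat cpoly" where
    "p k = (\<Prod>i\<in>{1..k}. cvar i ^ (N - i)) * (\<Prod>i\<in>{k+1..N+1}. cvar i ^ (N + 1 - i))" for k
  have "schubert_in (Suc N) (w k) (p k)" if "k \<le> N" for k
    using that
  proof (induction k)
    case 0
    have "w 0 = longest (Suc N)" by (auto simp: w_def longest_def fun_eq_iff)
    with schubert_in.longest[of "Suc N"] show ?case by (simp add: p_def)
  next
    case (Suc k)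
    \<comment> \<open>\<open>p k\<close> is the variable \<open>cvar (Suc k)\<close> times a
      monomial \<open>s\<close> symmetric in the two exchanged variables, so only \<open>s\<close>
      survives.\<close>
    have "divdiff (Suc k) (p k) = p (Suc k)"
    proof -
      define s :: "nat cpoly" where "s = (\<Prod>i\<in>{1..k}. cvar i ^ (N - i))
          * (cvar (Suc k) * cvar (Suc (Suc k))) ^ (N - k - 1) * (\<Prod>i\<in>{k+3..N+1}. cvar i ^ (N + 1 - i))"
      have sym: "swap_vars (Suc k) s = s"
      proof (rule cpoly_eqI)
        fix f :: "nat \<Rightarrow> complex"
        have "(\<Prod>i\<in>{1..k}. f (adj_transp (Suc k) i) ^ (N - i)) = (\<Prod>i\<in>{1..k}. f i ^ (N - i))"
          by (rule prod.cong) (auto simp: transpose_apply_other)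
        moreover have "(\<Prod>i\<in>{k+3..N+1}. f (adj_transp (Suc k) i) ^ (N + 1 - i)) = (\<Prod>i\<in>{k+3..N+1}. f i ^ (N + 1 - i))"
          by (rule prod.cong) (auto simp: transpose_apply_other)
        ultimately show "cpoly_eval f (swap_vars (Suc k) s) = cpoly_eval f s"
          by (simp add: s_def mult.commute)
      qed
      have "{k+1..N+1} = insert (Suc k) (insert (Suc (Suc k)) {k+3..N+1})" using Suc.prems by auto
      then have "p k = (\<Prod>i\<in>{1..k}. cvar i ^ (N - i)) * (cvar (Suc k) ^ Suc (N - k - 1)
          * (cvar (Suc (Suc k)) ^ (N - k - 1) * (\<Prod>i\<in>{k+3..N+1}. cvar i ^ (N + 1 - i))))"
        unfolding p_def using Suc.prems by (simp add: Suc_diff_Suc)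
      then have pk: "p k = s * cvar (Suc k)"
        by (simp add: s_def power_mult_distrib mult_ac)
      have "{Suc k+1..N+1} = insert (Suc (Suc k)) {k+3..N+1}" using Suc.prems by auto
      then have "p (Suc k) = (\<Prod>i\<in>{1..k}. cvar i ^ (N - i)) * cvar (Suc k) ^ (N - k - 1)
          * (cvar (Suc (Suc k)) ^ (N - k - 1) * (\<Prod>i\<in>{k+3..N+1}. cvar i ^ (N + 1 - i)))"
        unfolding p_def using Suc.prems by (simp add: mult.commute)
      then have pS: "p (Suc k) = s"
        by (simp add: s_def power_mult_distrib mult_ac)
      have "divdiff (Suc k) (cvar (Suc k)) = 1"
        by (rule divdiff_unique) (simp add: swap_vars_cvar)
      then show ?thesis by (simp add: pk pS divdiff_mult_sym[OF sym])
    qed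
    moreover have "w (Suc k) = w k \<circ> adj_transp (Suc k)"
      using Suc.prems by (auto simp: w_def fun_eq_iff Transposition.transpose_def)
    moreover have "w k (Suc k) > w k (Suc (Suc k))"
      using Suc.prems by (auto simp: w_def)
    ultimately show ?case
      using descentI[of "Suc N" "w k" "p k" "Suc k" "w (Suc k)"] Suc by (simp add: comp_def)
  qed
  from this[of N] have "schubert_in (Suc N) (w N) (p N)" by simp
  moreover have "w N = longest N" by (auto simp: w_def longest_def fun_eq_iff)
  moreover have "p N = (\<Prod>i\<in>{1..N}. cvar i ^ (N - i))" by (simp add: p_def)
  ultimately show ?thesis by simp
qed

lemma schubert_in_Suc: "schubert_in N w p \<Longrightarrow> schubert_in (Suc N) w p"
proof (induction rule: schubert_in.induct)
  case longest
  show ?case by (rule schubert_in_Suc_longest)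
next
  case (descent w p i)
  then show ?case by (intro schubert_in.descent) auto
qed

lemma schubert_in_mono: "N \<le> M \<Longrightarrow> schubert_in N w p \<Longrightarrow> schubert_in M w p"
  by (induction M rule: dec_induct) (auto intro: schubert_in_Suc)

text \<open>Derivations in different symmetric groups meet in the larger one, where uniqueness is
  known; hence the definite description in \<open>schubert\<close> is well posed.\<close>

lemma schubert_eqI:
  assumes "schubert_in N w p"
  shows "schubert w = p"
  unfolding schubert_def
proof (rule the_equality)
  show "\<exists>N. w permutes {1..N} \<and> schubert_in N w p"
    using assms schubert_in_permutes by blast
  fix q
  assume "\<exists>N. w permutes {1..N} \<and> schubert_in N w q"
  then obtain M where "schubert_in M w q" by blast
  then have "schubert_in (max N M) w q" by (rule schubert_in_mono[rotated]) simp
  moreover have "schubert_in (max N M) w p" using assms by (rule schubert_in_mono[rotated]) simp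
  ultimately show "q = p" by (rule schubert_in_unique)
qed

section \<open>Expansions in elementary symmetric polynomials\<close>

lemma cpoly_eval_esym:
  "cpoly_eval f (esym i k) = (\<Sum>S | S \<subseteq> {1..k} \<and> card S = i. \<Prod>j\<in>S. f j)"
  by (simp add: esym_def)

lemma sum_esym_eval:
  "(\<Sum>i\<le>k. cpoly_eval f (esym i k) * y ^ (k - i)) = (\<Prod>j\<in>{1..k}. f j + y)"
proof -
  have "(\<Prod>j\<in>{1..k}. f j + y) = (\<Sum>S\<in>Pow {1..k}. prod f S * y ^ (k - card S))"
    by (subst prod_add) (auto intro!: sum.cong simp: card_Diff_subset finite_subset)
  also have "\<dots> = (\<Sum>i\<le>k. \<Sum>S\<in>{S \<in> Pow {1..k}. card S = i}. prod f S * y ^ (k - card S))"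
    by (rule sum.group[symmetric]) (use card_mono[of "{1..k}"] in auto)
  also have "\<dots> = (\<Sum>i\<le>k. cpoly_eval f (esym i k) * y ^ (k - i))"
  proof (rule sum.cong)
    fix i
    have "{S \<in> Pow {1..k}. card S = i} = {S. S \<subseteq> {1..k} \<and> card S = i}" by blast
    then show "(\<Sum>S\<in>{S \<in> Pow {1..k}. card S = i}. prod f S * y ^ (k - card S))
        = cpoly_eval f (esym i k) * y ^ (k - i)"
      unfolding cpoly_eval_esym sum_distrib_right by (intro sum.cong) auto
  qed simp
  finally show ?thesis by simp
qed

lemma esym_0 [simp]: "esym 0 k = 1"
proof -
  have "{S. S \<subseteq> {1..k} \<and> card S = 0} = {{}}"
    by (auto simp: card_eq_0_iff dest: finite_subset)
  then show ?thesis by (simp add: esym_def)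
qed

lemma esym_Suc_Suc: "esym (Suc i) (Suc k) = esym (Suc i) k + cvar (Suc k) * esym i k"
proof -
  let ?A = "{S. S \<subseteq> {1..k} \<and> card S = Suc i}" and ?B = "{S. S \<subseteq> {1..k} \<and> card S = i}"
  have fin: "finite S" if "S \<subseteq> {1..k}" for S :: "nat set"
    using that by (rule finite_subset) simp
  have sub: "S - {Suc k} \<subseteq> {1..k}" if "S \<subseteq> {1..Suc k}" for S
    using that by (force simp: le_Suc_eq)
  have "{S. S \<subseteq> {1..Suc k} \<and> card S = Suc i} = ?A \<union> insert (Suc k) ` ?B" (is "?L = ?R")
  proof (rule equalityI; rule subsetI)
    fix S assume S: "S \<in> ?L"
    show "S \<in> ?R"
    proof (cases "Suc k \<in> S")
      case True
      then have "S = insert (Suc k) (S - {Suc k})" by auto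
      moreover have "S - {Suc k} \<in> ?B"
        using S True sub[of S] fin[of "S - {Suc k}"] by (auto simp: card_Diff_singleton)
      ultimately show ?thesis by blast
    next
      case False
      with S sub[of S] show ?thesis by auto
    qed
  next
    fix S assume "S \<in> ?R"
    then show "S \<in> ?L"
    proof
      assume "S \<in> insert (Suc k) ` ?B"
      then obtain T where T: "S = insert (Suc k) T" "T \<subseteq> {1..k}" "card T = i" by auto
      moreover have "Suc k \<notin> T" using T(2) by auto
      ultimately show ?thesis using fin[of T] by auto
    qed auto
  qed
  moreover have "?A \<inter> insert (Suc k) ` ?B = {}" by auto
  moreover have "finite ?A" "finite ?B" by (auto intro: finite_subset[of _ "Pow {1..k}"])
  moreover have inj: "inj_on (insert (Suc k)) ?B"
  proof (rule inj_onI)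
    fix S T assume a: "S \<in> ?B" "T \<in> ?B" "insert (Suc k) S = insert (Suc k) T"
    then have "Suc k \<notin> S" "Suc k \<notin> T" by auto
    with a(3) show "S = T" by (metis insert_ident)
  qed
  ultimately have "esym (Suc i) (Suc k) = esym (Suc i) k + (\<Sum>S\<in>?B. \<Prod>j\<in>insert (Suc k) S. cvar j)"
    unfolding esym_def by (simp add: sum.union_disjoint sum.reindex)
  also have "(\<Sum>S\<in>?B. \<Prod>j\<in>insert (Suc k) S. cvar j) = (\<Sum>S\<in>?B. cvar (Suc k) * (\<Prod>j\<in>S. cvar j) :: nat cpoly)"
  proof (rule sum.cong)
    fix S assume S: "S \<in> ?B"
    then have "Suc k \<notin> S" by auto
    with S fin[of S] show "(\<Prod>j\<in>insert (Suc k) S. cvar j) = cvar (Suc k) * (\<Prod>j\<in>S. cvar j :: nat cpoly)"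
      by simp
  qed simp
  finally show ?thesis by (simp add: esym_def sum_distrib_left)
qed

lemma swap_vars_esym:
  assumes "1 \<le> j" "j \<noteq> k"
  shows "swap_vars j (esym i k) = esym i k"
proof (rule cpoly_eqI)
  fix f :: "nat \<Rightarrow> complex"
  have in_k: "adj_transp j x \<in> {1..k}" if "x \<in> {1..k}" for x
    using that assms by (auto simp: Transposition.transpose_def)
  have inj: "inj_on (adj_transp j) S" for S
    by (rule inj_on_subset[OF inj_transpose]) simp
  show "cpoly_eval f (swap_vars j (esym i k)) = cpoly_eval f (esym i k)"
    unfolding cpoly_eval_swap_vars cpoly_eval_esym
  proof (rule sum.reindex_bij_witness[of _ "image (adj_transp j)" "image (adj_transp j)"])
    fix S :: "nat set"
    show "adj_transp j ` adj_transp j ` S = S" by (simp add: image_image)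
    show "adj_transp j ` adj_transp j ` S = S" by (simp add: image_image)
    assume S: "S \<in> {S. S \<subseteq> {1..k} \<and> card S = i}"
    then show "adj_transp j ` S \<in> {S. S \<subseteq> {1..k} \<and> card S = i}"
      using in_k by (auto simp: card_image[OF inj] subset_iff)
    show "adj_transp j ` S \<in> {S. S \<subseteq> {1..k} \<and> card S = i}"
      using S in_k by (auto simp: card_image[OF inj] subset_iff)
    show "prod f (adj_transp j ` S) = prod (f \<circ> adj_transp j) S"
      by (simp add: prod.reindex[OF inj])
  qed
qed

lemma swap_vars_1 [simp]: "swap_vars j 1 = 1"
  by (rule cpoly_eqI) simp

lemma divdiff_esym_Suc: "divdiff (Suc k) (esym (Suc i) (Suc k)) = esym i k"
proof (rule divdiff_unique)
  show "(cvar (Suc k) - cvar (Suc (Suc k))) * esym i k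
      = esym (Suc i) (Suc k) - swap_vars (Suc k) (esym (Suc i) (Suc k))"
    unfolding esym_Suc_Suc swap_vars_add swap_vars_mult
    by (simp add: swap_vars_cvar swap_vars_esym left_diff_distrib)
qed

lemma esym_eq_0: "k < i \<Longrightarrow> esym i k = 0"
proof -
  assume "k < i"
  have "card S \<noteq> i" if "S \<subseteq> {1..k}" for S
    using card_mono[of "{1..k}" S] that \<open>k < i\<close> by simp
  then have "{S. S \<subseteq> {1..k} \<and> card S = i} = {}"
    by blast
  then show ?thesis by (simp only: esym_def) simp
qed

lemma cconst_eq_0_iff [simp]: "cconst a = 0 \<longleftrightarrow> a = 0"
  by (metis cpoly_eval_cconst cpoly_eval_0 cconst_def single_zero)

lemma swap_vars_sum: "swap_vars j (\<Sum>i\<in>I. p i) = (\<Sum>i\<in>I. swap_vars j (p i))"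
  by (rule cpoly_eqI) simp

lemma swap_vars_prod: "swap_vars j (\<Prod>i\<in>I. p i) = (\<Prod>i\<in>I. swap_vars j (p i))"
  by (rule cpoly_eqI) simp

lemma swap_vars_cconst [simp]: "swap_vars j (cconst a) = cconst a"
  by (rule cpoly_eqI) simp

text \<open>Applying the divided differences \<open>K, K - 1, \<dots>\<close> peels off the factor \<open>esym d K\<close>, because
  the remaining factors are symmetric in the first \<open>K + 1\<close> variables.\<close>

lemma esym_sum_eq_0_imp_coeff_eq_0:
  assumes sum0: "(\<Sum>d\<le>K. esym d K * B d) = 0"
    and sym: "\<And>d j. \<lbrakk>1 \<le> j; j \<le> K\<rbrakk> \<Longrightarrow> swap_vars j (B d) = B d"
    and d: "d \<le> K"
  shows "B d = 0"
proof -
  \<comment> \<open>The relation after \<open>d\<close> divided differences. Each one kills the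
    leading term, whose elementary factor is 1, and lowers both indices of the other elementary
    factors.\<close>
  have P: "(\<Sum>e\<in>{d..K}. esym (e - d) (K - d) * B e) = 0" if "d \<le> K" for d
    using that
  proof (induction d)
    case 0
    with sum0 show ?case by (simp add: atMost_atLeast0)
  next
    case (Suc d)
    define L where "L = K - Suc d"
    have L: "K - d = Suc L" "Suc L \<le> K" using Suc.prems by (auto simp: L_def)
    have "divdiff (Suc L) (\<Sum>e\<in>{d..K}. esym (e - d) (K - d) * B e) = 0"
      using Suc by simp
    also have "divdiff (Suc L) (\<Sum>e\<in>{d..K}. esym (e - d) (K - d) * B e)
        = (\<Sum>e\<in>{d..K}. B e * divdiff (Suc L) (esym (e - d) (Suc L)))"
      unfolding divdiff_sum L(1)
      by (intro sum.cong refl) (subst mult.commute, rule divdiff_mult_sym, use sym L in auto)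
    also have "{d..K} = insert d {Suc d..K}" using Suc.prems by auto
    also have "(\<Sum>e\<in>\<dots>. B e * divdiff (Suc L) (esym (e - d) (Suc L)))
        = (\<Sum>e\<in>{Suc d..K}. B e * divdiff (Suc L) (esym (e - d) (Suc L)))"
    proof -
      have "divdiff (Suc L) 1 = 0" by (rule divdiff_unique) simp
      then show ?thesis by simp
    qed
    also have "\<dots> = (\<Sum>e\<in>{Suc d..K}. esym (e - Suc d) (K - Suc d) * B e)"
    proof (rule sum.cong)
      fix e assume "e \<in> {Suc d..K}"
      then have "e - d = Suc (e - Suc d)" by auto
      then show "B e * divdiff (Suc L) (esym (e - d) (Suc L)) = esym (e - Suc d) (K - Suc d) * B e"
        by (simp add: divdiff_esym_Suc L_def mult.commute)
    qed simp
    finally show ?case .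
  qed
  \<comment> \<open>The relation at \<open>d\<close> starts with \<open>B d\<close> itself, so the
    coefficients vanish successively from \<open>d = K\<close> downwards.\<close>
  show ?thesis
    using d
  proof (induction "K - d" arbitrary: d rule: less_induct)
    case less
    have "{d..K} = insert d {Suc d..K}" using less.prems by auto
    moreover have "B e = 0" if "e \<in> {Suc d..K}" for e
      using that by (intro less.hyps) auto
    ultimately show ?case using P[OF less.prems] by simp
  qed
qed

text \<open>The factor with the smallest index \<open>K\<close> is removed first: the factors with
  larger index are invariant under the adjacent transpositions at 1, ..., K, as
  \<open>esym_sum_eq_0_imp_coeff_eq_0\<close> requires of the coefficients
  \<open>B d\<close>.\<close>

lemma esym_products_independent:
  assumes "K \<le> M" "1 \<le> K" "finite I"
    and "\<And>i i'. \<lbrakk>i \<in> I; i' \<in> I; \<And>k. k \<in> {K..<M} \<Longrightarrow> L i k = L i' k\<rbrakk> \<Longrightarrow> i = i'"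
    and "\<And>i k. i \<in> I \<Longrightarrow> L i k \<le> k"
    and "(\<Sum>i\<in>I. cconst (a i) * (\<Prod>k\<in>{K..<M}. esym (L i k) k)) = 0"
    and "i \<in> I"
  shows "a i = 0"
  using assms
proof (induction K arbitrary: I i rule: inc_induct)
  case base
  have "i' = i" if "i' \<in> I" for i'
    by (rule base.prems(3)) (use that base.prems(6) in auto)
  with base.prems(6) have "I = {i}" by blast
  with base.prems(5) show ?case by simp
next
  case (step K)
  define B where "B d = (\<Sum>i\<in>{i\<in>I. L i K = d}. cconst (a i) * (\<Prod>k\<in>{Suc K..<M}. esym (L i k) k))" for d
  have KM: "{K..<M} = insert K {Suc K..<M}" using step.hyps by auto
  have "0 = (\<Sum>i\<in>I. cconst (a i) * (\<Prod>k\<in>{K..<M}. esym (L i k) k))"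
    using step.prems(5) by simp
  also have "\<dots> = (\<Sum>d\<le>K. \<Sum>i\<in>{i\<in>I. L i K = d}. cconst (a i) * (\<Prod>k\<in>{K..<M}. esym (L i k) k))"
    by (rule sum.group[symmetric]) (use step.prems in auto)
  also have "\<dots> = (\<Sum>d\<le>K. esym d K * B d)"
    by (intro sum.cong refl) (simp add: B_def KM sum_distrib_left mult_ac)
  finally have sum0: "(\<Sum>d\<le>K. esym d K * B d) = 0" by simp
  have sym: "swap_vars j (B d) = B d" if "1 \<le> j" "j \<le> K" for j d
    unfolding B_def swap_vars_sum swap_vars_mult swap_vars_prod swap_vars_cconst
    by (intro sum.cong arg_cong2[where f = "(*)"] prod.cong refl swap_vars_esym) (use that in auto)
  have B0: "B (L i K) = 0"
    by (rule esym_sum_eq_0_imp_coeff_eq_0[OF sum0 sym]) (use step.prems in auto)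
  show ?case
  proof (rule step.IH)
    show "(\<Sum>i\<in>{i'\<in>I. L i' K = L i K}. cconst (a i) * (\<Prod>k\<in>{Suc K..<M}. esym (L i k) k)) = 0"
      using B0 by (simp add: B_def)
    show "i' = i''" if "i' \<in> {i'\<in>I. L i' K = L i K}" "i'' \<in> {i'\<in>I. L i' K = L i K}"
      "\<And>k. k \<in> {Suc K..<M} \<Longrightarrow> L i' k = L i'' k" for i' i''
      by (rule step.prems(3)) (use that KM in auto)
  qed (use step.prems in auto)
qed

lemma e_combination_superset:
  assumes "finite I" "Poly_Mapping.keys a \<subseteq> I" "\<And>\<iota>. \<iota> \<in> I \<Longrightarrow> Poly_Mapping.keys \<iota> \<subseteq> {1..<M}"
    and e0: "\<And>k. e 0 k = 1"
  shows "e_combination e a = (\<Sum>\<iota>\<in>I. cconst (Poly_Mapping.lookup a \<iota>)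
      * (\<Prod>k\<in>{1..<M}. e (Poly_Mapping.lookup \<iota> k) k))"
proof -
  have "e_combination e a = (\<Sum>\<iota>\<in>I. cconst (Poly_Mapping.lookup a \<iota>)
      * (\<Prod>k\<in>Poly_Mapping.keys \<iota>. e (Poly_Mapping.lookup \<iota> k) k))"
    unfolding e_combination_def
    by (rule sum.mono_neutral_left) (use assms in \<open>auto simp: in_keys_iff cconst_def\<close>)
  also have "\<dots> = (\<Sum>\<iota>\<in>I. cconst (Poly_Mapping.lookup a \<iota>)
      * (\<Prod>k\<in>{1..<M}. e (Poly_Mapping.lookup \<iota> k) k))"
    by (intro sum.cong arg_cong2[where f = "(*)"] prod.mono_neutral_left refl)
       (use assms in \<open>auto simp: in_keys_iff\<close>)
  finally show ?thesis .
qed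

lemma e_indices_keys_bounded:
  assumes "finite I" "I \<subseteq> e_indices"
  obtains M where "\<And>\<iota>. \<iota> \<in> I \<Longrightarrow> Poly_Mapping.keys \<iota> \<subseteq> {1..<M}" "1 \<le> M"
proof -
  have "finite (\<Union>\<iota>\<in>I. Poly_Mapping.keys \<iota>)" using assms(1) by auto
  then obtain M where M: "\<forall>k\<in>(\<Union>\<iota>\<in>I. Poly_Mapping.keys \<iota>). k < M"
    unfolding finite_nat_set_iff_bounded by blast
  show ?thesis
  proof (rule that[of "Suc M"])
    fix \<iota> assume \<iota>: "\<iota> \<in> I"
    show "Poly_Mapping.keys \<iota> \<subseteq> {1..<Suc M}"
    proof
      fix k assume k: "k \<in> Poly_Mapping.keys \<iota>"
      have "Poly_Mapping.lookup \<iota> k \<le> k"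
        using assms(2) \<iota> by (auto simp: e_indices_def)
      with k have "k \<noteq> 0" by (auto simp: in_keys_iff)
      moreover have "k < M" using M \<iota> k by blast
      ultimately show "k \<in> {1..<Suc M}" by simp
    qed
  qed simp
qed

text \<open>The uniqueness on which the definite description in \<open>e_coeffs\<close> rests.
  Existence for Schubert polynomials will come from \<open>e_dual\<close>.\<close>

lemma e_combination_esym_inj:
  assumes "Poly_Mapping.keys a \<subseteq> e_indices" "Poly_Mapping.keys b \<subseteq> e_indices"
    and eq: "e_combination esym a = e_combination esym b"
  shows "a = b"
proof (rule poly_mapping_eqI)
  fix \<iota>
  let ?I = "Poly_Mapping.keys a \<union> Poly_Mapping.keys b"
  have I: "finite ?I" "?I \<subseteq> e_indices" using assms by auto
  obtain M where M: "\<And>\<iota>. \<iota> \<in> ?I \<Longrightarrow> Poly_Mapping.keys \<iota> \<subseteq> {1..<M}" "1 \<le> M"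
    by (rule e_indices_keys_bounded[OF I]) blast
  have cd: "cconst (x - y) = cconst x - (cconst y :: nat cpoly)" for x y
    by (rule cpoly_eqI) simp
  have "Poly_Mapping.lookup a \<iota> - Poly_Mapping.lookup b \<iota> = 0" if "\<iota> \<in> ?I"
  proof (rule esym_products_independent[of 1 M ?I Poly_Mapping.lookup])
    show "\<iota> = \<kappa>" if "\<iota> \<in> ?I" "\<kappa> \<in> ?I"
      "\<And>k. k \<in> {1..<M} \<Longrightarrow> Poly_Mapping.lookup \<iota> k = Poly_Mapping.lookup \<kappa> k" for \<iota> \<kappa>
    proof (rule poly_mapping_eqI)
      fix k
      show "Poly_Mapping.lookup \<iota> k = Poly_Mapping.lookup \<kappa> k"
        using that M(1)[OF that(1)] M(1)[OF that(2)]
        by (metis not_in_keys_iff_lookup_eq_zero subsetD)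
    qed
    show "(\<Sum>\<iota>\<in>?I. cconst (Poly_Mapping.lookup a \<iota> - Poly_Mapping.lookup b \<iota>)
        * (\<Prod>k = 1..<M. esym (Poly_Mapping.lookup \<iota> k) k)) = 0"
      using eq e_combination_superset[of ?I a M esym] e_combination_superset[of ?I b M esym] M(1)
      by (simp add: cd left_diff_distrib sum_subtractf)
  qed (use M I that in \<open>auto simp: e_indices_def\<close>)
  then show "Poly_Mapping.lookup a \<iota> = Poly_Mapping.lookup b \<iota>"
    by (cases "\<iota> \<in> ?I") (auto simp: in_keys_iff)
qed

lemma e_coeffs_eqI:
  assumes "Poly_Mapping.keys a \<subseteq> e_indices" "e_combination esym a = p"
  shows "e_coeffs p = a"
  unfolding e_coeffs_def
proof (rule the_equality)
  show "Poly_Mapping.keys a \<subseteq> e_indices \<and> e_combination esym a = p"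
    using assms by blast
  show "b = a" if "Poly_Mapping.keys b \<subseteq> e_indices \<and> e_combination esym b = p" for b
    by (rule e_combination_esym_inj) (use that assms in auto)
qed

text \<open>\<open>e_kernel N E\<close> is the product over \<open>k\<close> of the homogenised generating functions of
  \<open>E k 0, \<dots>, E k k\<close>; for elementary symmetric polynomials it is the top double Schubert
  polynomial \<open>\<Prod>\<^bsub>i + j \<le> N\<^esub> (x\<^sub>i + y\<^sub>j)\<close>, as a polynomial in \<open>y\<close>.\<close>

definition e_kernel :: "nat \<Rightarrow> (nat \<Rightarrow> nat \<Rightarrow> complex) \<Rightarrow> nat cpoly" where
  "e_kernel N E = (\<Prod>k\<in>{1..<N}. \<Sum>i\<le>k. cconst (E k i) * cvar (N - k) ^ (k - i))"

definition e_indices_below :: "nat \<Rightarrow> (nat \<Rightarrow>\<^sub>0 nat) set" where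
  "e_indices_below N = {\<iota>\<in>e_indices. Poly_Mapping.keys \<iota> \<subseteq> {1..<N}}"

text \<open>The monomial that accompanies the product of the \<open>E k (g k)\<close> when
  \<open>e_kernel N E\<close> is multiplied out.\<close>

definition e_complement :: "nat \<Rightarrow> (nat \<Rightarrow> nat) \<Rightarrow> nat cpoly" where
  "e_complement N g = (\<Prod>k\<in>{1..<N}. cvar (N - k) ^ (k - g k))"

text \<open>Coefficients chosen so that combining any family \<open>e\<close> with them amounts to
  applying \<open>lam\<close> to the kernel. One functional then serves the classical, quantum and
  reflected values alike, and operations on Schubert polynomials become operations on
  \<open>lam\<close>.\<close>

definition e_dual :: "nat \<Rightarrow> (nat cpoly \<Rightarrow> complex) \<Rightarrow> (nat \<Rightarrow>\<^sub>0 nat) \<Rightarrow>\<^sub>0 complex" where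
  "e_dual N lam = Abs_poly_mapping (\<lambda>\<iota>. if \<iota> \<in> e_indices_below N
     then lam (e_complement N (Poly_Mapping.lookup \<iota>)) else 0)"

definition clinear_form :: "(nat cpoly \<Rightarrow> complex) \<Rightarrow> bool" where
  "clinear_form lam \<longleftrightarrow> (\<forall>p q. lam (p + q) = lam p + lam q) \<and> (\<forall>a p. lam (cconst a * p) = a * lam p)"

lemma clinear_form_sum:
  assumes "clinear_form lam"
  shows "lam (\<Sum>i\<in>I. p i) = (\<Sum>i\<in>I. lam (p i))"
proof -
  have "lam 0 = 0"
    using assms unfolding clinear_form_def by (metis add_cancel_right_right)
  then show ?thesis
    using assms by (induction I rule: infinite_finite_induct) (auto simp: clinear_form_def)
qed

lemma bij_betw_e_indices_below:
  "bij_betw (\<lambda>\<iota>. restrict (Poly_Mapping.lookup \<iota>) {1..<N}) (e_indices_below N) (PiE {1..<N} (\<lambda>k. {..k}))"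
proof (rule bij_betw_byWitness[where f' = "\<lambda>g. Abs_poly_mapping (\<lambda>k. if k \<in> {1..<N} then g k else 0)"])
  have lk: "Poly_Mapping.lookup (Abs_poly_mapping (\<lambda>k. if k \<in> {1..<N} then g k else 0))
      = (\<lambda>k. if k \<in> {1..<N} then g k else 0)" for g :: "nat \<Rightarrow> nat"
    by (rule Abs_poly_mapping_inverse) (auto intro: finite_subset[of _ "{1..<N}"])
  have out: "Poly_Mapping.lookup \<iota> k = 0" if "\<iota> \<in> e_indices_below N" "k \<notin> {1..<N}" for \<iota> k
    using that by (auto simp: e_indices_below_def in_keys_iff)
  show "\<forall>\<iota>\<in>e_indices_below N. Abs_poly_mapping
      (\<lambda>k. if k \<in> {1..<N} then restrict (Poly_Mapping.lookup \<iota>) {1..<N} k else 0) = \<iota>"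
  proof
    fix \<iota> assume "\<iota> \<in> e_indices_below N"
    then show "Abs_poly_mapping (\<lambda>k. if k \<in> {1..<N} then restrict (Poly_Mapping.lookup \<iota>) {1..<N} k else 0) = \<iota>"
      by (intro poly_mapping_eqI) (auto simp only: lk restrict_apply out split: if_splits)
  qed
  show "\<forall>g\<in>PiE {1..<N} (\<lambda>k. {..k}).
      restrict (Poly_Mapping.lookup (Abs_poly_mapping (\<lambda>k. if k \<in> {1..<N} then g k else 0))) {1..<N} = g"
    by (auto simp only: lk fun_eq_iff restrict_apply PiE_def extensional_def split: if_splits)
  show "(\<lambda>\<iota>. restrict (Poly_Mapping.lookup \<iota>) {1..<N}) ` e_indices_below N \<subseteq> PiE {1..<N} (\<lambda>k. {..k})"
    by (auto simp: e_indices_below_def e_indices_def)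
  show "(\<lambda>g. Abs_poly_mapping (\<lambda>k. if k \<in> {1..<N} then g k else 0)) ` PiE {1..<N} (\<lambda>k. {..k}) \<subseteq> e_indices_below N"
  proof
    fix \<iota> assume "\<iota> \<in> (\<lambda>g. Abs_poly_mapping (\<lambda>k. if k \<in> {1..<N} then g k else 0)) ` PiE {1..<N} (\<lambda>k. {..k})"
    then obtain g where g: "g \<in> PiE {1..<N} (\<lambda>k. {..k})"
      "\<iota> = Abs_poly_mapping (\<lambda>k. if k \<in> {1..<N} then g k else 0)" by blast
    have "Poly_Mapping.lookup \<iota> k \<le> k" "k \<notin> {1..<N} \<Longrightarrow> Poly_Mapping.lookup \<iota> k = 0" for k
      unfolding g(2) lk using g(1) by (auto simp: PiE_def Pi_def)
    then show "\<iota> \<in> e_indices_below N"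
      by (auto simp: e_indices_below_def e_indices_def in_keys_iff simp del: atLeastLessThan_iff)
  qed
qed

lemma finite_e_indices_below [simp]: "finite (e_indices_below N)"
  using bij_betw_finite[OF bij_betw_e_indices_below[of N]] by (simp add: finite_PiE)

lemma lookup_e_dual:
  "Poly_Mapping.lookup (e_dual N lam) \<iota>
    = (if \<iota> \<in> e_indices_below N then lam (e_complement N (Poly_Mapping.lookup \<iota>)) else 0)"
proof -
  have "finite {\<iota>. (if \<iota> \<in> e_indices_below N then lam (e_complement N (Poly_Mapping.lookup \<iota>)) else 0) \<noteq> 0}"
    by (rule finite_subset[OF _ finite_e_indices_below[of N]]) (auto split: if_splits)
  then show ?thesis
    unfolding e_dual_def by (subst Abs_poly_mapping_inverse) auto
qed

lemma keys_e_dual: "Poly_Mapping.keys (e_dual N lam) \<subseteq> e_indices_below N"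
  by (auto simp: in_keys_iff lookup_e_dual split: if_splits)

lemma cconst_prod: "cconst (\<Prod>i\<in>I. a i) = (\<Prod>i\<in>I. cconst (a i) :: 'v cpoly)"
  by (rule cpoly_eqI) simp

lemma sum_e_dual:
  assumes lam: "clinear_form lam"
  shows "(\<Sum>\<iota>\<in>e_indices_below N. Poly_Mapping.lookup (e_dual N lam) \<iota>
      * (\<Prod>k\<in>{1..<N}. E k (Poly_Mapping.lookup \<iota> k))) = lam (e_kernel N E)"
proof -
  have "lam (e_kernel N E)
      = lam (\<Sum>g\<in>PiE {1..<N} (\<lambda>k. {..k}). \<Prod>k\<in>{1..<N}. cconst (E k (g k)) * cvar (N - k) ^ (k - g k))"
    unfolding e_kernel_def by (subst prod_sum_PiE) auto
  also have "\<dots> = (\<Sum>g\<in>PiE {1..<N} (\<lambda>k. {..k}). (\<Prod>k\<in>{1..<N}. E k (g k)) * lam (e_complement N g))"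
    using lam unfolding clinear_form_sum[OF lam]
    by (simp add: prod.distrib e_complement_def clinear_form_def flip: cconst_prod)
  also have "\<dots> = (\<Sum>\<iota>\<in>e_indices_below N. (\<Prod>k\<in>{1..<N}. E k (restrict (Poly_Mapping.lookup \<iota>) {1..<N} k))
      * lam (e_complement N (restrict (Poly_Mapping.lookup \<iota>) {1..<N})))"
    by (rule sum.reindex_bij_betw[OF bij_betw_e_indices_below, symmetric])
  also have "\<dots> = (\<Sum>\<iota>\<in>e_indices_below N. Poly_Mapping.lookup (e_dual N lam) \<iota>
      * (\<Prod>k\<in>{1..<N}. E k (Poly_Mapping.lookup \<iota> k)))"
    by (intro sum.cong refl) (simp add: lookup_e_dual e_complement_def)
  finally show ?thesis by simp
qed

lemma cpoly_eval_e_combination_e_dual: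
  assumes "clinear_form lam" "\<And>k. e 0 k = 1"
  shows "cpoly_eval f (e_combination e (e_dual N lam)) = lam (e_kernel N (\<lambda>k i. cpoly_eval f (e i k)))"
proof -
  have "e_combination e (e_dual N lam) = (\<Sum>\<iota>\<in>e_indices_below N. cconst (Poly_Mapping.lookup (e_dual N lam) \<iota>)
      * (\<Prod>k\<in>{1..<N}. e (Poly_Mapping.lookup \<iota> k) k))"
    by (rule e_combination_superset[OF finite_e_indices_below keys_e_dual])
       (use assms(2) in \<open>auto simp: e_indices_below_def\<close>)
  then show ?thesis
    using sum_e_dual[OF assms(1), of N "\<lambda>k i. cpoly_eval f (e i k)"] by simp
qed

abbreviation esym_at :: "(nat \<Rightarrow> complex) \<Rightarrow> nat \<Rightarrow> nat \<Rightarrow> complex" where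
  "esym_at f k i \<equiv> cpoly_eval f (esym i k)"

lemma e_kernel_esym:
  "e_kernel N (esym_at f) = (\<Prod>k\<in>{..<N}. \<Prod>j\<in>{1..k}. cconst (f j) + cvar (N - k))"
proof (rule cpoly_eqI)
  fix g
  have "cpoly_eval g (e_kernel N (esym_at f)) = (\<Prod>k\<in>{1..<N}. \<Prod>j\<in>{1..k}. f j + g (N - k))"
    by (simp add: e_kernel_def sum_esym_eval)
  also have "\<dots> = (\<Prod>k\<in>{..<N}. \<Prod>j\<in>{1..k}. f j + g (N - k))"
    by (rule prod.mono_neutral_left) (auto simp: Suc_le_eq)
  finally show "cpoly_eval g (e_kernel N (esym_at f))
      = cpoly_eval g (\<Prod>k\<in>{..<N}. \<Prod>j\<in>{1..k}. cconst (f j) + cvar (N - k))"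
    by simp
qed

text \<open>The staircase product of the x_i + y_j with i + j at most N has the corner factor x_i +
  y_{N-i}. Without this factor the product \<open>h\<close> is symmetric both in x_i, x_{i+1} and in
  y_{N-i}, y_{N-i+1}.\<close>

lemma e_kernel_swap:
  assumes i: "1 \<le> i" "i < N"
  obtains h where "swap_vars (N - i) h = h"
    "e_kernel N (esym_at f) = (cconst (f i) + cvar (N - i)) * h"
    "e_kernel N (esym_at (f \<circ> adj_transp i)) = (cconst (f (Suc i)) + cvar (N - i)) * h"
proof -
  define c where "c l k = (\<Prod>j\<in>{1..l}. cconst (f j) + cvar (N - k) :: nat cpoly)" for l k
  define h where "h = c (i - 1) i * c (i - 1) (i - 1) * (\<Prod>k\<in>{..<N} - {i, i - 1}. c k k)"
  have split: "(\<Prod>k\<in>{..<N}. x k) = x i * (x (i - 1) * (\<Prod>k\<in>{..<N} - {i, i - 1}. x k))" for x :: "nat \<Rightarrow> nat cpoly"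
  proof -
    have "{..<N} = insert i (insert (i - 1) ({..<N} - {i, i - 1}))" using i by auto
    then have "(\<Prod>k\<in>{..<N}. x k) = (\<Prod>k\<in>insert i (insert (i - 1) ({..<N} - {i, i - 1})). x k)"
      by simp
    also have "\<dots> = x i * (x (i - 1) * (\<Prod>k\<in>{..<N} - {i, i - 1}. x k))"
      using i by (subst prod.insert; (subst prod.insert)?) auto
    finally show ?thesis .
  qed
  have ii: "{1..i} = insert i {1..i - 1}" using i by auto
  have cii: "c i k = (cconst (f i) + cvar (N - k)) * c (i - 1) k" for k
    unfolding c_def ii using i by (subst prod.insert) auto
  have "e_kernel N (esym_at f) = (\<Prod>k\<in>{..<N}. c k k)"
    by (simp add: e_kernel_esym c_def)
  also have "\<dots> = (cconst (f i) + cvar (N - i)) * h"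
    by (simp add: split h_def cii mult_ac)
  finally have 1: "e_kernel N (esym_at f) = (cconst (f i) + cvar (N - i)) * h" .
  define c' where "c' l k = (\<Prod>j\<in>{1..l}. cconst (f (adj_transp i j)) + cvar (N - k) :: nat cpoly)" for l k
  have c'_less: "c' l k = c l k" if "l < i" for l k
    unfolding c_def c'_def using that by (intro prod.cong) (auto simp: transpose_apply_other)
  have c'_gr: "c' l k = c l k" if "i < l" for l k
    unfolding c_def c'_def
    by (rule prod.reindex_bij_witness[of _ "adj_transp i" "adj_transp i"])
       (use that i in \<open>auto simp: Transposition.transpose_def\<close>)
  have "e_kernel N (esym_at (f \<circ> adj_transp i)) = (\<Prod>k\<in>{..<N}. c' k k)"
    by (simp add: e_kernel_esym c'_def)
  also have "\<dots> = c' i i * (c' (i - 1) (i - 1) * (\<Prod>k\<in>{..<N} - {i, i - 1}. c' k k))"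
    by (rule split)
  also have "(\<Prod>k\<in>{..<N} - {i, i - 1}. c' k k) = (\<Prod>k\<in>{..<N} - {i, i - 1}. c k k)"
  proof (rule prod.cong)
    fix k assume "k \<in> {..<N} - {i, i - 1}"
    then have "k < i \<or> i < k" by auto
    then show "c' k k = c k k" using c'_less c'_gr by blast
  qed simp
  also have "c' i i = (cconst (f (Suc i)) + cvar (N - i)) * c' (i - 1) i"
    unfolding c'_def ii using i by (subst prod.insert) auto
  finally have 2: "e_kernel N (esym_at (f \<circ> adj_transp i)) = (cconst (f (Suc i)) + cvar (N - i)) * h"
    using i by (simp add: h_def c'_less mult_ac comp_def)
  have "swap_vars (N - i) (c (i - 1) i) = c (i - 1) (i - 1)" "swap_vars (N - i) (c (i - 1) (i - 1)) = c (i - 1) i"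
    using i by (auto simp: c_def swap_vars_prod swap_vars_add swap_vars_cvar Suc_diff_le Suc_diff_Suc)
  moreover have "swap_vars (N - i) (c k k) = c k k" if "k \<in> {..<N} - {i, i - 1}" for k
    unfolding c_def swap_vars_prod swap_vars_add swap_vars_cvar swap_vars_cconst
    using that i by (intro prod.cong) (auto simp: transpose_apply_other)
  ultimately have "swap_vars (N - i) h = h"
    by (simp add: h_def swap_vars_mult swap_vars_prod)
  with 1 2 show thesis by (intro that)
qed

text \<open>The divided difference \<open>i\<close> in x and the divided difference
  \<open>N - i\<close> in y both reduce the kernel (x_i + y_{N-i}) h to \<open>h\<close>. A descent
  in x therefore lengthens the functional by one divided difference in y.\<close>

lemma divdiff_e_combination_e_dual:
  assumes i: "1 \<le> i" "i < N" and lam: "clinear_form lam" "clinear_form (lam \<circ> divdiff (N - i))"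
  shows "divdiff i (e_combination esym (e_dual N lam)) = e_combination esym (e_dual N (lam \<circ> divdiff (N - i)))"
proof (rule divdiff_unique_eval)
  fix f
  obtain h where h: "swap_vars (N - i) h = h"
    "e_kernel N (esym_at f) = (cconst (f i) + cvar (N - i)) * h"
    "e_kernel N (esym_at (f \<circ> adj_transp i)) = (cconst (f (Suc i)) + cvar (N - i)) * h"
    using e_kernel_swap[OF i, of f] by blast
  have "divdiff (N - i) (cconst (f i) + cvar (N - i)) = 1"
    by (rule divdiff_unique) (simp add: swap_vars_add swap_vars_cvar)
  then have d: "divdiff (N - i) (e_kernel N (esym_at f)) = h"
    using divdiff_mult_sym[OF h(1), of "cconst (f i) + cvar (N - i)"] h(2) by (simp add: mult.commute)
  have l: "lam ((cconst a + cvar (N - i)) * h) = a * lam h + lam (cvar (N - i) * h)" for a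
    using lam(1) by (simp add: distrib_right clinear_form_def)
  show "(f i - f (Suc i)) * cpoly_eval f (e_combination esym (e_dual N (lam \<circ> divdiff (N - i))))
      = cpoly_eval f (e_combination esym (e_dual N lam))
        - cpoly_eval (f \<circ> adj_transp i) (e_combination esym (e_dual N lam))"
    by (simp add: cpoly_eval_e_combination_e_dual lam d) (simp add: h l left_diff_distrib)
qed

text \<open>The functionals reached from evaluation at the origin by such steps; the last letter of
  \<open>js\<close> acts first.\<close>

definition dd_word :: "nat list \<Rightarrow> nat cpoly \<Rightarrow> complex" where
  "dd_word js p = cpoly_eval (\<lambda>_. 0) (foldr divdiff js p)"

lemma foldr_divdiff_add: "foldr divdiff js (p + q) = foldr divdiff js p + foldr divdiff js q"
  by (induction js) (auto simp: divdiff_add)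

lemma foldr_divdiff_mult_sym:
  assumes "\<And>j. j \<in> set js \<Longrightarrow> swap_vars j s = s"
  shows "foldr divdiff js (s * p) = s * foldr divdiff js p"
  using assms by (induction js) (auto simp: divdiff_mult_sym)

lemma clinear_form_dd_word: "clinear_form (dd_word js)"
  by (auto simp: clinear_form_def dd_word_def foldr_divdiff_add foldr_divdiff_mult_sym)

lemma dd_word_comp_divdiff: "dd_word js \<circ> divdiff j = dd_word (js @ [j])"
  by (simp add: fun_eq_iff dd_word_def)

lemma prod_prod_upto: "(\<Prod>k\<in>{..<N}. \<Prod>j\<in>{1..k}. f j) = (\<Prod>i\<in>{1..N}. f i ^ (N - i))"
  for f :: "nat \<Rightarrow> 'a::comm_monoid_mult"
proof (induction N)
  case (Suc N)
  have "(\<Prod>i\<in>{1..N}. f i ^ (Suc N - i)) = (\<Prod>i\<in>{1..N}. f i ^ (N - i) * f i)"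
    by (rule prod.cong) (auto simp: Suc_diff_le mult.commute)
  with Suc show ?case by (simp add: prod.distrib)
qed simp

lemma adj_transp_complement:
  assumes "1 \<le> j" "j < N"
  shows "adj_transp (N - j) x \<in> {1..N} \<longleftrightarrow> x \<in> {1..N}"
    and "x \<in> {1..N} \<Longrightarrow> N + 1 - adj_transp (N - j) x = adj_transp j (N + 1 - x)"
    and "x \<notin> {1..N} \<Longrightarrow> adj_transp (N - j) x = x"
    and "x \<notin> {1..N} \<Longrightarrow> adj_transp j x = x"
  using assms by (auto simp: Transposition.transpose_def)

definition flip :: "nat \<Rightarrow> (nat \<Rightarrow> nat) \<Rightarrow> nat \<Rightarrow> nat" where
  "flip N w = longest N \<circ> w \<circ> longest N"

text \<open>Follows \<open>w\<close> and its conjugate simultaneously: a descent of \<open>w\<close>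
  at \<open>i\<close> is a descent of \<open>flip N w\<close> at \<open>N - i\<close>. It appends
  \<open>N - i\<close> to the first word and \<open>i\<close> to the second, so the words stay
  related by \<open>j \<mapsto> N - j\<close>. At the start, y = 0 turns the kernel into the
  staircase monomial.\<close>

lemma schubert_in_dd_word:
  assumes "schubert_in N w p"
  shows "\<exists>js. set js \<subseteq> {1..<N} \<and> p = e_combination esym (e_dual N (dd_word js))
    \<and> schubert_in N (flip N w) (e_combination esym (e_dual N (dd_word (map (\<lambda>j. N - j) js))))"
  using assms
proof (induction rule: schubert_in.induct)
  case longest
  have "(\<Prod>i\<in>{1..N}. cvar i ^ (N - i)) = e_combination esym (e_dual N (dd_word []))"
  proof (rule cpoly_eqI)
    fix f
    show "cpoly_eval f (\<Prod>i\<in>{1..N}. cvar i ^ (N - i)) = cpoly_eval f (e_combination esym (e_dual N (dd_word [])))"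
      using prod_prod_upto[of f N]
      by (simp add: cpoly_eval_e_combination_e_dual clinear_form_dd_word)
         (simp add: dd_word_def e_kernel_esym)
  qed
  moreover have "flip N (longest N) = longest N" by (simp add: flip_def fun_eq_iff)
  ultimately show ?case
    using schubert_in.longest[of N] by (intro exI[of _ "[]"]) auto
next
  case (descent w p i)
  then obtain js where js: "set js \<subseteq> {1..<N}" "p = e_combination esym (e_dual N (dd_word js))"
    "schubert_in N (flip N w) (e_combination esym (e_dual N (dd_word (map (\<lambda>j. N - j) js))))" by blast
  have w: "w permutes {1..N}" using descent.hyps(1) by (rule schubert_in_permutes)
  then have wi: "w i \<in> {1..N}" "w (Suc i) \<in> {1..N}"
    using permutes_in_image[OF w, of i] permutes_in_image[OF w, of "Suc i"] descent.hyps(2,3) by simp_all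
  have "divdiff i p = e_combination esym (e_dual N (dd_word (js @ [N - i])))"
    unfolding js(2) using descent.hyps
    by (subst divdiff_e_combination_e_dual) (auto simp: dd_word_comp_divdiff clinear_form_dd_word)
  moreover have "schubert_in N (flip N (w \<circ> adj_transp i))
      (e_combination esym (e_dual N (dd_word (map (\<lambda>j. N - j) (js @ [N - i])))))"
  proof -
    have "schubert_in N (flip N (w \<circ> adj_transp i))
        (divdiff (N - i) (e_combination esym (e_dual N (dd_word (map (\<lambda>j. N - j) js)))))"
    proof (rule descentI[OF js(3)])
      show "flip N w (Suc (N - i)) < flip N w (N - i)"
        using descent.hyps wi by (auto simp: flip_def longest_def Suc_diff_le)
      show "flip N (w \<circ> adj_transp i) = flip N w \<circ> adj_transp (N - i)"
      proof
        fix x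
        have "adj_transp i (longest N x) = longest N (adj_transp (N - i) x)"
          using adj_transp_complement[OF descent.hyps(2,3), of x]
          by (simp add: longest_def del: atLeastAtMost_iff)
        then show "flip N (w \<circ> adj_transp i) x = (flip N w \<circ> adj_transp (N - i)) x"
          by (simp add: flip_def)
      qed
    qed (use descent.hyps in auto)
    also have "divdiff (N - i) (e_combination esym (e_dual N (dd_word (map (\<lambda>j. N - j) js))))
        = e_combination esym (e_dual N (dd_word (map (\<lambda>j. N - j) (js @ [N - i]))))"
      using descent.hyps
      by (subst divdiff_e_combination_e_dual) (auto simp: dd_word_comp_divdiff clinear_form_dd_word)
    finally show ?thesis .
  qed
  moreover have "set (js @ [N - i]) \<subseteq> {1..<N}"
    using js(1) descent.hyps(2,3) by auto
  ultimately show ?case by blast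
qed

text \<open>The substitution of -y_{N+1-v} for y_v. Its sign turns y_j - y_{j+1} into y_{N-j} -
  y_{N-j+1}, so that the divided differences \<open>j\<close> and \<open>N - j\<close> are
  intertwined without a sign.\<close>

definition reflect :: "nat \<Rightarrow> (nat \<Rightarrow> complex) \<Rightarrow> nat \<Rightarrow> complex" where
  "reflect N f v = (if v \<in> {1..N} then - f (N + 1 - v) else f v)"

lemma foldr_divdiff_reflect:
  assumes "set js \<subseteq> {1..<N}" "\<And>f. cpoly_eval f g = cpoly_eval (reflect N f) h"
  shows "cpoly_eval f (foldr divdiff js g) = cpoly_eval (reflect N f) (foldr divdiff (map (\<lambda>j. N - j) js) h)"
  using assms(1)
proof (induction js arbitrary: f)
  case Nil
  then show ?case by (simp add: assms(2))
next
  case (Cons j js)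
  define g' h' where "g' = foldr divdiff js g" and "h' = foldr divdiff (map (\<lambda>j. N - j) js) h"
  have IH: "cpoly_eval f g' = cpoly_eval (reflect N f) h'" for f
    unfolding g'_def h'_def using Cons by auto
  have "\<exists>q. \<forall>f. cpoly_eval f q = cpoly_eval (reflect N f) (divdiff (N - j) h')"
  proof (rule cpoly_subst_exists)
    fix v
    show "\<exists>q. \<forall>f. cpoly_eval f q = reflect N f v"
      by (rule exI[of _ "if v \<in> {1..N} then - cvar (N + 1 - v) else cvar v"]) (auto simp: reflect_def)
  qed
  then obtain q where q: "\<And>f. cpoly_eval f q = cpoly_eval (reflect N f) (divdiff (N - j) h')" by blast
  have j: "1 \<le> j" "j < N" using Cons.prems by auto
  \<comment> \<open>\<open>q\<close> is the reflected divided difference of \<open>h'\<close>;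
    uniqueness of the quotient identifies it once the linear factors are seen to agree.\<close>
  have "divdiff j g' = q"
  proof (rule divdiff_unique_eval)
    fix f :: "nat \<Rightarrow> complex"
    have "reflect N f (N - j) - reflect N f (Suc (N - j)) = f j - f (Suc j)"
    proof -
      have "N - j \<in> {1..N}" "Suc (N - j) \<in> {1..N}" "N + 1 - (N - j) = Suc j" "N + 1 - Suc (N - j) = j"
        using j by auto
      then show ?thesis by (simp only: reflect_def if_True) simp
    qed
    moreover have "reflect N f \<circ> adj_transp (N - j) = reflect N (f \<circ> adj_transp j)"
    proof
      fix x
      show "(reflect N f \<circ> adj_transp (N - j)) x = reflect N (f \<circ> adj_transp j) x"
        using adj_transp_complement[OF j, of x] by (simp add: reflect_def del: atLeastAtMost_iff)
    qed
    ultimately show "(f j - f (Suc j)) * cpoly_eval f q = cpoly_eval f g' - cpoly_eval (f \<circ> adj_transp j) g'"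
      using divdiff_eval[of "reflect N f" "N - j" h'] by (simp add: q IH)
  qed
  then show ?case by (simp add: q g'_def h'_def)
qed

lemma dd_word_reflect:
  assumes "set js \<subseteq> {1..<N}" "\<And>f. cpoly_eval f g = cpoly_eval (reflect N f) h"
  shows "dd_word js g = dd_word (map (\<lambda>j. N - j) js) h"
proof -
  have "reflect N (\<lambda>_. 0) = (\<lambda>_. 0)" by (auto simp: fun_eq_iff reflect_def)
  then show ?thesis
    using foldr_divdiff_reflect[OF assms, of "\<lambda>_. 0"] by (simp add: dd_word_def)
qed

lemma dd_word_mult_sym:
  assumes "\<And>j. j \<in> set js \<Longrightarrow> swap_vars j s = s"
  shows "dd_word js (s * p) = cpoly_eval (\<lambda>_. 0) s * dd_word js p"
  using assms by (simp add: dd_word_def foldr_divdiff_mult_sym)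

text \<open>Putting t = y_j in the product of all y_l - t gives 0, so y_j^N lies in the ideal of
  symmetric polynomials without constant term. These pass through every divided difference in
  \<open>js\<close> and vanish at the origin.\<close>

lemma dd_word_cvar_power:
  assumes js: "set js \<subseteq> {1..<N}" and j: "j \<in> {1..N}"
  shows "dd_word js (cvar j ^ N * p) = 0"
proof -
  let ?t = "\<lambda>i. esym i N * (- cvar j) ^ (N - i) :: nat cpoly"
  have "(\<Sum>i\<le>N. ?t i) = 0"
  proof (rule cpoly_eqI)
    fix f
    have "cpoly_eval f (\<Sum>i\<le>N. ?t i) = (\<Prod>l\<in>{1..N}. f l + - f j)"
      unfolding sum_esym_eval[symmetric] by simp
    also have "\<dots> = 0" using j by (intro prod_zero) auto
    finally show "cpoly_eval f (\<Sum>i\<le>N. ?t i) = cpoly_eval f 0" by simp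
  qed
  also have "{..N} = insert 0 {1..N}" by auto
  finally have "?t 0 + (\<Sum>i\<in>{1..N}. ?t i) = 0" by simp
  then have "(- cvar j) ^ N = - (\<Sum>i\<in>{1..N}. ?t i)"
    by (simp add: eq_neg_iff_add_eq_0)
  note pow = this
  have "cvar j ^ N * p = (- cvar j) ^ N * ((- 1) ^ N * p)"
  proof -
    have "(- 1) ^ N * (- 1) ^ N = (1 :: nat cpoly)" by (simp flip: power_mult_distrib)
    moreover have "(- cvar j) ^ N * ((- 1) ^ N * p) = ((- 1) ^ N * (- 1) ^ N) * (cvar j ^ N * p)"
      unfolding power_minus[of "cvar j" N] by (simp only: mult_ac)
    ultimately show ?thesis by (simp only: mult_1_left)
  qed
  also have "\<dots> = (\<Sum>i\<in>{1..N}. esym i N * ((- cvar j) ^ (N - i) * (- ((- 1) ^ N * p))))"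
    by (simp only: pow minus_mult_commute sum_distrib_right mult.assoc)
  finally have "cvar j ^ N * p = (\<Sum>i\<in>{1..N}. esym i N * ((- cvar j) ^ (N - i) * (- ((- 1) ^ N * p))))" .
  then have "dd_word js (cvar j ^ N * p)
      = (\<Sum>i\<in>{1..N}. dd_word js (esym i N * ((- cvar j) ^ (N - i) * (- ((- 1) ^ N * p)))))"
    by (simp only: clinear_form_sum[OF clinear_form_dd_word])
  also have "\<dots> = 0"
  proof (rule sum.neutral, rule ballI)
    fix i assume i: "i \<in> {1..N}"
    have "cpoly_eval (\<lambda>_. 0) (esym i N) = 0"
      unfolding cpoly_eval_esym
    proof (rule sum.neutral, rule ballI)
      fix S assume S: "S \<in> {S. S \<subseteq> {1..N} \<and> card S = i}"
      then have "finite S" "S \<noteq> {}" using i by (auto dest: finite_subset)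
      then show "(\<Prod>j\<in>S. 0 :: complex) = 0" by auto
    qed
    moreover have "swap_vars j' (esym i N) = esym i N" if "j' \<in> set js" for j'
      by (rule swap_vars_esym) (use that js in auto)
    ultimately show "dd_word js (esym i N * ((- cvar j) ^ (N - i) * (- ((- 1) ^ N * p)))) = 0"
      by (subst dd_word_mult_sym) auto
  qed
  finally show ?thesis .
qed

section \<open>Tridiagonal determinants and Toeplitz minors\<close>

lemma det_mat_lower_triangular:
  assumes "\<And>i j. \<lbrakk>i < j; j < n\<rbrakk> \<Longrightarrow> f (i, j) = 0"
  shows "Determinant.det (mat n n f) = (\<Prod>i<n. f (i, i))"
  by (subst det_lower_triangular[of n])
     (use assms in \<open>auto simp: prod_list_diag_prod atLeast0LessThan\<close>)

lemma det_mat_upper_triangular: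
  assumes "\<And>i j. \<lbrakk>j < i; i < n\<rbrakk> \<Longrightarrow> f (i, j) = 0"
  shows "Determinant.det (mat n n f) = (\<Prod>i<n. f (i, i))"
  by (subst det_upper_triangular[of _ n])
     (use assms in \<open>auto simp: prod_list_diag_prod atLeast0LessThan upper_triangular_def\<close>)

lemma det_mat_row_single:
  assumes "i < Suc n" "j < Suc n" "\<And>j'. \<lbrakk>j' < Suc n; j' \<noteq> j\<rbrakk> \<Longrightarrow> f (i, j') = 0"
  shows "Determinant.det (mat (Suc n) (Suc n) f) = f (i, j) * (- 1) ^ (i + j)
    * Determinant.det (mat n n (\<lambda>(a, b). f (if a < i then a else Suc a, if b < j then b else Suc b)))"
proof -
  let ?A = "mat (Suc n) (Suc n) f"
  have "Determinant.det ?A = (\<Sum>j'<Suc n. ?A $$ (i, j') * cofactor ?A i j')"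
    by (rule laplace_expansion_row) (use assms in auto)
  also have "\<dots> = (\<Sum>j'\<in>{j}. ?A $$ (i, j') * cofactor ?A i j')"
    by (rule sum.mono_neutral_right) (use assms in auto)
  also have "\<dots> = f (i, j) * (- 1) ^ (i + j) * Determinant.det (mat_delete ?A i j)"
    using assms by (simp add: cofactor_def)
  also have "mat_delete ?A i j = mat n n (\<lambda>(a, b). f (if a < i then a else Suc a, if b < j then b else Suc b))"
    by (rule eq_matI) (auto simp: mat_delete_def)
  finally show ?thesis .
qed

lemma det_mat_column_single:
  assumes "i < Suc n" "j < Suc n" "\<And>i'. \<lbrakk>i' < Suc n; i' \<noteq> i\<rbrakk> \<Longrightarrow> f (i', j) = 0"
  shows "Determinant.det (mat (Suc n) (Suc n) f) = f (i, j) * (- 1) ^ (i + j)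
    * Determinant.det (mat n n (\<lambda>(a, b). f (if a < i then a else Suc a, if b < j then b else Suc b)))"
proof -
  let ?A = "mat (Suc n) (Suc n) f"
  have "Determinant.det ?A = (\<Sum>i'<Suc n. ?A $$ (i', j) * cofactor ?A i' j)"
    by (rule laplace_expansion_column) (use assms in auto)
  also have "\<dots> = (\<Sum>i'\<in>{i}. ?A $$ (i', j) * cofactor ?A i' j)"
    by (rule sum.mono_neutral_right) (use assms in auto)
  also have "\<dots> = f (i, j) * (- 1) ^ (i + j) * Determinant.det (mat_delete ?A i j)"
    using assms by (simp add: cofactor_def)
  also have "mat_delete ?A i j = mat n n (\<lambda>(a, b). f (if a < i then a else Suc a, if b < j then b else Suc b))"
    by (rule eq_matI) (auto simp: mat_delete_def)
  finally show ?thesis .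
qed

lemma det_mat_cong:
  assumes "\<And>a b. \<lbrakk>a < n; b < n\<rbrakk> \<Longrightarrow> f (a, b) = g (a, b)"
  shows "Determinant.det (mat n n f) = Determinant.det (mat n n g)"
  by (rule arg_cong[where f = Determinant.det], rule eq_matI) (use assms in auto)

lemma det_mat_mult:
  "Determinant.det (mat n n f) * Determinant.det (mat n n g)
    = Determinant.det (mat n n (\<lambda>(a, b). \<Sum>j<n. f (a, j) * g (j, b)))"
proof -
  have "mat n n f * mat n n g = mat n n (\<lambda>(a, b). \<Sum>j<n. f (a, j) * g (j, b))"
    by (rule eq_matI) (auto simp: scalar_prod_def atLeast0LessThan)
  then show ?thesis
    by (subst det_mult[of _ n, symmetric]) auto
qed

definition tridiag :: "(nat \<Rightarrow> 'a::comm_ring_1) \<Rightarrow> (nat \<Rightarrow> 'a) \<Rightarrow> (nat \<Rightarrow> 'a) \<Rightarrow> nat \<Rightarrow> 'a mat" where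
  "tridiag d u l k = mat k k (\<lambda>(a, b). if a = b then d a else if b = Suc a then u a
     else if a = Suc b then l b else 0)"

lemma det_tridiag_Suc_Suc:
  "Determinant.det (tridiag d u l (Suc (Suc k)))
    = d (Suc k) * Determinant.det (tridiag d u l (Suc k)) - u k * l k * Determinant.det (tridiag d u l k)"
proof -
  let ?f = "\<lambda>(a, b). if a = b then d a else if b = Suc a then u a else if a = Suc b then l b else 0"
  let ?A = "mat (Suc (Suc k)) (Suc (Suc k)) ?f"
  have "Determinant.det ?A = (\<Sum>j<Suc (Suc k). ?A $$ (Suc k, j) * cofactor ?A (Suc k) j)"
    by (rule laplace_expansion_row) auto
  also have "\<dots> = (\<Sum>j\<in>{k, Suc k}. ?A $$ (Suc k, j) * cofactor ?A (Suc k) j)"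
    by (rule sum.mono_neutral_right) auto
  also have "\<dots> = l k * (- 1) ^ (Suc k + k) * Determinant.det (mat_delete ?A (Suc k) k)
      + d (Suc k) * (- 1) ^ (Suc k + Suc k) * Determinant.det (mat_delete ?A (Suc k) (Suc k))"
    by (simp add: cofactor_def)
  also have "(- 1 :: 'a) ^ (Suc k + k) = - 1" by simp
  also have "(- 1 :: 'a) ^ (Suc k + Suc k) = 1" by simp
  also have "mat_delete ?A (Suc k) (Suc k) = tridiag d u l (Suc k)"
    by (rule eq_matI) (auto simp: mat_delete_def tridiag_def)
  also have "Determinant.det (mat_delete ?A (Suc k) k) = u k * Determinant.det (tridiag d u l k)"
  proof -
    have "mat_delete ?A (Suc k) k = mat (Suc k) (Suc k) (\<lambda>(a, b). ?f (a, if b < k then b else Suc b))"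
      by (rule eq_matI) (auto simp: mat_delete_def)
    then have "Determinant.det (mat_delete ?A (Suc k) k)
        = Determinant.det (mat (Suc k) (Suc k) (\<lambda>(a, b). ?f (a, if b < k then b else Suc b)))"
      by simp
    also have "\<dots> = u k * (- 1) ^ (k + k) * Determinant.det (mat k k (\<lambda>(a, b).
        (\<lambda>(a, b). ?f (a, if b < k then b else Suc b)) (if a < k then a else Suc a, if b < k then b else Suc b)))"
      by (subst det_mat_column_single[of k k k]) auto
    also have "Determinant.det (mat k k (\<lambda>(a, b).
        (\<lambda>(a, b). ?f (a, if b < k then b else Suc b)) (if a < k then a else Suc a, if b < k then b else Suc b)))
        = Determinant.det (tridiag d u l k)"
      unfolding tridiag_def by (rule det_mat_cong) auto
    finally show ?thesis by simp
  qed
  finally show ?thesis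
    by (simp add: tridiag_def algebra_simps)
qed

lemma qesym_tridiag:
  "qesym i k = Polynomial.coeff (Determinant.det
     (tridiag (\<lambda>a. [:1, cvar (X (Suc a)):]) (\<lambda>a. [:0, cvar (Q (Suc a)):]) (\<lambda>_. [:0, - 1:]) k)) i"
proof -
  have "1\<^sub>m k + [:0, 1:] \<cdot>\<^sub>m map_mat (\<lambda>g. [:g:]) (Gmat k)
      = tridiag (\<lambda>a. [:1, cvar (X (Suc a)):]) (\<lambda>a. [:0, cvar (Q (Suc a)):]) (\<lambda>_. [:0, - 1:]) k"
    by (rule eq_matI) (auto simp: Gmat_def tridiag_def one_pCons)
  then show ?thesis by (simp add: qesym_def)
qed

lemma qesym_0_right: "qesym i 0 = (if i = 0 then 1 else 0)"
  by (simp add: qesym_tridiag tridiag_def)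

lemma qesym_1_right: "qesym i (Suc 0) = (if i = 0 then 1 else if i = 1 then cvar (X 1) else 0)"
proof -
  have "Determinant.det (tridiag (\<lambda>a. [:1, cvar (X (Suc a)):]) u l (Suc 0)) = [:1, cvar (X (Suc 0)):]" for u l
    unfolding tridiag_def by (subst det_mat_lower_triangular) auto
  then show ?thesis
    by (cases i) (auto simp: qesym_tridiag coeff_pCons split: nat.split)
qed

lemma qesym_Suc_Suc_right:
  "qesym i (Suc (Suc k)) = qesym i (Suc k)
    + (if i \<ge> 1 then cvar (X (Suc (Suc k))) * qesym (i - 1) (Suc k) else 0)
    + (if i \<ge> 2 then cvar (Q (Suc k)) * qesym (i - 2) k else 0)"
proof -
  have c: "Polynomial.coeff ([:a, b:] * p) i = a * Polynomial.coeff p i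
      + (if i \<ge> 1 then b * Polynomial.coeff p (i - 1) else 0)" for a b :: "qvar cpoly" and p i
    by (cases i) (auto simp: coeff_pCons)
  have c2: "Polynomial.coeff ([:0, a:] * [:0, - 1:] * p) i
      = - (if i \<ge> 2 then a * Polynomial.coeff p (i - 2) else 0)" for a :: "qvar cpoly" and p i
    by (cases i; cases "i - 1") (auto simp: coeff_pCons)
  show ?thesis
    unfolding qesym_tridiag det_tridiag_Suc_Suc coeff_diff c c2 by simp
qed

text \<open>The monic characteristic polynomial det(t + G_k), given by its recurrence so that
  arbitrary parameters can be inserted. Its coefficients are the E_i^{(k)} in reverse order.\<close>

fun jacobi_poly :: "(nat \<Rightarrow> 'a::comm_ring_1) \<Rightarrow> (nat \<Rightarrow> 'a) \<Rightarrow> nat \<Rightarrow> 'a poly" where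
  "jacobi_poly x q 0 = 1"
| "jacobi_poly x q (Suc 0) = [:x 1, 1:]"
| "jacobi_poly x q (Suc (Suc k)) = [:x (Suc (Suc k)), 1:] * jacobi_poly x q (Suc k)
     + Polynomial.smult (q (Suc k)) (jacobi_poly x q k)"

lemma coeff_linear_mult: "Polynomial.coeff ([:a, 1:] * p) m
    = a * Polynomial.coeff p m + (if m \<ge> 1 then Polynomial.coeff p (m - 1) else (0::'a::comm_ring_1))"
  by (cases m) (auto simp: coeff_pCons)

lemma coeff_jacobi_poly_gt: "m > k \<Longrightarrow> Polynomial.coeff (jacobi_poly x q k) m = 0"
  by (induction x q k arbitrary: m rule: jacobi_poly.induct)
     (auto simp: coeff_linear_mult coeff_pCons split: nat.split)

lemma coeff_jacobi_poly_self: "Polynomial.coeff (jacobi_poly x q k) k = 1"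
  by (induction x q k rule: jacobi_poly.induct) (auto simp: coeff_linear_mult coeff_jacobi_poly_gt)

lemma cpoly_eval_qesym:
  "cpoly_eval g (qesym i k)
    = (if i \<le> k then Polynomial.coeff (jacobi_poly (\<lambda>j. g (X j)) (\<lambda>j. g (Q j)) k) (k - i) else 0)"
proof (induction "\<lambda>j. g (X j)" "\<lambda>j. g (Q j)" k arbitrary: i rule: jacobi_poly.induct)
  case 1
  show ?case by (simp add: qesym_0_right)
next
  case 2
  show ?case by (auto simp: qesym_1_right)
next
  case (3 k)
  let ?G = "jacobi_poly (\<lambda>j. g (X j)) (\<lambda>j. g (Q j))"
  consider "i = 0" | "i = 1" | j where "i = Suc (Suc j)" by (metis One_nat_def not0_implies_Suc)
  then show ?case
  proof cases
    case 1
    then show ?thesis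
      by (simp add: qesym_Suc_Suc_right 3 coeff_linear_mult coeff_jacobi_poly_gt)
  next
    case 2
    then show ?thesis
      by (simp add: qesym_Suc_Suc_right 3 coeff_linear_mult coeff_jacobi_poly_gt)
  next
    case (3 j)
    note j = this
    show ?thesis
    proof (cases "Suc j \<le> k")
      case True
      then have "k - j = Suc (k - Suc j)" by simp
      with j True show ?thesis
        by (simp add: qesym_Suc_Suc_right "3.hyps" coeff_linear_mult Suc_diff_le)
    next
      case False
      with j show ?thesis
        by (auto simp: qesym_Suc_Suc_right "3.hyps" coeff_linear_mult coeff_jacobi_poly_gt)
    qed
  qed
qed

lemma qesym_0_left: "qesym 0 k = 1"
proof (induction k rule: induct_nat_012)
  case (ge2 n)
  then show ?case by (simp add: qesym_Suc_Suc_right)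
qed (auto simp: qesym_0_right qesym_1_right)

lemma poly_jacobi_poly_homogeneous:
  "poly (jacobi_poly x q k) y = (\<Sum>i\<le>k. Polynomial.coeff (jacobi_poly x q k) (k - i) * y ^ (k - i))"
proof -
  let ?p = "jacobi_poly x q k"
  have "Polynomial.degree ?p \<le> k"
    by (rule degree_le) (simp add: coeff_jacobi_poly_gt)
  then have "poly ?p y = (\<Sum>i\<le>k. Polynomial.coeff ?p i * y ^ i)"
    by (simp add: poly_altdef) (rule sum.mono_neutral_left, auto simp: coeff_eq_0)
  also have "\<dots> = (\<Sum>i\<le>k. Polynomial.coeff ?p (k - i) * y ^ (k - i))"
    by (rule sum.reindex_bij_witness[of _ "\<lambda>i. k - i" "\<lambda>i. k - i"]) auto
  finally show ?thesis .
qed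

text \<open>The \<open>Z k m\<close> of the overview: rows \<open>{..<k}\<close> and columns
  \<open>{m..<m + k}\<close> of \<open>toeplitz c\<close>.\<close>

definition toeplitz_minor :: "(nat \<Rightarrow> 'a::comm_ring_1) \<Rightarrow> nat \<Rightarrow> nat \<Rightarrow> 'a" where
  "toeplitz_minor c k m = Determinant.det (mat k k (\<lambda>(a, b). if a \<le> m + b then c (m + b - a) else 0))"

lemma toeplitz_minor_0 [simp]: "toeplitz_minor c 0 m = 1"
  by (simp add: toeplitz_minor_def)

lemma toeplitz_minor_1 [simp]: "toeplitz_minor c (Suc 0) m = c m"
  unfolding toeplitz_minor_def by (subst det_mat_lower_triangular) auto

lemma toeplitz_minor_0_right: "c 0 = 1 \<Longrightarrow> toeplitz_minor c k 0 = 1"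
  unfolding toeplitz_minor_def by (subst det_mat_upper_triangular) auto

locale toeplitz_moments =
  fixes c :: "nat \<Rightarrow> 'a::field" and n :: nat
begin

definition corner :: "nat \<Rightarrow> 'a" where
  "corner k = toeplitz_minor c k (n + 1 - k)"

definition h :: "nat \<Rightarrow> 'a" where
  "h m = (if m \<le> n then c (n - m) else 0)"

text \<open>\<open>moment p b\<close> is the value of \<open>t^b p(t)\<close> under the functional \<open>t^m \<mapsto> (-1)^m c_{n-m}\<close>, whose
  Hankel determinants are up to sign the corner minors.  At a Toeplitz matrix, the tridiagonal
  characteristic polynomials attached to the Peterson generators are its monic orthogonal polynomials.\<close>

definition moment :: "'a poly \<Rightarrow> nat \<Rightarrow> 'a" where
  "moment p b = (\<Sum>j\<le>Polynomial.degree p. Polynomial.coeff p j * ((- 1) ^ (j + b) * h (j + b)))"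

definition monic_orth :: "nat \<Rightarrow> 'a poly \<Rightarrow> bool" where
  "monic_orth k p \<longleftrightarrow> Polynomial.degree p = k \<and> Polynomial.coeff p k = 1 \<and> (\<forall>b<k. moment p b = 0)"

lemma corner_0 [simp]: "corner 0 = 1"
  by (simp add: corner_def)

text \<open>The Hankel matrix appears with its columns in reverse order, \<open>k - 1 - b\<close>,
  which avoids the sign of the column reversal.\<close>

lemma corner_hankel:
  "k \<le> Suc n \<Longrightarrow> corner k = Determinant.det (mat k k (\<lambda>(a, b). h (a + (k - 1 - b))))"
  unfolding corner_def toeplitz_minor_def
  by (rule det_mat_cong) (auto simp: h_def intro!: arg_cong[where f = c])

lemma moment_bound:
  assumes "Polynomial.degree p \<le> M"
  shows "moment p b = (\<Sum>j\<le>M. Polynomial.coeff p j * ((- 1) ^ (j + b) * h (j + b)))"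
  unfolding moment_def by (rule sum.mono_neutral_left) (use assms in \<open>auto simp: coeff_eq_0\<close>)

lemma moment_add: "moment (p + q) b = moment p b + moment q b"
  by (simp add: moment_bound[of _ "max (Polynomial.degree p) (Polynomial.degree q)"]
        degree_add_le algebra_simps sum.distrib)

lemma moment_smult: "moment (Polynomial.smult a p) b = a * moment p b"
  by (subst moment_bound[of _ "Polynomial.degree p"])
     (auto simp: degree_smult_le moment_def sum_distrib_left mult_ac)

lemma moment_diff: "moment (p - q) b = moment p b - moment q b"
proof -
  have "p - q = p + Polynomial.smult (- 1) q" by simp
  then show ?thesis by (simp only: moment_add moment_smult) simp
qed

lemma moment_shift: "moment (pCons 0 p) b = moment p (Suc b)"
proof -
  have "moment (pCons 0 p) b = (\<Sum>j\<le>Suc (Polynomial.degree p).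
      Polynomial.coeff (pCons 0 p) j * ((- 1) ^ (j + b) * h (j + b)))"
    by (rule moment_bound) (rule degree_pCons_le)
  also have "\<dots> = moment p (Suc b)"
    by (subst sum.atMost_Suc_shift) (simp add: moment_def)
  finally show ?thesis .
qed

text \<open>A nonzero corner minor makes the Hankel form nondegenerate in degrees below
  \<open>k\<close>. Uniqueness of the orthogonal polynomials, their recurrence and the
  Desnanot-Jacobi identity all come down to this.\<close>

lemma moment_eq_0_imp_eq_0:
  assumes k: "k \<le> Suc n" and nz: "corner k \<noteq> 0"
    and deg: "\<And>j. j \<ge> k \<Longrightarrow> Polynomial.coeff p j = 0"
    and mom: "\<And>b. b < k \<Longrightarrow> moment p b = 0"
  shows "p = 0"
proof (rule ccontr)
  assume "p \<noteq> 0"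
  let ?H = "mat k k (\<lambda>(a, b). h (a + (k - 1 - b)))"
  define v where "v = vec k (\<lambda>j. Polynomial.coeff p j * (- 1) ^ j)"
  have degp: "Polynomial.degree p \<le> k" using deg by (intro degree_le) auto
  have "?H\<^sup>T *\<^sub>v v = 0\<^sub>v k"
  proof (rule eq_vecI)
    fix b assume "b < dim_vec (0\<^sub>v k :: 'a vec)"
    then have b: "b < k" by simp
    have "0 = (- 1) ^ (k - 1 - b) * moment p (k - 1 - b)"
      using b mom[of "k - 1 - b"] by simp
    also have "\<dots> = (\<Sum>j\<le>k. (- 1) ^ (k - 1 - b) * (Polynomial.coeff p j * ((- 1) ^ (j + (k - 1 - b)) * h (j + (k - 1 - b)))))"
      by (simp add: moment_bound[OF degp] sum_distrib_left)
    also have "\<dots> = (\<Sum>j\<le>k. Polynomial.coeff p j * (- 1) ^ j * h (j + (k - 1 - b)))"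
    proof (rule sum.cong)
      fix j
      have sgn: "(- 1 :: 'a) ^ (k - 1 - b) * (- 1) ^ (j + (k - 1 - b)) = (- 1) ^ j"
        by (simp add: minus_one_power_iff)
      show "(- 1) ^ (k - 1 - b) * (Polynomial.coeff p j * ((- 1) ^ (j + (k - 1 - b)) * h (j + (k - 1 - b))))
          = Polynomial.coeff p j * (- 1) ^ j * h (j + (k - 1 - b))"
        by (simp only: sgn[symmetric] mult_ac)
    qed simp
    also have "\<dots> = (\<Sum>j<k. Polynomial.coeff p j * (- 1) ^ j * h (j + (k - 1 - b)))"
      by (rule sum.mono_neutral_right) (use deg in auto)
    finally show "(?H\<^sup>T *\<^sub>v v) $ b = 0\<^sub>v k $ b"
      using b by (simp add: scalar_prod_def v_def atLeast0LessThan mult_ac)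
  qed (simp add: v_def)
  moreover have "v \<noteq> 0\<^sub>v k"
  proof
    assume "v = 0\<^sub>v k"
    then have "v $ j = 0" if "j < k" for j using that by simp
    then have "Polynomial.coeff p j = 0" for j
      using deg[of j] by (cases "j < k") (auto simp: v_def)
    with \<open>p \<noteq> 0\<close> show False by (simp add: poly_eq_iff)
  qed
  moreover have "v \<in> carrier_vec k" by (simp add: v_def)
  ultimately have "Determinant.det (?H\<^sup>T) = 0"
    by (subst det_0_iff_vec_prod_zero[of _ k]) auto
  then have "Determinant.det ?H = 0" by (subst (asm) Determinant.det_transpose[of _ k]) auto
  with nz corner_hankel[OF k] show False by simp
qed

text \<open>Orthogonality is a linear system with the transposed Hankel matrix, solved by Cramer's
  rule in the form of the adjugate.\<close>

lemma monic_orth_exists: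
  assumes k: "k \<le> Suc n" and nz: "corner k \<noteq> 0"
  shows "\<exists>p. monic_orth k p"
proof -
  let ?H = "mat k k (\<lambda>(a, b). h (a + (k - 1 - b)))"
  let ?A = "?H\<^sup>T"
  have A: "?A \<in> carrier_mat k k" by simp
  have detA: "Determinant.det ?A \<noteq> 0"
    using nz corner_hankel[OF k] Determinant.det_transpose[of ?H k] by simp
  define r where "r = vec k (\<lambda>b. - (h (k + (k - 1 - b))))"
  define w where "w = adj_mat ?A *\<^sub>v r"
  have r: "r \<in> carrier_vec k" by (simp add: r_def)
  have w: "w \<in> carrier_vec k" unfolding w_def using adj_mat(1)[OF A] r by simp
  have "?A *\<^sub>v w = (?A * adj_mat ?A) *\<^sub>v r"
    unfolding w_def by (rule assoc_mult_mat_vec[symmetric]) (use A r adj_mat(1)[OF A] in auto)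
  also have "\<dots> = Determinant.det ?A \<cdot>\<^sub>v r"
    unfolding adj_mat(2)[OF A] using r by auto
  finally have Aw: "?A *\<^sub>v w = Determinant.det ?A \<cdot>\<^sub>v r" .
  define g where "g j = (- 1) ^ (j + k) * (w $ j / Determinant.det ?A)" for j
  define p where "p = Polynomial.monom 1 k + (\<Sum>j<k. Polynomial.monom (g j) j)"
  have cp: "Polynomial.coeff p j = (if j = k then 1 else if j < k then g j else 0)" for j
    by (auto simp: p_def coeff_sum)
  have deg: "Polynomial.degree p = k"
    by (rule antisym, rule degree_le) (auto simp: cp intro!: le_degree)
  have "moment p b = 0" if b: "b < k" for b
  proof -
    define b' where "b' = k - 1 - b"
    have b': "b' < k" "k - 1 - b' = b" using b by (auto simp: b'_def)
    have "(\<Sum>j<k. h (j + b) * w $ j) = (?A *\<^sub>v w) $ b'"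
      using b' w by (simp add: scalar_prod_def atLeast0LessThan)
    also have "\<dots> = - (Determinant.det ?A * h (k + b))"
      using b' r unfolding Aw by (simp add: r_def)
    finally have s: "(\<Sum>j<k. h (j + b) * w $ j) = - (Determinant.det ?A * h (k + b))" .
    have "moment p b = (\<Sum>j<k. g j * ((- 1) ^ (j + b) * h (j + b))) + (- 1) ^ (k + b) * h (k + b)"
      by (simp add: moment_def deg cp flip: lessThan_Suc_atMost)
    also have "(\<Sum>j<k. g j * ((- 1) ^ (j + b) * h (j + b)))
        = (\<Sum>j<k. ((- 1) ^ (k + b) / Determinant.det ?A) * (h (j + b) * w $ j))"
    proof (rule sum.cong)
      fix j
      have sgn: "(- 1 :: 'a) ^ (j + k) * (- 1) ^ (j + b) = (- 1) ^ (k + b)"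
        by (simp add: minus_one_power_iff)
      show "g j * ((- 1) ^ (j + b) * h (j + b)) = ((- 1) ^ (k + b) / Determinant.det ?A) * (h (j + b) * w $ j)"
        by (simp only: g_def sgn[symmetric] divide_inverse mult_ac)
    qed simp
    also have "\<dots> = - ((- 1) ^ (k + b) * h (k + b))"
      using detA unfolding sum_distrib_left[symmetric] s by simp
    finally show ?thesis by simp
  qed
  with deg cp show ?thesis unfolding monic_orth_def by auto
qed

text \<open>Orthogonality read as a row relation: row \<open>k\<close> of the Hankel array is a
  combination of the rows above it. The next two determinant formulas multiply by a matrix
  containing these coefficients.\<close>

lemma monic_orth_row:
  assumes p: "monic_orth k p" and b: "b < k"
  shows "(\<Sum>j<k. (- 1) ^ (j + k + 1) * Polynomial.coeff p j * h (j + b)) = h (k + b)"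
proof -
  have "0 = (- 1) ^ (k + b) * moment p b"
    using p b by (simp add: monic_orth_def)
  also have "moment p b = (\<Sum>j<k. Polynomial.coeff p j * ((- 1) ^ (j + b) * h (j + b))) + (- 1) ^ (k + b) * h (k + b)"
    using p by (simp add: moment_def monic_orth_def flip: lessThan_Suc_atMost)
  finally have row_eq: "0 = (- 1) ^ (k + b) * ((\<Sum>j<k. Polynomial.coeff p j * ((- 1) ^ (j + b) * h (j + b)))
      + (- 1) ^ (k + b) * h (k + b))" .
  have "(- 1) ^ (k + b) * ((- 1) ^ (k + b) * h (k + b)) = h (k + b)"
    by (simp add: minus_one_power_iff)
  note sq = this
  note row_eq
  also have "(- 1) ^ (k + b) * ((\<Sum>j<k. Polynomial.coeff p j * ((- 1) ^ (j + b) * h (j + b)))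
      + (- 1) ^ (k + b) * h (k + b)) = (\<Sum>j<k. (- 1) ^ (k + b) * (Polynomial.coeff p j * ((- 1) ^ (j + b) * h (j + b)))) + h (k + b)"
    by (simp only: distrib_left sum_distrib_left sq)
  also have "(\<Sum>j<k. (- 1) ^ (k + b) * (Polynomial.coeff p j * ((- 1) ^ (j + b) * h (j + b))))
      = (\<Sum>j<k. - ((- 1) ^ (j + k + 1) * Polynomial.coeff p j * h (j + b)))"
  proof (rule sum.cong)
    fix j
    have sgn: "(- 1 :: 'a) ^ (j + k + 1) = - ((- 1) ^ (k + b) * (- 1) ^ (j + b))"
      by (simp add: minus_one_power_iff)
    show "(- 1) ^ (k + b) * (Polynomial.coeff p j * ((- 1) ^ (j + b) * h (j + b)))
        = - ((- 1) ^ (j + k + 1) * Polynomial.coeff p j * h (j + b))"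
      unfolding sgn by (simp add: mult_ac)
  qed simp
  finally show ?thesis by (simp add: sum_negf neg_eq_iff_add_eq_0)
qed

text \<open>\<open>?T\<close> is the identity except for its last row, which replaces row
  \<open>k - 1\<close> of the Hankel matrix by row \<open>k\<close>; its determinant is its last
  diagonal entry. The resulting minor is the numerator of the Peterson image of the
  \<open>k\<close>-th divisor class.\<close>

lemma monic_orth_subleading:
  assumes p: "monic_orth k p" and k: "1 \<le> k" "k \<le> Suc n"
  shows "Polynomial.coeff p (k - 1) * corner k
    = Determinant.det (mat k k (\<lambda>(a, b). h ((if a < k - 1 then a else k) + (k - 1 - b))))"
proof -
  let ?t = "\<lambda>b. (- 1) ^ (b + k + 1) * Polynomial.coeff p b"
  let ?T = "\<lambda>(a, b). if a < k - 1 then (if a = b then 1 else 0) else ?t b"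
  have "Determinant.det (mat k k ?T) = (\<Prod>a<k. ?T (a, a))"
    by (rule det_mat_lower_triangular) auto
  also have "{..<k} = insert (k - 1) {..<k - 1}" using k by auto
  also have "(\<Prod>a\<in>\<dots>. ?T (a, a)) = Polynomial.coeff p (k - 1)"
    using k by (simp add: minus_one_power_iff)
  finally have "Polynomial.coeff p (k - 1) * corner k
      = Determinant.det (mat k k ?T) * Determinant.det (mat k k (\<lambda>(a, b). h (a + (k - 1 - b))))"
    using corner_hankel[OF k(2)] by simp
  also have "\<dots> = Determinant.det (mat k k (\<lambda>(a, b). h ((if a < k - 1 then a else k) + (k - 1 - b))))"
    unfolding det_mat_mult
  proof (rule det_mat_cong)
    fix a b assume ab: "a < k" "b < k"
    show "(\<lambda>(a, b). \<Sum>j<k. ?T (a, j) * (\<lambda>(a, b). h (a + (k - 1 - b))) (j, b)) (a, b)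
        = (\<lambda>(a, b). h ((if a < k - 1 then a else k) + (k - 1 - b))) (a, b)"
    proof (cases "a < k - 1")
      case True
      then have "(\<Sum>j<k. ?T (a, j) * h (j + (k - 1 - b))) = (\<Sum>j<k. if a = j then h (j + (k - 1 - b)) else 0)"
        by (intro sum.cong) auto
      with True ab show ?thesis by simp
    next
      case False
      with monic_orth_row[OF p, of "k - 1 - b"] ab show ?thesis by simp
    qed
  qed
  finally show ?thesis .
qed

text \<open>\<open>?T\<close> is a companion matrix: it shifts every Hankel row by one index, and
  its determinant is the constant coefficient of \<open>p\<close>.\<close>

lemma monic_orth_constant:
  assumes p: "monic_orth k p" and k: "k \<le> n"
  shows "Polynomial.coeff p 0 * corner k = toeplitz_minor c k (n - k)"
proof (cases "k = 0")
  case True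
  with p show ?thesis by (simp add: monic_orth_def)
next
  case False
  then obtain l where l: "k = Suc l" by (cases k) auto
  let ?t = "\<lambda>b. (- 1) ^ (b + k + 1) * Polynomial.coeff p b"
  let ?T = "\<lambda>(a, b). if a < l then (if b = Suc a then 1 else 0) else ?t b"
  have "Determinant.det (mat k k ?T) = ?T (l, 0) * (- 1) ^ (l + 0)
      * Determinant.det (mat l l (\<lambda>(a, b). ?T (if a < l then a else Suc a, if b < 0 then b else Suc b)))"
    unfolding l by (rule det_mat_column_single) auto
  also have "Determinant.det (mat l l (\<lambda>(a, b). ?T (if a < l then a else Suc a, if b < 0 then b else Suc b))) = 1"
    by (subst det_mat_lower_triangular) auto
  finally have "Determinant.det (mat k k ?T) = Polynomial.coeff p 0"
    by (simp add: l minus_one_power_iff)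
  then have "Polynomial.coeff p 0 * corner k
      = Determinant.det (mat k k ?T) * Determinant.det (mat k k (\<lambda>(a, b). h (a + (k - 1 - b))))"
    using corner_hankel[of k] k by simp
  also have "\<dots> = Determinant.det (mat k k (\<lambda>(a, b). h (Suc a + (k - 1 - b))))"
    unfolding det_mat_mult
  proof (rule det_mat_cong)
    fix a b assume ab: "a < k" "b < k"
    show "(\<lambda>(a, b). \<Sum>j<k. ?T (a, j) * (\<lambda>(a, b). h (a + (k - 1 - b))) (j, b)) (a, b)
        = (\<lambda>(a, b). h (Suc a + (k - 1 - b))) (a, b)"
    proof (cases "a < l")
      case True
      then have "(\<Sum>j<k. ?T (a, j) * h (j + (k - 1 - b))) = (\<Sum>j<k. if j = Suc a then h (j + (k - 1 - b)) else 0)"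
        by (intro sum.cong) auto
      with True ab l show ?thesis by simp
    next
      case False
      then have "a = l" using ab l by simp
      with monic_orth_row[OF p, of "k - 1 - b"] ab l show ?thesis by simp
    qed
  qed
  also have "\<dots> = toeplitz_minor c k (n - k)"
    unfolding toeplitz_minor_def
    by (rule det_mat_cong) (use k in \<open>auto simp: h_def intro!: arg_cong[where f = c]\<close>)
  finally show ?thesis .
qed

text \<open>Row operations turn the last row of the next Hankel matrix into moments of
  \<open>p\<close>; orthogonality leaves only the entry in column 0, which accounts for the
  sign.\<close>

lemma monic_orth_moment:
  assumes p: "monic_orth k p" and k: "k \<le> n"
  shows "corner (Suc k) = (- 1) ^ k * moment p k * corner k"
proof -
  let ?T = "\<lambda>(a, b). if a < k then (if a = b then 1 else 0) else (- 1) ^ (b + k) * Polynomial.coeff p b"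
  let ?H = "\<lambda>(a, b). h (a + (Suc k - 1 - b))"
  let ?R = "\<lambda>(a, b). if a < k then h (a + (k - b)) else if b = 0 then moment p k else 0"
  have "Determinant.det (mat (Suc k) (Suc k) ?T) = (\<Prod>a<Suc k. ?T (a, a))"
    by (rule det_mat_lower_triangular) auto
  also have "\<dots> = 1"
    using p by (simp add: monic_orth_def minus_one_power_iff)
  finally have "corner (Suc k) = Determinant.det (mat (Suc k) (Suc k) ?T) * Determinant.det (mat (Suc k) (Suc k) ?H)"
    using corner_hankel[of "Suc k"] k by simp
  also have "\<dots> = Determinant.det (mat (Suc k) (Suc k) ?R)"
    unfolding det_mat_mult
  proof (rule det_mat_cong)
    fix a b assume ab: "a < Suc k" "b < Suc k"
    show "(\<lambda>(a, b). \<Sum>j<Suc k. ?T (a, j) * ?H (j, b)) (a, b) = ?R (a, b)"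
    proof (cases "a < k")
      case True
      then have "(\<Sum>j<Suc k. ?T (a, j) * h (j + (k - b))) = (\<Sum>j<Suc k. if a = j then h (j + (k - b)) else 0)"
        by (intro sum.cong) auto
      with True ab show ?thesis by simp
    next
      case False
      then have a: "a = k" using ab by simp
      have "(\<Sum>j<Suc k. ?T (a, j) * h (j + (k - b))) = (\<Sum>j\<le>k. (- 1) ^ b * (Polynomial.coeff p j * ((- 1) ^ (j + (k - b)) * h (j + (k - b)))))"
      proof (rule sum.cong)
        fix j
        have sgn: "(- 1 :: 'a) ^ b * (- 1) ^ (j + (k - b)) = (- 1) ^ (j + k)"
          using ab by (simp flip: power_add)
        have "(- 1) ^ (j + k) * Polynomial.coeff p j * h (j + (k - b))
            = (- 1) ^ b * (Polynomial.coeff p j * ((- 1) ^ (j + (k - b)) * h (j + (k - b))))"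
          by (simp only: sgn[symmetric] mult_ac)
        then show "?T (a, j) * h (j + (k - b)) = (- 1) ^ b * (Polynomial.coeff p j * ((- 1) ^ (j + (k - b)) * h (j + (k - b))))"
          by (simp add: a)
      qed auto
      also have "\<dots> = (- 1) ^ b * moment p (k - b)"
        using p by (simp add: moment_def monic_orth_def sum_distrib_left)
      also have "\<dots> = ?R (a, b)"
        using p ab by (simp add: a monic_orth_def)
      finally show ?thesis by simp
    qed
  qed
  also have "\<dots> = ?R (k, 0) * (- 1) ^ (k + 0)
      * Determinant.det (mat k k (\<lambda>(a, b). ?R (if a < k then a else Suc a, if b < 0 then b else Suc b)))"
    by (rule det_mat_row_single) auto
  also have "Determinant.det (mat k k (\<lambda>(a, b). ?R (if a < k then a else Suc a, if b < 0 then b else Suc b))) = corner k"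
    using k by (subst corner_hankel) (auto intro!: det_mat_cong)
  finally show ?thesis by (simp add: mult_ac)
qed

text \<open>\<open>h\<close> vanishes beyond \<open>n\<close>, hence so do all moments of t^(n+1).
  This is the source of the relations E_i^{(n+1)} = 0.\<close>

lemma monic_orth_monom: "monic_orth (Suc n) (Polynomial.monom 1 (Suc n))"
  unfolding monic_orth_def
  by (simp add: degree_monom_eq moment_bound[of _ "Suc n"] h_def)

end

locale toeplitz_corner = toeplitz_moments +
  assumes c_0: "c 0 = 1"
    and minor_nonzero: "\<And>k. k \<in> {1..n} \<Longrightarrow> toeplitz_minor c k (n + 1 - k) \<noteq> 0"
begin

lemma corner_Suc_n: "corner (Suc n) = 1"
  by (simp add: corner_def toeplitz_minor_0_right c_0)

lemma corner_nonzero: "k \<le> Suc n \<Longrightarrow> corner k \<noteq> 0"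
  using minor_nonzero[of k] corner_Suc_n
  by (cases "k = 0"; cases "k = Suc n") (auto simp: corner_def)

text \<open>The difference of the two sides has degree at most \<open>k\<close>, by the choice of
  the linear factor, and is orthogonal to 1, ..., t^k. Only the last of these conditions is not
  automatic: it compares two first nonvanishing moments and fixes the factor of
  \<open>p\<close>.\<close>

lemma monic_orth_recurrence:
  assumes p: "monic_orth k p" "monic_orth (Suc k) p'" "monic_orth (Suc (Suc k)) p''" and k: "Suc k \<le> n"
  shows "p'' = [:Polynomial.coeff p'' (Suc k) - Polynomial.coeff p' k, 1:] * p'
      + Polynomial.smult (corner (Suc (Suc k)) * corner k / (corner (Suc k))\<^sup>2) p"
proof -
  define x where "x = Polynomial.coeff p'' (Suc k) - Polynomial.coeff p' k"
  define q where "q = corner (Suc (Suc k)) * corner k / (corner (Suc k))\<^sup>2"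
  have lin: "[:x, 1:] * p' = Polynomial.smult x p' + pCons 0 p'" by simp
  have "[:x, 1:] * p' + Polynomial.smult q p - p'' = 0"
  proof (rule moment_eq_0_imp_eq_0[of "Suc k"])
    fix b assume b: "b < Suc k"
    have "moment p' (Suc k) = (- 1) ^ Suc k * corner (Suc (Suc k)) / corner (Suc k)"
      using monic_orth_moment[OF p(2)] k corner_nonzero[of "Suc k"]
      by (auto simp: minus_one_power_iff field_simps)
    moreover have "moment p k = (- 1) ^ k * corner (Suc k) / corner k"
      using monic_orth_moment[OF p(1)] k corner_nonzero[of k]
      by (auto simp: minus_one_power_iff field_simps)
    ultimately have "moment p' (Suc k) + q * moment p k = 0"
      using corner_nonzero[of "Suc k"] corner_nonzero[of k] k
      by (simp add: q_def field_simps power2_eq_square)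
    then show "moment ([:x, 1:] * p' + Polynomial.smult q p - p'') b = 0"
      using p b by (cases "b = k") (auto simp: lin moment_add moment_diff moment_smult moment_shift monic_orth_def)
  next
    fix j assume j: "j \<ge> Suc k"
    have p0: "Polynomial.coeff p j = 0" using p(1) j by (intro coeff_eq_0) (auto simp: monic_orth_def)
    show "Polynomial.coeff ([:x, 1:] * p' + Polynomial.smult q p - p'') j = 0"
    proof (cases "j = Suc k \<or> j = Suc (Suc k)")
      case True
      have "Polynomial.coeff p' (Suc (Suc k)) = 0"
        using p(2) by (intro coeff_eq_0) (auto simp: monic_orth_def)
      with True p0 p show ?thesis
        by (auto simp: coeff_linear_mult x_def monic_orth_def)
    next
      case False
      with j have "j > Suc (Suc k)" by simp
      then have "Polynomial.coeff p' j = 0" "Polynomial.coeff p' (j - 1) = 0" "Polynomial.coeff p'' j = 0"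
        using p by (auto simp: monic_orth_def intro!: coeff_eq_0)
      with p0 show ?thesis by (cases j) (simp_all add: coeff_linear_mult)
    qed
  qed (use k corner_nonzero in auto)
  then show ?thesis by (simp add: x_def q_def)
qed

text \<open>The Peterson value of x_{k+1} is a difference of divisor values, hence of subleading
  coefficients; so the recurrence of the orthogonal polynomials has exactly the Peterson
  parameters.\<close>

lemma jacobi_poly_monic_orth:
  assumes xq: "\<And>k p p'. \<lbrakk>k \<le> n; monic_orth k p; monic_orth (Suc k) p'\<rbrakk>
        \<Longrightarrow> x (Suc k) = Polynomial.coeff p' k - (if k = 0 then 0 else Polynomial.coeff p (k - 1))"
    and q: "\<And>k. \<lbrakk>1 \<le> k; k \<le> n\<rbrakk> \<Longrightarrow> q k = corner (Suc k) * corner (k - 1) / (corner k)\<^sup>2"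
    and k: "k \<le> Suc n"
  shows "monic_orth k (jacobi_poly x q k)"
  using k
proof (induction k rule: induct_nat_012)
  case 0
  show ?case by (simp add: monic_orth_def)
next
  case 1
  obtain p' where p': "monic_orth (Suc 0) p'" using monic_orth_exists[of "Suc 0"] corner_nonzero[of "Suc 0"] by auto
  have "monic_orth 0 1" by (simp add: monic_orth_def)
  from xq[OF _ this p'] have "x 1 = Polynomial.coeff p' 0" by simp
  moreover have "p' = [:Polynomial.coeff p' 0, 1:]"
    using p' by (intro poly_eqI) (auto simp: monic_orth_def coeff_pCons coeff_eq_0 split: nat.split)
  ultimately show ?case using p' by simp
next
  case (ge2 k)
  obtain p'' where p'': "monic_orth (Suc (Suc k)) p''" using monic_orth_exists[OF ge2.prems] corner_nonzero[OF ge2.prems] by auto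
  note p = ge2.IH(1) and p' = ge2.IH(2)
  have "p'' = jacobi_poly x q (Suc (Suc k))"
    using monic_orth_recurrence[of k "jacobi_poly x q k" "jacobi_poly x q (Suc k)" p'']
      p p' p'' xq[of "Suc k" "jacobi_poly x q (Suc k)" p''] q[of "Suc k"] ge2.prems
    by simp
  with p'' show ?case by simp
qed

lemma monic_orth_unique:
  assumes "monic_orth k p" "monic_orth k p'" "k \<le> Suc n"
  shows "p = p'"
proof -
  have "p - p' = 0"
  proof (rule moment_eq_0_imp_eq_0[OF assms(3) corner_nonzero[OF assms(3)]])
    fix j assume "j \<ge> k"
    then show "Polynomial.coeff (p - p') j = 0"
      using assms by (cases "j = k") (auto simp: monic_orth_def coeff_eq_0)
  qed (use assms in \<open>auto simp: monic_orth_def moment_diff\<close>)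
  then show ?thesis by simp
qed

end

section \<open>Values of the quantum generators\<close>

lemma sorted_list_lessThan: "sorted_list_of_set {..<k::nat} = [0..<k]"
  by (metis lessThan_atLeast0 sorted_list_of_set_range)

lemma sorted_list_gap:
  assumes "1 \<le> k"
  shows "sorted_list_of_set ({..<k - 1} \<union> {k}) = [0..<k - 1] @ [k]"
proof -
  have "{..<k - 1} \<union> {k} = set ([0..<k - 1] @ [k])" by auto
  moreover have "sorted ([0..<k - 1] @ [k])" "distinct ([0..<k - 1] @ [k])"
    by (auto simp: sorted_append)
  ultimately show ?thesis by (metis sorted_list_of_set.idem_if_sorted_distinct)
qed

lemma entries_truncation:
  "\<lbrakk>i < N; j < N\<rbrakk> \<Longrightarrow> entries (truncation N U) i j = U i j"
  by (simp add: entries_def truncation_def)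

lemma Minor_contiguous:
  assumes "m + k \<le> N"
  shows "Minor (entries (truncation N (toeplitz c))) {..<k} {m..<m + k} = toeplitz_minor c k m"
  unfolding Minor_def toeplitz_minor_def
  using assms by (simp add: sorted_list_lessThan)
    (rule det_mat_cong, auto simp: entries_truncation toeplitz_def)

lemma Delta_toeplitz:
  assumes "k \<le> n + 1"
  shows "Delta n k (truncation (n + 1) (toeplitz c)) = toeplitz_minor c k (n + 1 - k)"
  using Minor_contiguous[of "n + 1 - k" k "n + 1" c] assms by (simp add: Delta_def)

lemma (in toeplitz_corner) Minor_gap:
  assumes "k \<in> {1..n}"
  shows "Minor (entries (truncation (n + 1) (toeplitz c))) ({..<k - 1} \<union> {k}) {n + 1 - k..<n + 1}
    = Determinant.det (mat k k (\<lambda>(a, b). h ((if a < k - 1 then a else k) + (k - 1 - b))))"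
proof -
  have "card ({..<k - 1} \<union> {k}) = k" "card {n + 1 - k..<n + 1} = k"
    using assms by auto
  moreover have "([0..<k - 1] @ [k]) ! a = (if a < k - 1 then a else k)" if "a < k" for a
    using that by (auto simp: nth_append)
  moreover have "sorted_list_of_set {n + 1 - k..<n + 1} ! b = n + 1 - k + b" if "b < k" for b
    using that assms by (simp del: upt_Suc)
  ultimately show ?thesis
    unfolding Minor_def using sorted_list_gap[of k] assms
    by (simp del: sorted_list_of_set_range upt_Suc)
       (rule det_mat_cong, auto simp: entries_truncation toeplitz_def h_def intro!: arg_cong[where f = c])
qed

lemma UToepE:
  assumes "u \<in> UToep N"
  obtains c where "c 0 = 1" "u = truncation N (toeplitz c)"
  using assms by (auto simp: UToep_def)

lemma UToep_open_corner:
  fixes c :: "nat \<Rightarrow> complex"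
  assumes "truncation (n + 1) (toeplitz c) \<in> UToep_open n" "c 0 = 1"
  shows "toeplitz_corner c n"
proof
  fix k assume k: "k \<in> {1..n}"
  then have "Delta n k (truncation (n + 1) (toeplitz c)) \<noteq> 0"
    using assms by (auto simp: UToep_open_def)
  with k show "toeplitz_minor c k (n + 1 - k) \<noteq> 0"
    using Delta_toeplitz[of k n c] by simp
qed (fact assms)

context
  fixes c :: "nat \<Rightarrow> complex" and n :: nat and u :: "complex mat"
  assumes corner: "toeplitz_corner c n" and u: "u = truncation (n + 1) (toeplitz c)"
begin

interpretation toeplitz_corner c n by (rule corner)

lemma Delta_corner: "k \<le> n + 1 \<Longrightarrow> Delta n k u = corner k"
  unfolding u corner_def by (rule Delta_toeplitz)

lemma divisor_image_monic_orth:
  assumes p: "monic_orth k p" and k: "1 \<le> k" "k \<le> Suc n"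
  shows "divisor_image n u k = Polynomial.coeff p (k - 1)"
proof (cases "k = Suc n")
  \<comment> \<open>Here the orthogonal polynomial is t^(n+1), whose subleading coefficient agrees
    with the default 0 of \<open>divisor_image\<close> at \<open>n + 1\<close>.\<close>
  case True
  with monic_orth_unique[OF p, of "Polynomial.monom 1 (Suc n)"] monic_orth_monom
  show ?thesis by (simp add: divisor_image_def)
next
  case False
  with k have "k \<in> {1..n}" by simp
  then show ?thesis
    using monic_orth_subleading[OF p k] corner_nonzero[OF k(2)] Minor_gap Delta_corner[of k]
    by (simp add: divisor_image_def u field_simps)
qed

lemma jacobi_poly_gen_image:
  assumes "k \<le> Suc n"
  shows "monic_orth k (jacobi_poly (\<lambda>j. gen_image n u (X j)) (\<lambda>j. gen_image n u (Q j)) k)"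
proof (rule jacobi_poly_monic_orth[OF _ _ assms])
  fix k p p' assume k: "k \<le> n" and p: "monic_orth k p" "monic_orth (Suc k) p'"
  show "gen_image n u (X (Suc k)) = Polynomial.coeff p' k - (if k = 0 then 0 else Polynomial.coeff p (k - 1))"
    using divisor_image_monic_orth[OF p(2)] divisor_image_monic_orth[OF p(1)] k
    by (cases "k = 0") (auto simp: divisor_image_def[of n u 0])
next
  fix k assume "1 \<le> k" "k \<le> n"
  then show "gen_image n u (Q k) = corner (Suc k) * corner (k - 1) / (corner k)\<^sup>2"
    by (simp add: Delta_corner)
qed

lemma jacobi_poly_gen_image_top:
  "jacobi_poly (\<lambda>j. gen_image n u (X j)) (\<lambda>j. gen_image n u (Q j)) (Suc n) = Polynomial.monom 1 (Suc n)"
  by (rule monic_orth_unique[OF jacobi_poly_gen_image monic_orth_monom]) auto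

lemma jacobi_poly_gen_image_0:
  assumes "k \<le> n"
  shows "Polynomial.coeff (jacobi_poly (\<lambda>j. gen_image n u (X j)) (\<lambda>j. gen_image n u (Q j)) k) 0
    = toeplitz_minor c k (n - k) / toeplitz_minor c k (n + 1 - k)"
  using monic_orth_constant[OF jacobi_poly_gen_image assms] corner_nonzero[of k] assms
  by (simp add: corner_def field_simps)

lemma gen_image_qesym_top:
  "i \<in> {1..n + 1} \<Longrightarrow> cpoly_eval (gen_image n u) (qesym i (n + 1)) = 0"
  using cpoly_eval_qesym[of "gen_image n u" i "Suc n"] jacobi_poly_gen_image_top by auto

lemma gen_image_QInv:
  assumes "k \<in> {1..n}"
  shows "cpoly_eval (gen_image n u) (cvar (Q k) * cvar (QInv k) - 1) = 0"
  using assms corner_nonzero[of k] corner_nonzero[of "k - 1"] corner_nonzero[of "Suc k"]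
  by (auto simp: Delta_corner)

end

section \<open>Evaluation at the Peterson generators descends to the localised ring\<close>

lemma cvars_add: "cvars (p + q) \<subseteq> cvars p \<union> cvars q"
  using keys_add[of p q] by (auto simp: cvars_def)

lemma cvars_mult: "cvars (p * q) \<subseteq> cvars p \<union> cvars q"
proof
  fix v assume "v \<in> cvars (p * q)"
  then obtain m where m: "m \<in> Poly_Mapping.keys (p * q)" "v \<in> Poly_Mapping.keys m"
    by (auto simp: cvars_def)
  then obtain a b where ab: "m = a + b" "a \<in> Poly_Mapping.keys p" "b \<in> Poly_Mapping.keys q"
    using keys_mult[of p q] by blast
  with m keys_add[of a b] have "v \<in> Poly_Mapping.keys a \<union> Poly_Mapping.keys b" by auto
  with ab show "v \<in> cvars p \<union> cvars q" by (auto simp: cvars_def)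
qed

lemma cvars_uminus: "cvars (- p) = cvars p"
  by (simp add: cvars_def in_keys_iff set_eq_iff)

lemma cvars_0_1 [simp]: "cvars 0 = {}" "cvars 1 = {}"
  by (auto simp: cvars_def)

lemma ring_qpoly_ring: "ring (qpoly_ring n)"
proof (rule ringI)
  show "abelian_group (qpoly_ring n)"
  proof (rule abelian_groupI)
    fix p assume "p \<in> carrier (qpoly_ring n)"
    then show "\<exists>q\<in>carrier (qpoly_ring n). q \<oplus>\<^bsub>qpoly_ring n\<^esub> p = \<zero>\<^bsub>qpoly_ring n\<^esub>"
      by (intro bexI[of _ "- p"]) (auto simp: qpoly_ring_def cvars_uminus)
  qed (auto simp: qpoly_ring_def add_ac dest!: subsetD[OF cvars_add])
  show "monoid (qpoly_ring n)"
    by (rule monoidI) (auto simp: qpoly_ring_def mult_ac dest!: subsetD[OF cvars_mult])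
qed (auto simp: qpoly_ring_def algebra_simps)

text \<open>Being an ideal that contains the defining relations, it contains
  \<open>qH_ideal\<close>. So evaluation is constant on cosets, as \<open>the_elem\<close> in
  \<open>peterson\<close> demands.\<close>

definition peterson_kernel :: "nat \<Rightarrow> qvar cpoly set" where
  "peterson_kernel n = {p \<in> carrier (qpoly_ring n). \<forall>u\<in>UToep_open n. cpoly_eval (gen_image n u) p = 0}"

lemma ideal_peterson_kernel: "ideal (peterson_kernel n) (qpoly_ring n)"
proof (rule idealI[OF ring_qpoly_ring])
  interpret ring "qpoly_ring n" by (rule ring_qpoly_ring)
  have inv: "\<ominus>\<^bsub>qpoly_ring n\<^esub> p = - p" if "p \<in> carrier (qpoly_ring n)" for p
    using that by (intro minus_equality) (auto simp: qpoly_ring_def cvars_uminus)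
  show "subgroup (peterson_kernel n) (add_monoid (qpoly_ring n))"
  proof (rule add.subgroupI)
    show "peterson_kernel n \<subseteq> carrier (qpoly_ring n)" by (auto simp: peterson_kernel_def)
    show "peterson_kernel n \<noteq> {}"
      unfolding peterson_kernel_def by (auto intro!: exI[of _ 0] simp: qpoly_ring_def)
    fix p assume p: "p \<in> peterson_kernel n"
    then show "\<ominus>\<^bsub>qpoly_ring n\<^esub> p \<in> peterson_kernel n"
      using inv[of p] by (auto simp: peterson_kernel_def qpoly_ring_def cvars_uminus)
    fix q assume "q \<in> peterson_kernel n"
    with p show "p \<oplus>\<^bsub>qpoly_ring n\<^esub> q \<in> peterson_kernel n"
      using cvars_add[of p q] by (auto simp: peterson_kernel_def qpoly_ring_def)
  qed
  fix p q assume pq: "p \<in> peterson_kernel n" "q \<in> carrier (qpoly_ring n)"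
  then show "q \<otimes>\<^bsub>qpoly_ring n\<^esub> p \<in> peterson_kernel n"
    using cvars_mult[of q p] by (auto simp: peterson_kernel_def qpoly_ring_def)
  from pq show "p \<otimes>\<^bsub>qpoly_ring n\<^esub> q \<in> peterson_kernel n"
    using cvars_mult[of p q] by (auto simp: peterson_kernel_def qpoly_ring_def)
qed

lemma cvars_cvar: "cvars (cvar v) = {v}"
  by (simp add: cvars_def cvar_def)

lemma cvars_qesym: "cvars (qesym i k) \<subseteq> X ` {1..k} \<union> Q ` {1..<k}"
proof (induction k arbitrary: i rule: induct_nat_012)
  case 0
  show ?case by (simp add: qesym_0_right)
next
  case 1
  show ?case by (simp add: qesym_1_right cvars_cvar)
next
  case (ge2 k)
  have a: "cvars (p + q) \<subseteq> A" if "cvars p \<subseteq> A" "cvars q \<subseteq> A" for p q :: "qvar cpoly" and A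
    using that cvars_add[of p q] by blast
  have m: "cvars (p * q) \<subseteq> A" if "cvars p \<subseteq> A" "cvars q \<subseteq> A" for p q :: "qvar cpoly" and A
    using that cvars_mult[of p q] by blast
  let ?A = "X ` {1..Suc (Suc k)} \<union> Q ` {1..<Suc (Suc k)}"
  have sub: "cvars (qesym j (Suc k)) \<subseteq> ?A" "cvars (qesym j k) \<subseteq> ?A" for j
    by (rule order_trans[OF ge2.IH(2)], force, rule order_trans[OF ge2.IH(1)], force)
  have gen: "cvars (cvar (X (Suc (Suc k)))) \<subseteq> ?A" "cvars (cvar (Q (Suc k))) \<subseteq> ?A"
    by (auto simp: cvars_cvar)
  show ?case
    unfolding qesym_Suc_Suc_right
    using m[OF gen(1) sub(1)] m[OF gen(2) sub(2)] sub(1) by (intro a) simp_all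
qed

lemma qH_ideal_subset_kernel: "qH_ideal n \<subseteq> peterson_kernel n"
proof -
  have "(\<lambda>i. qesym i (n + 1)) ` {1..n + 1} \<union> (\<lambda>k. cvar (Q k) * cvar (QInv k) - 1) ` {1..n}
      \<subseteq> peterson_kernel n" (is "?S \<subseteq> _")
  proof
    fix p assume "p \<in> ?S"
    then consider i where "i \<in> {1..n + 1}" "p = qesym i (n + 1)"
      | k where "k \<in> {1..n}" "p = cvar (Q k) * cvar (QInv k) - 1" by blast
    note p = this
    have "cpoly_eval (gen_image n u) p = 0" if u: "u \<in> UToep_open n" for u
    proof -
      obtain c where c: "c 0 = 1" "u = truncation (n + 1) (toeplitz c)"
        using u by (auto simp: UToep_open_def elim: UToepE)
      with u have "toeplitz_corner c n" by (intro UToep_open_corner) auto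
      from p show ?thesis
        by cases (simp_all only: gen_image_qesym_top[OF \<open>toeplitz_corner c n\<close> c(2)]
          gen_image_QInv[OF \<open>toeplitz_corner c n\<close> c(2)])
    qed
    moreover have "p \<in> carrier (qpoly_ring n)"
    proof -
      have 1: "cvars (cvar (Q k) * cvar (QInv k) - 1) \<subseteq> {Q k, QInv k}" for k
        using cvars_add[of "cvar (Q k) * cvar (QInv k)" "- 1"] cvars_mult[of "cvar (Q k)" "cvar (QInv k)"]
        by (simp add: cvars_cvar cvars_uminus) blast
      have 2: "cvars (qesym i (n + 1)) \<subseteq> X ` {1..n + 1} \<union> Q ` {1..n}" for i
        using cvars_qesym[of i "n + 1"] by (simp add: atLeastLessThanSuc_atLeastAtMost)
      from p have "cvars p \<subseteq> X ` {1..n + 1} \<union> Q ` {1..n} \<union> QInv ` {1..n}"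
      proof cases
        case (1 i)
        with 2[of i] show ?thesis by blast
      next
        case (2 k)
        then have "cvars p \<subseteq> {Q k, QInv k}" using 1[of k] by simp
        with 2(1) show ?thesis by blast
      qed
      then show ?thesis by (simp add: qpoly_ring_def)
    qed
    ultimately show "p \<in> peterson_kernel n" by (simp add: peterson_kernel_def)
  qed
  then show ?thesis
    unfolding qH_ideal_def genideal_def using ideal_peterson_kernel by blast
qed

lemma zero_in_qH_ideal: "0 \<in> qH_ideal n"
  unfolding qH_ideal_def genideal_def
proof safe
  fix I assume "ideal I (qpoly_ring n)"
  then have "\<zero>\<^bsub>qpoly_ring n\<^esub> \<in> I"
    by (simp add: additive_subgroup.zero_closed ideal.axioms(1))
  then show "0 \<in> I" by (simp add: qpoly_ring_def)
qed

lemma schubert_fun_eq: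
  assumes "u \<in> UToep_open n"
  shows "schubert_fun n w u = cpoly_eval (gen_image n u) (quantum_schubert w)"
proof -
  have eq: "peterson_lift n (h + quantum_schubert w) = peterson_lift n (quantum_schubert w)"
    if "h \<in> qH_ideal n" for h
    unfolding peterson_lift_def
    by (rule restrict_ext) (use that qH_ideal_subset_kernel[of n] in \<open>auto simp: peterson_kernel_def\<close>)
  have "schubert_class n w = (\<lambda>h. h + quantum_schubert w) ` qH_ideal n"
    by (auto simp: schubert_class_def a_r_coset_def' qpoly_ring_def)
  then have "peterson_lift n ` schubert_class n w = {peterson_lift n (quantum_schubert w)}"
    using eq zero_in_qH_ideal[of n] by (auto simp: image_iff intro!: bexI[of _ 0])
  then show ?thesis
    using assms by (simp add: schubert_fun_def peterson_def peterson_lift_def)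
qed

section \<open>Duality under conjugation by the longest element\<close>

definition upoly :: "complex poly \<Rightarrow> 'v cpoly \<Rightarrow> 'v cpoly" where
  "upoly p v = (\<Sum>i\<le>Polynomial.degree p. cconst (Polynomial.coeff p i) * v ^ i)"

lemma cpoly_eval_upoly [simp]: "cpoly_eval f (upoly p v) = poly p (cpoly_eval f v)"
  by (simp add: upoly_def poly_altdef)

lemma e_kernel_upoly:
  assumes "\<And>k i. i \<le> k \<Longrightarrow> E k i = Polynomial.coeff (jacobi_poly x q k) (k - i)"
  shows "e_kernel N E = (\<Prod>j\<in>{1..N}. upoly (jacobi_poly x q (N - j)) (cvar j))"
proof (rule cpoly_eqI)
  fix f
  have "cpoly_eval f (e_kernel N E) = (\<Prod>k\<in>{1..<N}. poly (jacobi_poly x q k) (f (N - k)))"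
    by (simp add: e_kernel_def assms poly_jacobi_poly_homogeneous)
  also have "\<dots> = (\<Prod>k\<in>{0..<N}. poly (jacobi_poly x q k) (f (N - k)))"
    by (rule prod.mono_neutral_left) (auto simp: not_less_eq_eq)
  also have "\<dots> = (\<Prod>j\<in>{1..N}. poly (jacobi_poly x q (N - j)) (f j))"
    by (rule prod.reindex_bij_witness[of _ "\<lambda>j. N - j" "\<lambda>k. N - k"]) auto
  finally show "cpoly_eval f (e_kernel N E) = cpoly_eval f (\<Prod>j\<in>{1..N}. upoly (jacobi_poly x q (N - j)) (cvar j))"
    by simp
qed

lemma dd_word_add: "dd_word js (p + q) = dd_word js p + dd_word js q"
  using clinear_form_dd_word by (simp add: clinear_form_def)

lemma dd_word_cconst_mult: "dd_word js (cconst a * p) = a * dd_word js p"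
  using clinear_form_dd_word by (simp add: clinear_form_def)

text \<open>Makes congruences of the univariate factors modulo t^N sufficient:
  \<open>dd_word_cvar_power\<close> removes the error terms one variable at a time.\<close>

lemma dd_word_prod_mod_powers:
  assumes js: "set js \<subseteq> {1..<N}" and "finite S" "S \<subseteq> {1..N}"
  shows "dd_word js ((\<Prod>j\<in>S. A j + cvar j ^ N * B j) * p) = dd_word js ((\<Prod>j\<in>S. A j) * p)"
  using assms(2,3)
proof (induction S arbitrary: p rule: finite_induct)
  case (insert j S)
  let ?P = "\<Prod>j\<in>S. A j + cvar j ^ N * B j"
  have "dd_word js ((\<Prod>j\<in>insert j S. A j + cvar j ^ N * B j) * p)
      = dd_word js (?P * (A j * p) + cvar j ^ N * (B j * ?P * p))"
    using insert.hyps by (simp add: algebra_simps)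
  also have "\<dots> = dd_word js (?P * (A j * p))"
    using insert.prems by (simp add: dd_word_add dd_word_cvar_power[OF js])
  also have "\<dots> = dd_word js ((\<Prod>j\<in>S. A j) * (A j * p))"
    by (rule insert.IH) (use insert.prems in auto)
  also have "(\<Prod>j\<in>S. A j) * (A j * p) = (\<Prod>j\<in>insert j S. A j) * p"
    using insert.hyps by (simp add: mult_ac)
  finally show ?case .
qed simp

lemma prod_quotient_telescope:
  fixes f :: "nat \<Rightarrow> 'a::field"
  assumes "\<And>i. i \<le> N \<Longrightarrow> f i \<noteq> 0"
  shows "(\<Prod>i<N. f i / f (Suc i)) = f 0 / f N"
  using assms by (induction N) auto

text \<open>\<open>kap k\<close> is the product of q_n, ..., q_{n+1-k}. The polynomials
  \<open>G'\<close> run the recurrence from the far end, with the signs of the x reversed.\<close>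

context
  fixes x q kap :: "nat \<Rightarrow> complex" and n :: nat
  assumes top: "jacobi_poly x q (Suc n) = Polynomial.monom 1 (Suc n)"
    and kap_0: "kap 0 = 1"
    and kap_Suc: "\<And>k. Suc k \<le> n \<Longrightarrow> kap (Suc k) = kap k * q (n - k)"
begin

private abbreviation "G \<equiv> jacobi_poly x q"
private abbreviation "G' \<equiv> jacobi_poly (\<lambda>k. - x (n + 2 - k)) (\<lambda>k. q (n + 1 - k))"

text \<open>Both sides satisfy the same three-term recurrence modulo \<open>t^(n+1)\<close>, since
  \<open>G (n + 1)\<close> is the monomial \<open>t^(n+1)\<close>.\<close>

lemma jacobi_dual_congruence:
  assumes "k \<le> n"
  shows "\<exists>H. \<forall>t. poly (G' k) t * poly (G n) (- t) = kap k * poly (G (n - k)) (- t) + t ^ Suc n * poly H t"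
  using assms
proof (induction k rule: induct_nat_012)
  case 0
  show ?case by (intro exI[of _ 0]) (simp add: kap_0)
next
  case 1
  then obtain m where m: "n = Suc m" by (cases n) auto
  have top': "poly (G (Suc n)) (- t) = (- t) ^ Suc n" for t
    unfolding top by (simp add: poly_monom)
  have k1: "kap 1 = q n"
    using kap_Suc[of 0] 1 by (simp add: kap_0)
  show ?case
  proof (intro exI allI)
    fix t
    have "poly (G (Suc n)) (- t) = (x (Suc n) - t) * poly (G n) (- t) + q n * poly (G m) (- t)"
      by (simp only: m jacobi_poly.simps) (simp add: algebra_simps)
    then have "(t - x (Suc n)) * poly (G n) (- t) = q n * poly (G m) (- t) - (- t) ^ Suc n"
      unfolding top' by (simp add: algebra_simps)
    also have "(- t) ^ Suc n = t ^ Suc n * (- 1) ^ Suc n"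
      by (simp add: power_minus[of t])
    finally show "poly (G' (Suc 0)) t * poly (G n) (- t)
        = kap (Suc 0) * poly (G (n - Suc 0)) (- t) + t ^ Suc n * poly [:- ((- 1) ^ Suc n):] t"
      using k1 by (simp add: m algebra_simps)
  qed
next
  case (ge2 k)
  obtain H0 where H0: "poly (G' k) t * poly (G n) (- t)
      = kap k * poly (G (n - k)) (- t) + t ^ Suc n * poly H0 t" for t
    using ge2 by auto
  obtain H1 where H1: "poly (G' (Suc k)) t * poly (G n) (- t)
      = kap (Suc k) * poly (G (n - Suc k)) (- t) + t ^ Suc n * poly H1 t" for t
    using ge2 by auto
  obtain m where m: "n = Suc (Suc (m + k))" using ge2.prems by (metis add.commute add_Suc_right le_Suc_ex)
  have xk: "n + 2 - Suc (Suc k) = n - k" and qk: "n + 1 - Suc k = n - k" by auto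
  have nk: "n - k = Suc (Suc m)" "n - Suc k = Suc m" "n - Suc (Suc k) = m" using m by auto
  have kap: "kap (Suc k) = kap k * q (Suc (Suc m))" "kap (Suc (Suc k)) = kap (Suc k) * q (Suc m)"
    using kap_Suc[of k] kap_Suc[of "Suc k"] ge2.prems nk by auto
  show ?case
  proof (intro exI allI)
    fix t
    have r: "poly (G (Suc (Suc m))) (- t) = (x (Suc (Suc m)) - t) * poly (G (Suc m)) (- t) + q (Suc m) * poly (G m) (- t)"
      by (simp only: jacobi_poly.simps) (simp add: algebra_simps)
    have "poly (G' (Suc (Suc k))) t * poly (G n) (- t)
        = (t - x (Suc (Suc m))) * (poly (G' (Suc k)) t * poly (G n) (- t))
          + q (Suc (Suc m)) * (poly (G' k) t * poly (G n) (- t))"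
      by (simp only: jacobi_poly.simps xk qk nk) (simp add: algebra_simps)
    also have "\<dots> = kap (Suc k) * ((t - x (Suc (Suc m))) * poly (G (Suc m)) (- t) + poly (G (Suc (Suc m))) (- t))
        + t ^ Suc n * ((t - x (Suc (Suc m))) * poly H1 t + q (Suc (Suc m)) * poly H0 t)"
      unfolding H0 H1 nk kap(1) by (simp only: ring_distribs mult_ac add_ac)
    also have "(t - x (Suc (Suc m))) * poly (G (Suc m)) (- t) + poly (G (Suc (Suc m))) (- t) = q (Suc m) * poly (G m) (- t)"
      unfolding r by (simp only: ring_distribs) simp
    also have "kap (Suc k) * (q (Suc m) * poly (G m) (- t)) = kap (Suc (Suc k)) * poly (G m) (- t)"
      unfolding kap(2) by (simp only: mult_ac)
    finally show "poly (G' (Suc (Suc k))) t * poly (G n) (- t)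
        = kap (Suc (Suc k)) * poly (G (n - Suc (Suc k))) (- t)
          + t ^ Suc n * poly ([:- x (Suc (Suc m)), 1:] * H1 + Polynomial.smult (q (Suc (Suc m))) H0) t"
      unfolding nk by (simp add: algebra_simps)
  qed
qed

text \<open>The kernel of \<open>E'\<close> is multiplied by the symmetric polynomial
  \<open>s\<close>, which leaves the functional as the constant G_n(0)^(n+1). By the congruence the
  product becomes, modulo (n+1)-st powers, the reflected kernel \<open>g\<close> of \<open>E\<close>
  times all the \<open>kap\<close>; \<open>prod_kap\<close> says that this is the same constant, and
  it cancels.\<close>

lemma dd_word_dual:
  assumes js: "set js \<subseteq> {1..<n + 1}"
    and E: "\<And>k i. i \<le> k \<Longrightarrow> E k i = Polynomial.coeff (G k) (k - i)"
    and E': "\<And>k i. i \<le> k \<Longrightarrow> E' k i = Polynomial.coeff (G' k) (k - i)"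
    and nz: "poly (G n) 0 \<noteq> 0"
    and prod_kap: "(\<Prod>j\<in>{1..Suc n}. kap (Suc n - j)) = poly (G n) 0 ^ Suc n"
  shows "dd_word (map (\<lambda>j. n + 1 - j) js) (e_kernel (n + 1) E) = dd_word js (e_kernel (n + 1) E')"
proof -
  let ?N = "n + 1"
  define g where "g = (\<Prod>j\<in>{1..?N}. upoly (G (j - 1)) (- cvar j))"
  define s where "s = (\<Prod>j\<in>{1..?N}. upoly (G n) (- cvar j))"
  have "dd_word js g = dd_word (map (\<lambda>j. ?N - j) js) (e_kernel ?N E)"
  proof (rule dd_word_reflect[OF js])
    fix f
    have "cpoly_eval (reflect ?N f) (e_kernel ?N E) = (\<Prod>j\<in>{1..?N}. poly (G (?N - j)) (- f (?N + 1 - j)))"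
      by (simp add: e_kernel_upoly[OF E] reflect_def)
    also have "\<dots> = cpoly_eval f g"
      unfolding g_def cpoly_eval_prod
      by (rule prod.reindex_bij_witness[of _ "\<lambda>j. ?N + 1 - j" "\<lambda>j. ?N + 1 - j"]) auto
    finally show "cpoly_eval f g = cpoly_eval (reflect ?N f) (e_kernel ?N E)" by simp
  qed
  moreover have "poly (G n) 0 ^ ?N * dd_word js (e_kernel ?N E') = poly (G n) 0 ^ ?N * dd_word js g"
  proof -
    have sym: "swap_vars j s = s" if "j \<in> set js" for j
    proof (rule cpoly_eqI)
      fix f
      have "j \<in> {1..<?N}" using that js by blast
      then show "cpoly_eval f (swap_vars j s) = cpoly_eval f s"
        unfolding s_def
        by (simp del: prod.cl_ivl_Suc)
           (rule prod.reindex_bij_witness[of _ "adj_transp j" "adj_transp j"],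
             auto simp: Transposition.transpose_def)
    qed
    have "\<forall>k\<in>{0..n}. \<exists>H. \<forall>t. poly (G' k) t * poly (G n) (- t)
        = kap k * poly (G (n - k)) (- t) + t ^ Suc n * poly H t"
      using jacobi_dual_congruence by auto
    from bchoice[OF this] obtain H where "\<forall>k\<in>{0..n}. \<forall>t. poly (G' k) t * poly (G n) (- t)
        = kap k * poly (G (n - k)) (- t) + t ^ Suc n * poly (H k) t" by blast
    then have H: "poly (G' k) t * poly (G n) (- t)
        = kap k * poly (G (n - k)) (- t) + t ^ Suc n * poly (H k) t" if "k \<le> n" for k t
      using that by (simp del: power_Suc)
    have "s * e_kernel ?N E' = (\<Prod>j\<in>{1..?N}. cconst (kap (?N - j)) * upoly (G (j - 1)) (- cvar j)
        + cvar j ^ ?N * upoly (H (?N - j)) (cvar j))"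
    proof (rule cpoly_eqI)
      fix f
      have "cpoly_eval f (s * e_kernel ?N E') = (\<Prod>j\<in>{1..?N}. poly (G n) (- f j) * poly (G' (?N - j)) (f j))"
        by (simp add: s_def e_kernel_upoly[OF E'] prod.distrib del: prod.cl_ivl_Suc)
      also have "\<dots> = (\<Prod>j\<in>{1..?N}. kap (?N - j) * poly (G (j - 1)) (- f j) + f j ^ ?N * poly (H (?N - j)) (f j))"
      proof (rule prod.cong)
        fix j assume "j \<in> {1..?N}"
        then have "?N - j \<le> n" "n - (?N - j) = j - 1" by auto
        with H[of "?N - j" "f j"] show "poly (G n) (- f j) * poly (G' (?N - j)) (f j)
            = kap (?N - j) * poly (G (j - 1)) (- f j) + f j ^ ?N * poly (H (?N - j)) (f j)"
          by (simp add: mult.commute)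
      qed simp
      finally show "cpoly_eval f (s * e_kernel ?N E')
          = cpoly_eval f (\<Prod>j\<in>{1..?N}. cconst (kap (?N - j)) * upoly (G (j - 1)) (- cvar j)
            + cvar j ^ ?N * upoly (H (?N - j)) (cvar j))"
        by (simp del: prod.cl_ivl_Suc)
    qed
    then have "dd_word js (s * e_kernel ?N E')
        = dd_word js (\<Prod>j\<in>{1..?N}. cconst (kap (?N - j)) * upoly (G (j - 1)) (- cvar j))"
      using dd_word_prod_mod_powers[OF js, of "{1..?N}" "\<lambda>j. cconst (kap (?N - j)) * upoly (G (j - 1)) (- cvar j)"
          "\<lambda>j. upoly (H (?N - j)) (cvar j)" 1] by simp
    also have "(\<Prod>j\<in>{1..?N}. cconst (kap (?N - j)) * upoly (G (j - 1)) (- cvar j))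
        = cconst (poly (G n) 0 ^ ?N) * g"
      using prod_kap by (simp add: prod.distrib g_def del: prod.cl_ivl_Suc flip: cconst_prod)
    also have "dd_word js (s * e_kernel ?N E') = poly (G n) 0 ^ ?N * dd_word js (e_kernel ?N E')"
    proof -
      have "cpoly_eval (\<lambda>_. 0) s = poly (G n) 0 ^ ?N"
        by (simp add: s_def del: prod.cl_ivl_Suc)
      then show ?thesis by (simp add: dd_word_mult_sym[OF sym])
    qed
    finally show ?thesis by (simp add: dd_word_cconst_mult)
  qed
  ultimately show ?thesis
    using nz by simp
qed

end

context
  fixes c :: "nat \<Rightarrow> complex" and n :: nat and u :: "complex mat"
  assumes corner: "toeplitz_corner c n" and u: "u = truncation (n + 1) (toeplitz c)"
begin

interpretation toeplitz_corner c n by (rule corner)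

text \<open>Closed form of \<open>kap\<close>: writing D_k for the corner minors, q_k = D_{k+1}
  D_{k-1} / D_k^2 makes the product of q_n, ..., q_{n+1-k} telescope to D_{n-k} / (D_{n+1-k}
  D_n).\<close>

lemma corner_scaling_Suc:
  assumes "Suc k \<le> n"
  shows "corner (n - Suc k) / (corner (Suc n - Suc k) * corner n)
    = corner (n - k) / (corner (Suc n - k) * corner n) * gen_image n u (Q (n - k))"
proof -
  define m where "m = n - Suc k"
  have m: "n - k = Suc m" "n - Suc k = m" "Suc n - k = Suc (Suc m)" "Suc n - Suc k = Suc m" "Suc (Suc m) \<le> Suc n"
    using assms by (unfold m_def) linarith+
  show ?thesis
    unfolding m gen_image.simps using m(5) corner_nonzero[of "Suc m"] corner_nonzero[of "Suc (Suc m)"] corner_nonzero[of n]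
    by (simp add: Delta_corner[OF corner u] field_simps power2_eq_square)
qed

lemma dd_word_peterson_dual:
  assumes js: "set js \<subseteq> {1..<n + 1}"
    and E: "\<And>k i. i \<le> k \<Longrightarrow> E k i
      = Polynomial.coeff (jacobi_poly (\<lambda>k. gen_image n u (X k)) (\<lambda>k. gen_image n u (Q k)) k) (k - i)"
    and E': "\<And>k i. i \<le> k \<Longrightarrow> E' k i
      = Polynomial.coeff (jacobi_poly (\<lambda>k. - gen_image n u (X (n + 2 - k)))
          (\<lambda>k. gen_image n u (Q (n + 1 - k))) k) (k - i)"
  shows "dd_word (map (\<lambda>j. n + 1 - j) js) (e_kernel (n + 1) E) = dd_word js (e_kernel (n + 1) E')"
proof (rule dd_word_dual[OF jacobi_poly_gen_image_top[OF corner u] _ _ js E E'])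
  let ?kap = "\<lambda>k. corner (n - k) / (corner (Suc n - k) * corner n)"
  show "?kap 0 = 1" using corner_nonzero[of n] corner_Suc_n by simp
  show "?kap (Suc k) = ?kap k * gen_image n u (Q (n - k))" if "Suc k \<le> n" for k
    by (rule corner_scaling_Suc[OF that])
  have at_0: "poly (jacobi_poly (\<lambda>k. gen_image n u (X k)) (\<lambda>k. gen_image n u (Q k)) n) 0 = 1 / corner n"
    using jacobi_poly_gen_image_0[OF corner u, of n] c_0
    by (simp add: poly_0_coeff_0 toeplitz_minor_0_right corner_def)
  with corner_nonzero[of n]
  show "poly (jacobi_poly (\<lambda>k. gen_image n u (X k)) (\<lambda>k. gen_image n u (Q k)) n) 0 \<noteq> 0" by simp
  \<comment> \<open>The factors D_{j-1} / D_j telescope to 1, leaving a power of 1 / D_n, which is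
    G_n(0).\<close>
  have "(\<Prod>j\<in>{1..Suc n}. ?kap (Suc n - j)) = (\<Prod>j<Suc n. corner j / corner (Suc j) * (1 / corner n))"
    by (rule prod.reindex_bij_witness[of _ Suc "\<lambda>j. j - 1"]) (auto simp: Suc_diff_le)
  also have "\<dots> = (1 / corner n) ^ Suc n"
    using prod_quotient_telescope[of "Suc n" corner] corner_nonzero corner_Suc_n
    by (subst prod.distrib) simp
  finally show "(\<Prod>j\<in>{1..Suc n}. ?kap (Suc n - j))
      = poly (jacobi_poly (\<lambda>k. gen_image n u (X k)) (\<lambda>k. gen_image n u (Q k)) n) 0 ^ Suc n"
    unfolding at_0 .
qed

text \<open>The congruence at t = 0. Compared with \<open>jacobi_poly_gen_image_0\<close> the two
  arguments of \<open>toeplitz_minor\<close> are exchanged, which is how \<beta> takes the place of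
  \<alpha>.\<close>

lemma jacobi_poly_gen_image_dual_0:
  assumes k: "k \<le> n"
  shows "Polynomial.coeff (jacobi_poly (\<lambda>k. - gen_image n u (X (n + 2 - k))) (\<lambda>k. gen_image n u (Q (n + 1 - k))) k) 0
    = toeplitz_minor c (n - k) k / toeplitz_minor c (n + 1 - k) k" (is "Polynomial.coeff ?G' 0 = _")
proof -
  let ?G = "jacobi_poly (\<lambda>k. gen_image n u (X k)) (\<lambda>k. gen_image n u (Q k))"
  let ?kap = "\<lambda>k. corner (n - k) / (corner (Suc n - k) * corner n)"
  have "\<exists>H. \<forall>t. poly ?G' t * poly (?G n) (- t) = ?kap k * poly (?G (n - k)) (- t) + t ^ Suc n * poly H t"
  proof (rule jacobi_dual_congruence[OF jacobi_poly_gen_image_top[OF corner u] _ _ k])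
    show "?kap 0 = 1" using corner_nonzero[of n] corner_Suc_n by simp
    show "?kap (Suc k) = ?kap k * gen_image n u (Q (n - k))" if "Suc k \<le> n" for k
      by (rule corner_scaling_Suc[OF that])
  qed
  then obtain H where "\<forall>t. poly ?G' t * poly (?G n) (- t)
      = ?kap k * poly (?G (n - k)) (- t) + t ^ Suc n * poly H t" by blast
  from spec[OF this, of 0]
  have "Polynomial.coeff ?G' 0 * Polynomial.coeff (?G n) 0 = ?kap k * Polynomial.coeff (?G (n - k)) 0"
    by (simp add: poly_0_coeff_0)
  moreover have "Polynomial.coeff (?G n) 0 = 1 / corner n"
    using jacobi_poly_gen_image_0[OF corner u, of n] c_0 by (simp add: toeplitz_minor_0_right corner_def)
  moreover have "Polynomial.coeff (?G (n - k)) 0 = toeplitz_minor c (n - k) k / corner (n - k)"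
    using jacobi_poly_gen_image_0[OF corner u, of "n - k"] k by (simp add: corner_def)
  moreover have "corner (Suc n - k) = toeplitz_minor c (n + 1 - k) k"
    using k by (simp add: corner_def)
  ultimately have eq: "Polynomial.coeff ?G' 0 * (1 / corner n) = corner (n - k) / (toeplitz_minor c (n + 1 - k) k * corner n)
      * (toeplitz_minor c (n - k) k / corner (n - k))" by (simp only:)
  have cancel: "g = z / D" if "g * (1 / p) = r / (D * p) * (z / r)" "p \<noteq> 0" "r \<noteq> 0" for g z D p r :: complex
    using that by (simp add: divide_simps split: if_splits)
  show ?thesis
    by (rule cancel[OF eq]) (use corner_nonzero[of n] corner_nonzero[of "n - k"] in auto)
qed

end

text \<open>Separates an expansion from the numbers inserted into it: the coefficients will depend
  on \<open>w\<close> alone, so that limits are taken only in \<open>E\<close>.\<close>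

definition e_value :: "((nat \<Rightarrow>\<^sub>0 nat) \<Rightarrow>\<^sub>0 complex) \<Rightarrow> (nat \<Rightarrow> nat \<Rightarrow> complex) \<Rightarrow> complex" where
  "e_value a E = (\<Sum>\<iota>\<in>Poly_Mapping.keys a. Poly_Mapping.lookup a \<iota>
     * (\<Prod>k\<in>Poly_Mapping.keys \<iota>. E k (Poly_Mapping.lookup \<iota> k)))"

lemma cpoly_eval_e_combination:
  "cpoly_eval f (e_combination e a) = e_value a (\<lambda>k i. cpoly_eval f (e i k))"
  by (simp add: e_combination_def e_value_def)

lemma e_value_cong:
  assumes "Poly_Mapping.keys a \<subseteq> e_indices" "\<And>k i. i \<le> k \<Longrightarrow> E k i = E' k i"
  shows "e_value a E = e_value a E'"
  unfolding e_value_def using assms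
  by (intro sum.cong refl arg_cong2[where f = "(*)"] prod.cong) (auto simp: e_indices_def)

lemma e_value_e_dual:
  assumes lam: "clinear_form lam" and E0: "\<And>k. E k 0 = 1"
  shows "e_value (e_dual N lam) E = lam (e_kernel N E)"
proof -
  have "e_value (e_dual N lam) E = (\<Sum>\<iota>\<in>e_indices_below N. Poly_Mapping.lookup (e_dual N lam) \<iota>
      * (\<Prod>k\<in>Poly_Mapping.keys \<iota>. E k (Poly_Mapping.lookup \<iota> k)))"
    unfolding e_value_def
    by (rule sum.mono_neutral_left) (use keys_e_dual in \<open>auto simp: in_keys_iff\<close>)
  also have "\<dots> = (\<Sum>\<iota>\<in>e_indices_below N. Poly_Mapping.lookup (e_dual N lam) \<iota>
      * (\<Prod>k\<in>{1..<N}. E k (Poly_Mapping.lookup \<iota> k)))"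
    by (intro sum.cong refl arg_cong2[where f = "(*)"] prod.mono_neutral_left)
       (auto simp: e_indices_below_def in_keys_iff E0)
  also have "\<dots> = lam (e_kernel N E)" by (rule sum_e_dual[OF lam])
  finally show ?thesis .
qed

lemma schubert_e_expansion:
  assumes "w permutes {1..N}"
  obtains js where "set js \<subseteq> {1..<N}" "e_coeffs (schubert w) = e_dual N (dd_word js)"
    "e_combination esym (e_dual N (dd_word js)) = schubert w"
    "e_coeffs (schubert (flip N w)) = e_dual N (dd_word (map (\<lambda>j. N - j) js))"
proof -
  obtain p where p: "schubert_in N w p" using schubert_in_exists[OF assms] by blast
  obtain js where js: "set js \<subseteq> {1..<N}" "p = e_combination esym (e_dual N (dd_word js))"
    "schubert_in N (flip N w) (e_combination esym (e_dual N (dd_word (map (\<lambda>j. N - j) js))))"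
    using schubert_in_dd_word[OF p] by blast
  have keys: "Poly_Mapping.keys (e_dual N lam) \<subseteq> e_indices" for lam
    using keys_e_dual[of N lam] by (auto simp: e_indices_below_def)
  show thesis
    using that[OF js(1)] schubert_eqI[OF p] schubert_eqI[OF js(3)] js(2) keys e_coeffs_eqI
    by metis
qed

lemma keys_e_coeffs_schubert:
  assumes "w permutes {1..N}"
  shows "Poly_Mapping.keys (e_coeffs (schubert w)) \<subseteq> e_indices"
    and "cpoly_eval f (schubert w) = e_value (e_coeffs (schubert w)) (esym_at f)"
proof -
  obtain js where js: "e_coeffs (schubert w) = e_dual N (dd_word js)"
    "e_combination esym (e_dual N (dd_word js)) = schubert w"
    using schubert_e_expansion[OF assms] by metis
  show "Poly_Mapping.keys (e_coeffs (schubert w)) \<subseteq> e_indices"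
    using keys_e_dual[of N "dd_word js"] js(1) by (auto simp: e_indices_below_def)
  show "cpoly_eval f (schubert w) = e_value (e_coeffs (schubert w)) (esym_at f)"
    using cpoly_eval_e_combination[of f esym "e_coeffs (schubert w)"] js by simp
qed

lemma schubert_fun_e_value:
  assumes "truncation (n + 1) (toeplitz c) \<in> UToep_open n" "c 0 = 1" "w permutes {1..N}"
  defines "u \<equiv> truncation (n + 1) (toeplitz c)"
  shows "schubert_fun n w u = e_value (e_coeffs (schubert w))
    (\<lambda>k i. Polynomial.coeff (jacobi_poly (\<lambda>k. gen_image n u (X k)) (\<lambda>k. gen_image n u (Q k)) k) (k - i))"
proof -
  have "schubert_fun n w u = cpoly_eval (gen_image n u) (quantum_schubert w)"
    using assms by (intro schubert_fun_eq) simp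
  also have "\<dots> = e_value (e_coeffs (schubert w)) (\<lambda>k i. cpoly_eval (gen_image n u) (qesym i k))"
    by (simp add: quantum_schubert_def cpoly_eval_e_combination)
  also have "\<dots> = e_value (e_coeffs (schubert w))
    (\<lambda>k i. Polynomial.coeff (jacobi_poly (\<lambda>k. gen_image n u (X k)) (\<lambda>k. gen_image n u (Q k)) k) (k - i))"
    by (rule e_value_cong[OF keys_e_coeffs_schubert(1)[OF assms(3)]]) (simp add: cpoly_eval_qesym)
  finally show ?thesis .
qed

text \<open>The expansion of the conjugate changes with \<open>n\<close>. Duality moves this
  dependence into the inserted numbers and leaves the coefficients of \<open>w\<close>.\<close>

lemma schubert_fun_flip_e_value:
  assumes "truncation (n + 1) (toeplitz c) \<in> UToep_open n" "c 0 = 1" "w permutes {1..n + 1}"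
  defines "u \<equiv> truncation (n + 1) (toeplitz c)"
  shows "schubert_fun n (longest (n + 1) \<circ> w \<circ> longest (n + 1)) u = e_value (e_coeffs (schubert w))
    (\<lambda>k i. Polynomial.coeff (jacobi_poly (\<lambda>k. - gen_image n u (X (n + 2 - k)))
       (\<lambda>k. gen_image n u (Q (n + 1 - k))) k) (k - i))" (is "_ = e_value _ ?E'")
proof -
  have corner: "toeplitz_corner c n" using assms by (intro UToep_open_corner) auto
  obtain js where js: "set js \<subseteq> {1..<n + 1}" "e_coeffs (schubert w) = e_dual (n + 1) (dd_word js)"
    "e_coeffs (schubert (flip (n + 1) w)) = e_dual (n + 1) (dd_word (map (\<lambda>j. n + 1 - j) js))"
    using schubert_e_expansion[OF assms(3)] by metis
  have "schubert_fun n (flip (n + 1) w) u = cpoly_eval (gen_image n u) (quantum_schubert (flip (n + 1) w))"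
    using assms by (intro schubert_fun_eq) simp
  also have "\<dots> = e_value (e_dual (n + 1) (dd_word (map (\<lambda>j. n + 1 - j) js)))
      (\<lambda>k i. cpoly_eval (gen_image n u) (qesym i k))"
    by (simp only: quantum_schubert_def cpoly_eval_e_combination js)
  also have "\<dots> = dd_word (map (\<lambda>j. n + 1 - j) js) (e_kernel (n + 1) (\<lambda>k i. cpoly_eval (gen_image n u) (qesym i k)))"
    by (rule e_value_e_dual[OF clinear_form_dd_word]) (simp add: qesym_0_left)
  also have "\<dots> = dd_word js (e_kernel (n + 1) ?E')"
    by (rule dd_word_peterson_dual[OF corner _ js(1)]) (simp_all only: u_def cpoly_eval_qesym if_True)
  also have "\<dots> = e_value (e_coeffs (schubert w)) ?E'"
    unfolding js(2) by (rule e_value_e_dual[OF clinear_form_dd_word, symmetric]) (simp add: coeff_jacobi_poly_self)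
  finally show ?thesis by (simp add: flip_def)
qed

lemma coeff_jacobi_poly_esym:
  assumes "i \<le> k"
  shows "Polynomial.coeff (jacobi_poly f (\<lambda>_. 0) k) (k - i) = esym_at f k i"
  using assms
proof (induction k arbitrary: i)
  case (Suc k)
  have rec: "jacobi_poly f (\<lambda>_. 0) (Suc k) = [:f (Suc k), 1:] * jacobi_poly f (\<lambda>_. 0) k"
    by (cases k) simp_all
  show ?case
  proof (cases i)
    case 0
    then show ?thesis by (simp add: coeff_jacobi_poly_self)
  next
    case (Suc i')
    have "Polynomial.coeff (jacobi_poly f (\<lambda>_. 0) (Suc k)) (k - i')
        = f (Suc k) * esym_at f k i' + (if k - i' \<ge> 1 then Polynomial.coeff (jacobi_poly f (\<lambda>_. 0) k) (k - Suc i') else 0)"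
      using Suc.IH[of i'] Suc Suc.prems unfolding rec coeff_linear_mult by simp
    also have "\<dots> = esym_at f (Suc k) (Suc i')"
      using Suc.IH[of "Suc i'"] Suc Suc.prems
      by (cases "i' = k") (auto simp: esym_Suc_Suc esym_eq_0)
    finally show ?thesis using Suc by simp
  qed
qed simp

section \<open>Ratios of Toeplitz minors\<close>

text \<open>Desnanot--Jacobi for Toeplitz minors.  With \<open>n = k + m\<close>, the orthogonal polynomials \<open>P\<close> for
  \<open>n\<close> and \<open>p, r\<close> for \<open>n - 1\<close> satisfy \<open>p = P + f r\<close>; the identity results from comparing constant
  terms and the first nonvanishing moments.\<close>

lemma toeplitz_minor_jacobi:
  fixes c :: "nat \<Rightarrow> 'a::field"
  assumes k: "1 \<le> k" and m: "1 \<le> m"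
    and nz: "toeplitz_minor c k m \<noteq> 0" "toeplitz_minor c k (Suc m) \<noteq> 0" "toeplitz_minor c (k - 1) (Suc m) \<noteq> 0"
  shows "(toeplitz_minor c k m)\<^sup>2 = toeplitz_minor c k (m - 1) * toeplitz_minor c k (Suc m)
    + toeplitz_minor c (Suc k) m * toeplitz_minor c (k - 1) m"
proof -
  define n n' where "n = k + m" and "n' = k + m - 1"
  interpret A: toeplitz_moments c n .
  interpret B: toeplitz_moments c n' .
  have "n + 1 - k = Suc m" "n + 1 - Suc k = m" by (auto simp: n_def)
  then have Ac: "A.corner k = toeplitz_minor c k (Suc m)" "A.corner (Suc k) = toeplitz_minor c (Suc k) m"
    unfolding A.corner_def by (simp_all only:)
  have "n' + 1 - k = m" "n' + 1 - (k - 1) = Suc m" using k m by (auto simp: n'_def)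
  then have Bc: "B.corner k = toeplitz_minor c k m" "B.corner (k - 1) = toeplitz_minor c (k - 1) (Suc m)"
    unfolding B.corner_def by (simp_all only:)
  obtain P where P: "A.monic_orth k P"
    using A.monic_orth_exists[of k] nz Ac by (auto simp: n_def)
  obtain p where p: "B.monic_orth k p"
    using B.monic_orth_exists[of k] nz Bc m by (auto simp: n'_def)
  have "B.corner (k - 1) \<noteq> 0" "k - 1 \<le> Suc n'" using nz Bc by (auto simp: n'_def)
  then obtain r where r: "B.monic_orth (k - 1) r"
    using B.monic_orth_exists[of "k - 1"] by blast
  have "B.h j = A.h (Suc j)" for j
    unfolding A.h_def B.h_def using k by (auto simp: n_def n'_def)
  then have sh: "B.moment q b = - A.moment q (Suc b)" for q b
    unfolding A.moment_def B.moment_def by (simp add: sum_negf[symmetric])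
  define f where "f = Polynomial.coeff (p - P) (k - 1)"
  have "p - P - Polynomial.smult f r = 0"
  proof (rule B.moment_eq_0_imp_eq_0[of "k - 1"])
    show "B.corner (k - 1) \<noteq> 0" using Bc nz by simp
    fix j assume "j \<ge> k - 1"
    then consider "j = k - 1" | "j = k" | "j > k" by linarith
    then show "Polynomial.coeff (p - P - Polynomial.smult f r) j = 0"
    proof cases
      case 1
      then show ?thesis using r by (simp add: f_def B.monic_orth_def)
    next
      case 2
      then show ?thesis using p P r k by (simp add: A.monic_orth_def B.monic_orth_def coeff_eq_0)
    next
      case 3
      then show ?thesis using p P r by (simp add: A.monic_orth_def B.monic_orth_def coeff_eq_0)
    qed
  next
    fix b assume "b < k - 1"
    then show "B.moment (p - P - Polynomial.smult f r) b = 0"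
      using p P r by (simp add: B.moment_diff B.moment_smult sh[of P] A.monic_orth_def B.monic_orth_def)
  qed (use m in \<open>simp add: n'_def\<close>)
  then have eq: "p - P = Polynomial.smult f r" by simp
  have "B.moment (p - P) (k - 1) = A.moment P k"
    using p k by (simp add: B.moment_diff sh[of P] B.monic_orth_def)
  then have mom: "A.moment P k = f * B.moment r (k - 1)"
    by (simp add: eq B.moment_smult)
  have "Polynomial.coeff (p - P) 0 = f * Polynomial.coeff r 0" by (simp add: eq)
  then have cst: "Polynomial.coeff p 0 - Polynomial.coeff P 0 = f * Polynomial.coeff r 0" by simp
  have "Polynomial.coeff P 0 * toeplitz_minor c k (Suc m) = toeplitz_minor c k m"
    using A.monic_orth_constant[OF P] Ac by (simp add: n_def)
  then have P0: "Polynomial.coeff P 0 = toeplitz_minor c k m / toeplitz_minor c k (Suc m)"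
    using nz by (simp add: field_simps)
  have "n' - k = m - 1" "n' - (k - 1) = m" using k by (auto simp: n'_def)
  with B.monic_orth_constant[OF p] B.monic_orth_constant[OF r] Bc k m nz
  have p0: "Polynomial.coeff p 0 = toeplitz_minor c k (m - 1) / toeplitz_minor c k m"
    and r0: "Polynomial.coeff r 0 = toeplitz_minor c (k - 1) m / toeplitz_minor c (k - 1) (Suc m)"
    by (auto simp: n'_def field_simps)
  have "toeplitz_minor c (Suc k) m = (- 1) ^ k * A.moment P k * toeplitz_minor c k (Suc m)"
    using A.monic_orth_moment[OF P] Ac by (simp add: n_def)
  also have "\<dots> = - f * ((- 1) ^ (k - 1) * B.moment r (k - 1)) * toeplitz_minor c k (Suc m)"
    unfolding mom using k by (cases k) auto
  also have "(- 1) ^ (k - 1) * B.moment r (k - 1) = toeplitz_minor c k m / toeplitz_minor c (k - 1) (Suc m)"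
    using B.monic_orth_moment[OF r] Bc k m nz by (simp add: n'_def field_simps)
  finally have 1: "toeplitz_minor c (Suc k) m * toeplitz_minor c (k - 1) m
      = - (f * Polynomial.coeff r 0) * toeplitz_minor c k m * toeplitz_minor c k (Suc m)"
    unfolding r0 by simp
  show ?thesis
    unfolding 1 cst[symmetric] p0 P0 using nz by (simp add: field_simps power2_eq_square)
qed

section \<open>Positivity and the passage from fixed minors to the corner\<close>

lemma totally_positive_contiguous_minor:
  assumes tp: "totally_positive D U" and D: "{..<k} \<subseteq> D" "{m..<m + k} \<subseteq> D"
  shows "Minor U {..<k} {m..<m + k} > 0"
proof -
  \<comment> \<open>Witness that the minor does not vanish identically: ones on the diagonal and on
    the \<open>m\<close>-th superdiagonal make the submatrix unit lower triangular.\<close>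
  define B :: "nat \<Rightarrow> nat \<Rightarrow> real" where "B i j = (if i = j \<or> j = i + m then 1 else 0)" for i j
  have "upper_unipotent D B" by (auto simp: upper_unipotent_def B_def)
  moreover have "Minor B {..<k} {m..<m + k} = Determinant.det (mat k k (\<lambda>(a, b). B a (m + b)))"
    unfolding Minor_def by (simp add: sorted_list_lessThan) (rule det_mat_cong, simp)
  then have "Minor B {..<k} {m..<m + k} = 1"
    by (subst (asm) det_mat_lower_triangular) (auto simp: B_def)
  ultimately have "\<exists>B. upper_unipotent D B \<and> Minor B {..<k} {m..<m + k} \<noteq> 0"
    by (intro exI[of _ B]) auto
  moreover have "finite {..<k} \<and> finite {m..<m + k} \<and> {..<k} \<subseteq> D \<and> {m..<m + k} \<subseteq> D
      \<and> card {..<k} = card {m..<m + k}" using D by simp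
  ultimately show ?thesis using tp unfolding totally_positive_def by blast
qed

lemma toeplitz_minor_pos:
  assumes "totally_positive UNIV (toeplitz c)"
  shows "toeplitz_minor c k m > 0"
proof -
  have "Minor (toeplitz c) {..<k} {m..<m + k} = toeplitz_minor c k m"
    unfolding Minor_def toeplitz_minor_def
    by (simp add: sorted_list_lessThan) (rule det_mat_cong, simp add: toeplitz_def)
  with totally_positive_contiguous_minor[OF assms, of k m] show ?thesis by simp
qed

lemma toeplitz_minor_pos_truncation:
  assumes "totally_positive {..<N} (entries (truncation N (toeplitz c)))" "k + m \<le> N"
  shows "toeplitz_minor c k m > 0"
proof -
  have "{..<k} \<subseteq> {..<N}" "{m..<m + k} \<subseteq> {..<N}" "m + k \<le> N" using assms(2) by auto
  with totally_positive_contiguous_minor[OF assms(1), of k m] Minor_contiguous[of m k N c]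
  show ?thesis by simp
qed

text \<open>The ratios \<open>Z k (m + 1) / Z k m\<close> decrease in \<open>m\<close>, and their decrements shrink at least
  geometrically while the ratio stays above \<open>L\<close>; this keeps the ratio above \<open>L\<close>.\<close>

lemma ratio_decrement_geometric:
  fixes Z :: "nat \<Rightarrow> nat \<Rightarrow> real"
  defines "S \<equiv> \<lambda>k m. Z k (Suc m) / Z k m"
  assumes pos: "\<And>k m. k + m \<le> n + 1 \<Longrightarrow> Z k m > 0"
    and jac: "\<And>k m. \<lbrakk>1 \<le> k; 1 \<le> m; k + m \<le> n\<rbrakk>
        \<Longrightarrow> (Z k m)\<^sup>2 = Z k (m - 1) * Z k (Suc m) + Z (Suc k) m * Z (k - 1) m"
    and k: "1 \<le> k" and m0: "1 \<le> m0"
    and up1: "\<And>m. \<lbrakk>m0 \<le> m; Suc k + m \<le> n\<rbrakk> \<Longrightarrow> S (Suc k) m \<le> U1"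
    and up2: "\<And>m. \<lbrakk>m0 \<le> m; k - 1 + m \<le> n\<rbrakk> \<Longrightarrow> S (k - 1) m \<le> U2"
    and L: "0 < L" and \<theta>: "U1 * U2 \<le> \<theta> * L\<^sup>2" "0 < \<theta>" "\<theta> < 1"
    and D: "S k (m0 - 1) - S k m0 \<le> D" "0 \<le> D" and SL: "S k m0 - D / (1 - \<theta>) \<ge> L"
    and m: "m0 \<le> m" "k + m \<le> n"
  shows "S k (m - 1) - S k m \<le> D \<and> S k m \<ge> L \<and> S k m \<le> S k (m - 1)"
proof -
  define d where "d m = S k (m - 1) - S k m" for m
  \<comment> \<open>Desnanot-Jacobi turns the decrement into a positive quotient of minors.\<close>
  have d: "d m = Z (Suc k) m * Z (k - 1) m / (Z k m * Z k (m - 1))" if "1 \<le> m" "k + m \<le> n" for m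
  proof -
    have "Z k m > 0" "Z k (m - 1) > 0" using that by (auto intro!: pos)
    moreover have "Z (Suc k) m * Z (k - 1) m = (Z k m)\<^sup>2 - Z k (m - 1) * Z k (Suc m)"
      using jac[OF k that] by simp
    moreover have "Suc (m - 1) = m" using that by simp
    ultimately show ?thesis
      unfolding d_def S_def by (simp add: field_simps power2_eq_square)
  qed
  have dpos: "0 \<le> d m" if "1 \<le> m" "k + m \<le> n" for m
  proof -
    have "Z (Suc k) m > 0" "Z (k - 1) m > 0" "Z k m > 0" "Z k (m - 1) > 0"
      using that by (auto intro!: pos)
    then show ?thesis by (simp add: d[OF that])
  qed
  \<comment> \<open>The drop accumulated since \<open>m0\<close> stays below a geometric sum; the
    full sum \<open>D / (1 - \<theta>)\<close> is what \<open>SL\<close> sets aside.\<close>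
  have "d m \<le> \<theta> ^ (m - m0) * D \<and> S k m \<ge> S k m0 - D * (1 - \<theta> ^ (m - m0)) / (1 - \<theta>)"
    using m
  proof (induction m rule: dec_induct)
    case base
    then show ?case using D by (simp add: d_def)
  next
    case (step m)
    then have IH: "d m \<le> \<theta> ^ (m - m0) * D" "S k m \<ge> S k m0 - D * (1 - \<theta> ^ (m - m0)) / (1 - \<theta>)"
      by auto
    have m1: "1 \<le> m" "k + m \<le> n" using m0 step by auto
    have Zp: "Z (Suc k) m > 0" "Z (Suc k) (Suc m) > 0" "Z (k - 1) m > 0" "Z (k - 1) (Suc m) > 0"
      "Z k m > 0" "Z k (m - 1) > 0" "Z k (Suc m) > 0"
      using m1 step.prems k by (auto intro!: pos)
    have "D * (1 - \<theta> ^ (m - m0)) / (1 - \<theta>) \<le> D / (1 - \<theta>)"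
      using \<theta> D(2) by (intro divide_right_mono mult_left_le) auto
    with IH(2) SL have SmL: "L \<le> S k m" by linarith
    have "S k m \<le> S k (m - 1)" using dpos[OF m1] by (simp add: d_def)
    with SmL L have LL: "L\<^sup>2 \<le> S k m * S k (m - 1)"
      unfolding power2_eq_square by (intro mult_mono) auto
    \<comment> \<open>Two consecutive decrements have quotient
      \<open>S (Suc k) m * S (k - 1) m / (S k m * S k (m - 1))\<close>, at most
      \<open>U1 * U2 / L^2\<close> and so at most \<theta>.\<close>
    have "d (Suc m) * (S k m * S k (m - 1)) = d m * (S (Suc k) m * S (k - 1) m)"
      using Zp m1 step.prems by (simp add: d S_def field_simps)
    also have "\<dots> \<le> d m * (U1 * U2)"
      using up1[of m] up2[of m] dpos[OF m1] Zp step
      by (intro mult_left_mono mult_mono) (auto simp: S_def intro: order_trans[of 0 "S (Suc k) m"])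
    also have "\<dots> \<le> d m * (\<theta> * (S k m * S k (m - 1)))"
    proof (intro mult_left_mono)
      show "U1 * U2 \<le> \<theta> * (S k m * S k (m - 1))"
        using \<theta>(1) mult_left_mono[OF LL, of \<theta>] \<theta>(2) by linarith
    qed (rule dpos[OF m1])
    finally have "d (Suc m) * (S k m * S k (m - 1)) \<le> (\<theta> * d m) * (S k m * S k (m - 1))"
      by (simp add: mult_ac)
    moreover have "S k m * S k (m - 1) > 0"
      using LL L by (meson less_le_trans zero_less_power)
    ultimately have "d (Suc m) \<le> \<theta> * d m" by (simp add: mult_le_cancel_right_pos)
    also have "\<dots> \<le> \<theta> * (\<theta> ^ (m - m0) * D)" using IH(1) \<theta> by (intro mult_left_mono) auto
    finally have dS: "d (Suc m) \<le> \<theta> ^ (Suc m - m0) * D" using step by (simp add: Suc_diff_le)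
    have "S k (Suc m) = S k m - d (Suc m)" by (simp add: d_def)
    also have "\<dots> \<ge> S k m0 - D * (1 - \<theta> ^ (m - m0)) / (1 - \<theta>) - \<theta> ^ (m - m0) * D"
    proof -
      have "\<theta> ^ (Suc m - m0) * D \<le> \<theta> ^ (m - m0) * D"
        using \<theta> D(2) by (intro mult_right_mono power_decreasing) auto
      with dS IH(2) show ?thesis by linarith
    qed
    also have "S k m0 - D * (1 - \<theta> ^ (m - m0)) / (1 - \<theta>) - \<theta> ^ (m - m0) * D
        = S k m0 - D * (1 - \<theta> ^ (Suc m - m0)) / (1 - \<theta>)"
      using \<theta> step by (simp add: Suc_diff_le field_simps)
    finally show ?case using dS by simp
  qed
  moreover have "\<theta> ^ (m - m0) * D \<le> D"
    using \<theta> D(2) by (intro mult_left_le_one_le power_le_one) auto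
  moreover have "D * (1 - \<theta> ^ (m - m0)) / (1 - \<theta>) \<le> D / (1 - \<theta>)"
    using \<theta> D(2) by (intro divide_right_mono mult_left_le) auto
  moreover have "0 \<le> d m" using m m0 by (intro dpos) auto
  ultimately show ?thesis using SL by (auto simp: d_def)
qed

text \<open>Log-concavity in \<open>m\<close>: the second product in Desnanot-Jacobi is positive and
  is dropped.\<close>

lemma ratio_decreasing:
  fixes Z :: "nat \<Rightarrow> nat \<Rightarrow> real"
  assumes pos: "\<And>k m. k + m \<le> n + 1 \<Longrightarrow> Z k m > 0" and Z0: "\<And>m. Z 0 m = 1"
    and jac: "\<And>k m. \<lbrakk>1 \<le> k; 1 \<le> m; k + m \<le> n\<rbrakk>
        \<Longrightarrow> (Z k m)\<^sup>2 = Z k (m - 1) * Z k (Suc m) + Z (Suc k) m * Z (k - 1) m"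
    and m: "m0 \<le> m" "k + m \<le> n"
  shows "Z k (Suc m) / Z k m \<le> Z k (Suc m0) / Z k m0"
proof (cases "k = 0")
  case False
  then have k: "1 \<le> k" by simp
  from m show ?thesis
  proof (induction m rule: dec_induct)
    case (step m)
    have "Z (Suc k) (Suc m) > 0" "Z (k - 1) (Suc m) > 0" and Zp: "Z k m > 0" "Z k (Suc m) > 0"
      using step.prems by (auto intro!: pos)
    with jac[OF k, of "Suc m"] step.prems have "Z k (Suc (Suc m)) * Z k m \<le> (Z k (Suc m))\<^sup>2"
      by (simp add: mult.commute)
    with Zp have "Z k (Suc (Suc m)) / Z k (Suc m) \<le> Z k (Suc m) / Z k m"
      by (simp add: field_simps power2_eq_square)
    with step show ?case by simp
  qed simp
qed (simp add: Z0)

text \<open>The order of choices is essential: \<eta> depends on \<epsilon>, then \<open>m0\<close>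
  is an index where the ratios of the limit matrix are within tolerance, then \<open>n\<close> is so
  large that the finitely many minors near \<open>m0\<close> have converged. Beyond
  \<open>m0\<close>, monotonicity and the geometric bound take over.\<close>

lemma corner_ratio_limits:
  fixes Z :: "nat \<Rightarrow> nat \<Rightarrow> nat \<Rightarrow> real" and Zi :: "nat \<Rightarrow> nat \<Rightarrow> real" and \<sigma> :: "nat \<Rightarrow> real"
  assumes pos: "\<And>n k m. \<lbrakk>1 \<le> n; k + m \<le> n + 1\<rbrakk> \<Longrightarrow> Z n k m > 0" and Z0: "\<And>n m. Z n 0 m = 1"
    and jac: "\<And>n k m. \<lbrakk>1 \<le> n; 1 \<le> k; 1 \<le> m; k + m \<le> n\<rbrakk>
        \<Longrightarrow> (Z n k m)\<^sup>2 = Z n k (m - 1) * Z n k (Suc m) + Z n (Suc k) m * Z n (k - 1) m"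
    and lim: "\<And>k m. (\<lambda>n. Z n k m) \<longlonglongrightarrow> Zi k m" and Zi_pos: "\<And>k m. Zi k m > 0"
    and rat: "\<And>k. (\<lambda>m. Zi k (Suc m) / Zi k m) \<longlonglongrightarrow> \<sigma> k" and \<sigma>_pos: "\<And>k. \<sigma> k > 0"
    and gap: "\<sigma> (Suc k) * \<sigma> (k - 1) < (\<sigma> k)\<^sup>2" and k: "1 \<le> k"
  shows "(\<lambda>n. Z n k (n + 1 - k) / Z n k (n - k)) \<longlonglongrightarrow> \<sigma> k"
    and "(\<lambda>n. Z n (Suc k) (n - k) * Z n (k - 1) (n + 2 - k) / (Z n k (n + 1 - k))\<^sup>2) \<longlonglongrightarrow> 0"
proof -
  define S where "S n k m = Z n k (Suc m) / Z n k m" for n k m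
  define Si where "Si k m = Zi k (Suc m) / Zi k m" for k m
  define q where "q n = Z n (Suc k) (n - k) * Z n (k - 1) (n + 2 - k) / (Z n k (n + 1 - k))\<^sup>2" for n
  have S_lim: "(\<lambda>n. S n k m) \<longlonglongrightarrow> Si k m" for k m
    unfolding S_def Si_def using Zi_pos[of k m] by (intro tendsto_divide lim) simp
  have Si_lim: "(\<lambda>m. Si k (Suc m)) \<longlonglongrightarrow> \<sigma> k" for k
    using rat[of k] unfolding Si_def by (rule LIMSEQ_Suc)
  have main: "\<forall>\<^sub>F n in sequentially. \<bar>S n k (n - k) - \<sigma> k\<bar> < \<epsilon> \<and> \<bar>q n\<bar> < \<epsilon>" if \<epsilon>: "\<epsilon> > 0" for \<epsilon>
  proof -
    have "((\<lambda>\<eta>. (\<sigma> k - \<eta>)\<^sup>2 - (\<sigma> (Suc k) + \<eta>) * (\<sigma> (k - 1) + \<eta>))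
        \<longlongrightarrow> (\<sigma> k)\<^sup>2 - \<sigma> (Suc k) * \<sigma> (k - 1)) (at_right 0)"
      by (auto intro!: tendsto_eq_intros)
    then have 1: "\<forall>\<^sub>F \<eta> in at_right 0. (\<sigma> k - \<eta>)\<^sup>2 - (\<sigma> (Suc k) + \<eta>) * (\<sigma> (k - 1) + \<eta>) > 0"
      by (rule order_tendstoD) (use gap in simp)
    have "((\<lambda>\<eta>. \<eta> * (\<sigma> (k - 1) + \<eta>)\<^sup>2 / (\<sigma> k - \<eta>) ^ 3) \<longlongrightarrow> 0) (at_right 0)"
      using \<sigma>_pos[of k] by (auto intro!: tendsto_eq_intros)
    then have 2: "\<forall>\<^sub>F \<eta> in at_right 0. \<eta> * (\<sigma> (k - 1) + \<eta>)\<^sup>2 / (\<sigma> k - \<eta>) ^ 3 < \<epsilon>"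
      by (rule order_tendstoD) (rule \<epsilon>)
    have "\<forall>\<^sub>F \<eta> in at_right 0. \<eta> \<in> {0<..<min \<epsilon> (\<sigma> k)}"
      by (rule eventually_at_right_real) (use \<epsilon> \<sigma>_pos[of k] in simp)
    then have 3: "\<forall>\<^sub>F \<eta> in at_right 0. \<eta> < min \<epsilon> (\<sigma> k) \<and> \<eta> > 0"
      by eventually_elim simp
    from eventually_happens[OF eventually_conj[OF 1 eventually_conj[OF 2 3]]]
    obtain \<eta> where \<eta>: "(\<sigma> (Suc k) + \<eta>) * (\<sigma> (k - 1) + \<eta>) < (\<sigma> k - \<eta>)\<^sup>2"
      "\<eta> * (\<sigma> (k - 1) + \<eta>)\<^sup>2 / (\<sigma> k - \<eta>) ^ 3 < \<epsilon>" "\<eta> < \<epsilon>" "\<eta> < \<sigma> k" "0 < \<eta>"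
      by (auto simp: trivial_limit_at_right_real)
    \<comment> \<open>\<eta> is so small that \<open>gap\<close> survives perturbing all three
      limits, which yields \<theta> < 1; its other property is the final bound for
      \<open>q n\<close>.\<close>
    define L U1 U2 where "L = \<sigma> k - \<eta>" and "U1 = \<sigma> (Suc k) + \<eta>" and "U2 = \<sigma> (k - 1) + \<eta>"
    have L: "0 < L" and U: "0 < U1" "0 < U2"
      using \<eta> \<sigma>_pos[of "Suc k"] \<sigma>_pos[of "k - 1"] by (auto simp: L_def U1_def U2_def)
    define \<theta> where "\<theta> = U1 * U2 / L\<^sup>2"
    have \<theta>: "0 < \<theta>" "\<theta> < 1" "U1 * U2 \<le> \<theta> * L\<^sup>2"
      using L U \<eta>(1) by (auto simp: \<theta>_def L_def U1_def U2_def)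
    \<comment> \<open>Decrements starting from \<open>D\<close> lose at most
      \<open>D / (1 - \<theta>) = \<eta> / 2\<close> in total; the other half of \<eta> covers the
      starting error at \<open>m0\<close>.\<close>
    define D where "D = \<eta> / 2 * (1 - \<theta>)"
    have "1 - \<theta> \<noteq> 0" using \<theta> by simp
    then have D: "D / (1 - \<theta>) = \<eta> / 2"
      unfolding D_def by (rule nonzero_mult_div_cancel_right)
    have D_pos: "0 < D" using \<theta> \<eta> by (simp add: D_def)
    have D\<eta>: "D \<le> \<eta>" using \<theta> \<eta>(5) by (simp add: D_def field_simps)
    have "(\<lambda>m. Si k m - Si k (Suc m)) \<longlonglongrightarrow> \<sigma> k - \<sigma> k"
      using rat[of k] unfolding Si_def[symmetric] by (intro tendsto_diff Si_lim)
    then have "\<forall>\<^sub>F m in sequentially. Si k m - Si k (Suc m) < D"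
      by (rule order_tendstoD) (use D_pos in simp)
    moreover have "\<forall>\<^sub>F m in sequentially. Si (Suc k) (Suc m) < U1"
      by (rule order_tendstoD[OF Si_lim]) (use \<eta> in \<open>simp add: U1_def\<close>)
    moreover have "\<forall>\<^sub>F m in sequentially. Si (k - 1) (Suc m) < U2"
      by (rule order_tendstoD[OF Si_lim]) (use \<eta> in \<open>simp add: U2_def\<close>)
    moreover have "\<forall>\<^sub>F m in sequentially. Si k (Suc m) > \<sigma> k - \<eta> / 2"
      by (rule order_tendstoD[OF Si_lim]) (use \<eta> in simp)
    moreover have "\<forall>\<^sub>F m in sequentially. Si k (Suc m) < \<sigma> k + \<epsilon>"
      by (rule order_tendstoD[OF Si_lim]) (use \<epsilon> in simp)
    ultimately have "\<forall>\<^sub>F m in sequentially. Si k m - Si k (Suc m) < D \<and> Si (Suc k) (Suc m) < U1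
        \<and> Si (k - 1) (Suc m) < U2 \<and> Si k (Suc m) > \<sigma> k - \<eta> / 2 \<and> Si k (Suc m) < \<sigma> k + \<epsilon>"
      by (intro eventually_conj)
    from eventually_happens[OF this] obtain m' where m': "Si k m' - Si k (Suc m') < D"
      "Si (Suc k) (Suc m') < U1" "Si (k - 1) (Suc m') < U2" "Si k (Suc m') > \<sigma> k - \<eta> / 2" "Si k (Suc m') < \<sigma> k + \<epsilon>"
      by auto
    define m0 where "m0 = Suc m'"
    have "\<forall>\<^sub>F n in sequentially. S n k m' - S n k m0 < D"
      by (rule order_tendstoD[OF tendsto_diff[OF S_lim S_lim]]) (use m' in \<open>simp add: m0_def\<close>)
    moreover have "\<forall>\<^sub>F n in sequentially. S n (Suc k) m0 < U1" "\<forall>\<^sub>F n in sequentially. S n (k - 1) m0 < U2"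
      "\<forall>\<^sub>F n in sequentially. S n k m0 < \<sigma> k + \<epsilon>"
      by (rule order_tendstoD[OF S_lim], use m' in \<open>simp add: m0_def\<close>)+
    moreover have "\<forall>\<^sub>F n in sequentially. S n k m0 > \<sigma> k - \<eta> / 2"
      by (rule order_tendstoD[OF S_lim]) (use m' in \<open>simp add: m0_def\<close>)
    moreover have "\<forall>\<^sub>F n in sequentially. n \<ge> k + m0 + 2" by (rule eventually_ge_at_top)
    ultimately show ?thesis
    proof eventually_elim
      case (elim n)
      have n: "1 \<le> n" "m0 \<le> n - k" "k + (n - k) \<le> n" using elim by auto
      have posn: "Z n k m > 0" if "k + m \<le> n + 1" for k m
        using pos[OF n(1) that] .
      have jacn: "(Z n k m)\<^sup>2 = Z n k (m - 1) * Z n k (Suc m) + Z n (Suc k) m * Z n (k - 1) m"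
        if "1 \<le> k" "1 \<le> m" "k + m \<le> n" for k m
        using jac[OF n(1) that] .
      have dec: "S n l m \<le> S n l m0" if "m0 \<le> m" "l + m \<le> n" for l m
        unfolding S_def by (rule ratio_decreasing[OF posn Z0 jacn that])
      have "S n k (n - k - 1) - S n k (n - k) \<le> D \<and> S n k (n - k) \<ge> L \<and> S n k (n - k) \<le> S n k (n - k - 1)"
        unfolding S_def
      proof (rule ratio_decrement_geometric[OF posn jacn k, where ?U1.0 = U1 and ?U2.0 = U2 and ?\<theta> = \<theta> and ?m0.0 = m0])
        show "Z n (Suc k) (Suc m) / Z n (Suc k) m \<le> U1" if "m0 \<le> m" "Suc k + m \<le> n" for m
          using dec[OF that] elim unfolding S_def by linarith
        show "Z n (k - 1) (Suc m) / Z n (k - 1) m \<le> U2" if "m0 \<le> m" "k - 1 + m \<le> n" for m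
          using dec[OF that] elim unfolding S_def by linarith
        show "Z n k (Suc (m0 - 1)) / Z n k (m0 - 1) - Z n k (Suc m0) / Z n k m0 \<le> D"
          using elim by (simp add: S_def m0_def)
        show "L \<le> Z n k (Suc m0) / Z n k m0 - D / (1 - \<theta>)"
          using elim unfolding D S_def by (simp add: L_def)
      qed (use n L \<theta> D_pos in \<open>auto simp: m0_def\<close>)
      then have d: "S n k (n - k - 1) - S n k (n - k) \<le> D" "S n k (n - k) \<ge> L" "S n k (n - k - 1) \<ge> L" by auto
      have up: "S n k (n - k) < \<sigma> k + \<epsilon>" using dec[of "n - k" k] n elim by force
      define m where "m = n - k - 1"
      have m: "n - k = Suc m" "n + 1 - k = Suc (Suc m)" "n + 2 - k = Suc (Suc (Suc m))" "n = Suc (k + m)"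
        using elim by (auto simp: m_def)
      have Zp: "Z n k m > 0" "Z n k (Suc m) > 0" "Z n k (Suc (Suc m)) > 0" "Z n (Suc k) (Suc m) > 0"
        "Z n (k - 1) (Suc m) > 0" "Z n (k - 1) (Suc (Suc m)) > 0" "Z n (k - 1) (Suc (Suc (Suc m))) > 0"
        using n(1) k by (auto intro!: pos simp: m(4))
      have j: "Z n (Suc k) (Suc m) * Z n (k - 1) (Suc m) = (Z n k (Suc m))\<^sup>2 - Z n k m * Z n k (Suc (Suc m))"
        using jac[of n k "Suc m"] n(1) k by (simp add: m(4))
      have dd: "S n k m - S n k (Suc m) = Z n (Suc k) (Suc m) * Z n (k - 1) (Suc m) / (Z n k m * Z n k (Suc m))"
        unfolding j S_def using Zp by (simp add: field_simps power2_eq_square)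
      \<comment> \<open>\<open>q n\<close> is the last decrement times a quotient of ratios bounded
        by \<open>U2\<close> above and \<open>L\<close> below, so it is small together with
        \<open>D\<close>.\<close>
      have "q n = (S n k m - S n k (Suc m)) * (S n (k - 1) (Suc m) * S n (k - 1) (Suc (Suc m))) / (S n k m * (S n k (Suc m))\<^sup>2)"
        unfolding dd unfolding q_def m(1-3) S_def using Zp by (simp add: field_simps power2_eq_square)
      also have "\<dots> \<le> D * (U2 * U2) / (L * L\<^sup>2)"
      proof -
        have "S n (k - 1) (Suc m) \<le> U2" "S n (k - 1) (Suc (Suc m)) \<le> U2"
          using dec[of "Suc m" "k - 1"] dec[of "Suc (Suc m)" "k - 1"] n k elim by (auto simp: m)
        moreover have "S n k m - S n k (Suc m) \<le> D" "L \<le> S n k m" "L \<le> S n k (Suc m)"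
          using d by (simp_all add: m m_def[symmetric])
        moreover have "0 \<le> S n k m - S n k (Suc m)" unfolding dd using Zp by simp
        moreover have "0 < S n (k - 1) (Suc m)" "0 < S n (k - 1) (Suc (Suc m))"
          unfolding S_def using Zp by auto
        ultimately show ?thesis
          using D_pos U L by (intro frac_le mult_mono power_mono mult_nonneg_nonneg mult_pos_pos) auto
      qed
      also have "\<dots> \<le> \<eta> * (U2 * U2) / (L * L\<^sup>2)"
        using D\<eta> U L by (intro divide_right_mono mult_right_mono) auto
      also have "\<dots> < \<epsilon>"
        using \<eta>(2) by (simp add: L_def U2_def power2_eq_square power3_eq_cube mult.assoc)
      finally have "q n < \<epsilon>" .
      moreover have "q n > 0" unfolding q_def m(1-3) using Zp by simp
      ultimately show ?case using up d(2) \<eta>(3) by (auto simp: L_def)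
    qed
  qed
  have "(\<lambda>n. S n k (n - k)) \<longlonglongrightarrow> \<sigma> k"
    unfolding tendsto_iff dist_real_def
    by (intro allI impI) (drule main, erule eventually_mono, simp)
  moreover have "\<forall>\<^sub>F n in sequentially. S n k (n - k) = Z n k (n + 1 - k) / Z n k (n - k)"
    using eventually_ge_at_top[of k] by eventually_elim (simp add: S_def Suc_diff_le)
  ultimately show "(\<lambda>n. Z n k (n + 1 - k) / Z n k (n - k)) \<longlonglongrightarrow> \<sigma> k"
    by (rule Lim_transform_eventually)
  show "(\<lambda>n. Z n (Suc k) (n - k) * Z n (k - 1) (n + 2 - k) / (Z n k (n + 1 - k))\<^sup>2) \<longlonglongrightarrow> 0"
    unfolding tendsto_iff dist_real_def q_def[symmetric]
    by (intro allI impI) (drule main, erule eventually_mono, simp)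
qed

text \<open>Deleting column \<open>j\<close> in the first-row expansion leaves a unit triangular
  block and a smaller matrix of the same kind. The recursion says that the minors
  \<open>Z m 1\<close> are the coefficients of 1 / C(-z), with C the generating series of
  \<open>c\<close>.\<close>

lemma toeplitz_minor_hessenberg:
  fixes c :: "nat \<Rightarrow> 'a::idom"
  assumes "c 0 = 1"
  shows "toeplitz_minor c (Suc m) 1 = (\<Sum>j<Suc m. (- 1) ^ j * c (Suc j) * toeplitz_minor c (m - j) 1)"
proof -
  let ?f = "\<lambda>(a, b). if a \<le> 1 + b then c (1 + b - a) else 0"
  let ?A = "mat (Suc m) (Suc m) ?f"
  have del: "Determinant.det (mat_delete ?A 0 j) = toeplitz_minor c (m - j) 1" if j: "j < Suc m" for j
  proof -
    have "mat_delete ?A 0 j = four_block_mat (mat j j (\<lambda>(a, b). if a \<le> b then c (b - a) else 0))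
        (mat j (m - j) (\<lambda>(a, b). c (Suc (j + b) - a))) (0\<^sub>m (m - j) j)
        (mat (m - j) (m - j) ?f)" (is "_ = ?B")
    proof (rule eq_matI)
      fix a b assume "a < dim_row ?B" "b < dim_col ?B"
      then have "a < m" "b < m" using j by auto
      then show "mat_delete ?A 0 j $$ (a, b) = ?B $$ (a, b)"
        using j by (auto simp: mat_delete_def four_block_mat_def Let_def intro!: arg_cong[where f = c])
    qed (use j in \<open>auto simp: mat_delete_def\<close>)
    then have "Determinant.det (mat_delete ?A 0 j)
        = Determinant.det (mat j j (\<lambda>(a, b). if a \<le> b then c (b - a) else 0)) * Determinant.det (mat (m - j) (m - j) ?f)"
      by (simp add: det_four_block_mat_lower_left_zero[where n = j and m = "m - j"])
    also have "Determinant.det (mat j j (\<lambda>(a, b). if a \<le> b then c (b - a) else 0)) = 1"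
      by (subst det_mat_upper_triangular) (auto simp: assms)
    finally show ?thesis by (simp only: toeplitz_minor_def mult_1)
  qed
  have "toeplitz_minor c (Suc m) 1 = (\<Sum>j<Suc m. ?A $$ (0, j) * cofactor ?A 0 j)"
    unfolding toeplitz_minor_def by (rule laplace_expansion_row) auto
  also have "\<dots> = (\<Sum>j<Suc m. (- 1) ^ j * c (Suc j) * toeplitz_minor c (m - j) 1)"
  proof (rule sum.cong)
    fix j assume "j \<in> {..<Suc m}"
    then have j: "j < Suc m" by simp
    show "?A $$ (0, j) * cofactor ?A 0 j = (- 1) ^ j * c (Suc j) * toeplitz_minor c (m - j) 1"
      unfolding cofactor_def del[OF j] using j by simp
  qed simp
  finally show ?thesis .
qed

text \<open>The dual Jacobi-Trudi identity. Exchanging the two arguments exchanges the two products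
  in Desnanot-Jacobi, so both sides obey the same recurrence; nonvanishing minors let it determine
  the next value.\<close>

lemma toeplitz_minor_dual:
  fixes c :: "nat \<Rightarrow> 'a::field"
  assumes c0: "c 0 = 1" and nz: "\<And>k m. toeplitz_minor c k m \<noteq> 0"
  shows "toeplitz_minor (\<lambda>m. toeplitz_minor c m 1) k m = toeplitz_minor c m k"
proof (induction k arbitrary: m rule: induct_nat_012)
  case 0
  show ?case by (simp add: toeplitz_minor_0_right c0)
next
  case 1
  show ?case by simp
next
  case (ge2 k)
  define d where "d = (\<lambda>m. toeplitz_minor c m 1)"
  have IH: "toeplitz_minor d k m = toeplitz_minor c m k" "toeplitz_minor d (Suc k) m = toeplitz_minor c m (Suc k)" for m
    using ge2 by (simp_all only: d_def)
  have d0: "d 0 = 1" by (simp add: d_def)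
  have "toeplitz_minor d (Suc (Suc k)) m = toeplitz_minor c m (Suc (Suc k))"
  proof (cases m)
    case 0
    then show ?thesis by (simp add: toeplitz_minor_0_right d0)
  next
    case (Suc l)
    have "(toeplitz_minor d (Suc k) (Suc l))\<^sup>2
        = toeplitz_minor d (Suc k) l * toeplitz_minor d (Suc k) (Suc (Suc l))
          + toeplitz_minor d (Suc (Suc k)) (Suc l) * toeplitz_minor d k (Suc l)"
      using toeplitz_minor_jacobi[of "Suc k" "Suc l" d] by (simp add: IH nz)
    moreover have "(toeplitz_minor c (Suc l) (Suc k))\<^sup>2
        = toeplitz_minor c (Suc l) k * toeplitz_minor c (Suc l) (Suc (Suc k))
          + toeplitz_minor c (Suc (Suc l)) (Suc k) * toeplitz_minor c l (Suc k)"
      using toeplitz_minor_jacobi[of "Suc l" "Suc k" c] by (simp add: nz)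
    ultimately have "toeplitz_minor d (Suc (Suc k)) (Suc l) * toeplitz_minor c (Suc l) k
        = toeplitz_minor c (Suc l) (Suc (Suc k)) * toeplitz_minor c (Suc l) k"
      by (auto simp: IH mult.commute)
    then show ?thesis using nz Suc by simp
  qed
  then show ?case by (simp only: d_def)
qed

lemma tendsto_det_mat:
  fixes f :: "nat \<Rightarrow> nat \<times> nat \<Rightarrow> complex"
  assumes "\<And>a b. \<lbrakk>a < k; b < k\<rbrakk> \<Longrightarrow> (\<lambda>m. f m (a, b)) \<longlonglongrightarrow> g (a, b)"
  shows "(\<lambda>m. Determinant.det (mat k k (f m))) \<longlonglongrightarrow> Determinant.det (mat k k g)"
proof -
  have eq: "Determinant.det (mat k k h) = (\<Sum>p | p permutes {0..<k}. signof p * (\<Prod>i = 0..<k. h (i, p i)))"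
    for h :: "nat \<times> nat \<Rightarrow> complex"
  proof -
    have "Determinant.det (mat k k h) = (\<Sum>p | p permutes {0..<k}. signof p * (\<Prod>i = 0..<k. mat k k h $$ (i, p i)))"
      by (rule det_def') simp
    also have "\<dots> = (\<Sum>p | p permutes {0..<k}. signof p * (\<Prod>i = 0..<k. h (i, p i)))"
    proof (intro sum.cong arg_cong2[where f = "(*)"] prod.cong refl)
      fix p i assume "p \<in> {p. p permutes {0..<k}}" "i \<in> {0..<k}"
      then have "p i < k" "i < k" using permutes_in_image[of p "{0..<k}" i] by auto
      then show "mat k k h $$ (i, p i) = h (i, p i)" by simp
    qed
    finally show ?thesis .
  qed
  show ?thesis
    unfolding eq
  proof (intro tendsto_sum tendsto_mult tendsto_const tendsto_prod)
    fix p i assume "p \<in> {p. p permutes {0..<k}}" "i \<in> {0..<k}"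
    then have "p i < k" "i < k" using permutes_in_image[of p "{0..<k}" i] by auto
    then show "(\<lambda>m. f m (i, p i)) \<longlonglongrightarrow> g (i, p i)" by (intro assms)
  qed
qed

lemma det_mat_scale_columns:
  "Determinant.det (mat k k (\<lambda>(a, b). f (a, b) * s b)) = Determinant.det (mat k k f) * (\<Prod>b<k. s b)"
proof -
  have "(\<Prod>b<k. s b) = Determinant.det (mat k k (\<lambda>(a, b). if a = b then s b else 0))"
    by (subst det_mat_lower_triangular) auto
  also have "Determinant.det (mat k k f) * \<dots> = Determinant.det (mat k k (\<lambda>(a, b). f (a, b) * s b))"
    unfolding det_mat_mult
  proof (rule det_mat_cong)
    fix a b assume "a < k" "b < k"
    have "(\<Sum>j<k. f (a, j) * (if j = b then s b else 0)) = (\<Sum>j<k. if j = b then f (a, b) * s b else 0)"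
      by (rule sum.cong) auto
    with \<open>b < k\<close> show "(\<lambda>(a, b). \<Sum>j<k. f (a, j) * (\<lambda>(a, b). if a = b then s b else 0) (j, b)) (a, b)
        = (\<lambda>(a, b). f (a, b) * s b) (a, b)" by simp
  qed
  finally show ?thesis by simp
qed

text \<open>A kernel vector of the transpose would be a nonzero polynomial of degree below
  \<open>k\<close> with \<open>k\<close> distinct roots.\<close>

lemma det_vandermonde_nonzero:
  fixes x :: "nat \<Rightarrow> 'a::field"
  assumes "inj_on x {..<k}"
  shows "Determinant.det (mat k k (\<lambda>(a, b). x b ^ a)) \<noteq> 0"
proof
  let ?V = "mat k k (\<lambda>(a, b). x b ^ a)"
  assume "Determinant.det ?V = 0"
  then have "Determinant.det ?V\<^sup>T = 0" by (subst Determinant.det_transpose[of _ k]) auto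
  then obtain v where v: "v \<in> carrier_vec k" "v \<noteq> 0\<^sub>v k" "?V\<^sup>T *\<^sub>v v = 0\<^sub>v k"
    by (subst (asm) det_0_iff_vec_prod_zero[of _ k]) auto
  define p where "p = (\<Sum>a<k. Polynomial.monom (vec_index v a) a)"
  have cp: "Polynomial.coeff p a = (if a < k then vec_index v a else 0)" for a
    by (simp add: p_def coeff_sum)
  have "poly p (x b) = 0" if "b < k" for b
  proof -
    have "poly p (x b) = vec_index (?V\<^sup>T *\<^sub>v v) b"
      using v(1) that by (simp add: p_def poly_sum poly_monom scalar_prod_def atLeast0LessThan mult.commute)
    then show ?thesis using v(3) that by simp
  qed
  then have "x ` {..<k} \<subseteq> {z. poly p z = 0}" by auto
  moreover have "p \<noteq> 0"
  proof
    assume "p = 0"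
    then have "vec_index v a = 0" if "a < k" for a using cp[of a] that by simp
    then have "v = 0\<^sub>v k" using v(1) by (intro eq_vecI) auto
    with v(2) show False by simp
  qed
  moreover have "card (x ` {..<k}) = k" using assms by (simp add: card_image)
  ultimately have "k \<le> card {z. poly p z = 0}"
    by (metis card_mono poly_roots_finite)
  also have "\<dots> \<le> Polynomial.degree p" using \<open>p \<noteq> 0\<close> by (rule card_poly_roots_bound)
  finally have "Polynomial.coeff p (Polynomial.degree p) = 0" by (simp add: cp)
  with \<open>p \<noteq> 0\<close> show False by simp
qed

lemma fps_nth_prod_linear_gt:
  fixes a :: "nat \<Rightarrow> 'a::comm_ring_1"
  assumes "i > b"
  shows "fps_nth (\<Prod>l<b. 1 - fps_const (a l) * fps_X) i = 0"
  using assms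
proof (induction b arbitrary: i)
  case (Suc b)
  then obtain j where j: "i = Suc j" "j > b" by (cases i) auto
  with Suc.IH[of i] Suc.IH[of j] show ?case
    by (simp add: right_diff_distrib mult.assoc[symmetric] mult.commute[of _ "fps_const _"])
qed simp

lemma fps_nth_prod_linear_0:
  fixes a :: "nat \<Rightarrow> 'a::comm_ring_1"
  shows "fps_nth (\<Prod>l<b. 1 - fps_const (a l) * fps_X) 0 = 1"
  by (induction b) (auto simp: fps_mult_nth_0)

text \<open>Multiplication by a unit upper triangular matrix combines columns so that column
  \<open>b\<close> loses the first \<open>b\<close> pole factors and is governed by the pole 1 /
  a_b. The bound \<open>k \<le> m\<close> keeps all indices in range.\<close>

lemma toeplitz_minor_column_reduce:
  fixes d :: "nat \<Rightarrow> 'a::idom" and a :: "nat \<Rightarrow> 'a"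
  assumes m: "k \<le> m"
  shows "toeplitz_minor d k m = Determinant.det (mat k k (\<lambda>(i, b).
    fps_nth ((\<Prod>l<b. 1 - fps_const (a l) * fps_X) * Abs_fps d) (m + b - i)))"
proof -
  define p where "p b = fps_nth (\<Prod>l<b. 1 - fps_const (a l) * fps_X)" for b
  let ?U = "\<lambda>(j, b). if j \<le> b then p b (b - j) else 0"
  have "Determinant.det (mat k k ?U) = 1"
    by (subst det_mat_upper_triangular) (auto simp: p_def fps_nth_prod_linear_0)
  then have "toeplitz_minor d k m
      = Determinant.det (mat k k (\<lambda>(i, b). if i \<le> m + b then d (m + b - i) else 0)) * Determinant.det (mat k k ?U)"
    by (simp add: toeplitz_minor_def)
  also have "\<dots> = Determinant.det (mat k k (\<lambda>(i, b).
    fps_nth ((\<Prod>l<b. 1 - fps_const (a l) * fps_X) * Abs_fps d) (m + b - i)))"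
    unfolding det_mat_mult
  proof (rule det_mat_cong)
    fix i b assume ib: "i < k" "b < k"
    have "fps_nth ((\<Prod>l<b. 1 - fps_const (a l) * fps_X) * Abs_fps d) (m + b - i)
        = (\<Sum>t\<le>m + b - i. p b t * d (m + b - i - t))"
      by (simp add: fps_mult_nth p_def atLeast0AtMost)
    also have "\<dots> = (\<Sum>t\<le>b. p b t * d (m + b - i - t))"
      by (rule sum.mono_neutral_right) (use ib m in \<open>auto simp: p_def fps_nth_prod_linear_gt\<close>)
    also have "\<dots> = (\<Sum>j\<le>b. p b (b - j) * d (m + j - i))"
    proof (rule sum.reindex_bij_witness[of _ "\<lambda>t. b - t" "\<lambda>t. b - t"])
      fix t assume "t \<in> {..b}"
      then have "m + b - i - t = m + (b - t) - i" using ib m by auto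
      then show "p b (b - (b - t)) * d (m + (b - t) - i) = p b t * d (m + b - i - t)"
        using \<open>t \<in> {..b}\<close> by simp
    qed auto
    also have "\<dots> = (\<Sum>j<k. if j \<le> b then p b (b - j) * d (m + j - i) else 0)"
      by (subst sum.inter_filter[symmetric]) (use ib in \<open>auto intro!: sum.cong\<close>)
    also have "\<dots> = (\<Sum>j<k. (if i \<le> m + j then d (m + j - i) else 0) * (if j \<le> b then p b (b - j) else 0))"
      by (rule sum.cong) (use ib m in \<open>auto simp: mult.commute\<close>)
    finally show "(\<lambda>(i, b). \<Sum>j<k. (\<lambda>(i, b). if i \<le> m + b then d (m + b - i) else 0) (i, j) * ?U (j, b)) (i, b)
        = (\<lambda>(i, b). fps_nth ((\<Prod>l<b. 1 - fps_const (a l) * fps_X) * Abs_fps d) (m + b - i)) (i, b)"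
      by simp
  qed
  finally show ?thesis .
qed

text \<open>With column \<open>b\<close> divided by a_b^m, the reduced matrix tends to a Vandermonde
  matrix in the 1 / a_b with scaled columns, whose determinant \<open>K\<close> is nonzero since the
  a_b are distinct. So the minor is asymptotic to \<open>K\<close> times the m-th power of the
  product of the a_b.\<close>

lemma toeplitz_minor_ratio_limit:
  fixes d :: "nat \<Rightarrow> complex" and a :: "nat \<Rightarrow> complex"
  assumes inj: "inj a" and nz: "\<And>l. a l \<noteq> 0" and B: "\<And>b. B b \<noteq> 0"
    and lim: "\<And>b. (\<lambda>m. fps_nth ((\<Prod>l<b. 1 - fps_const (a l) * fps_X) * Abs_fps d) m / a b ^ m) \<longlonglongrightarrow> B b"
  shows "(\<lambda>m. toeplitz_minor d k (Suc m) / toeplitz_minor d k m) \<longlonglongrightarrow> (\<Prod>b<k. a b)"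
proof -
  define f where "f b = fps_nth ((\<Prod>l<b. 1 - fps_const (a l) * fps_X) * Abs_fps d)" for b
  define K where "K = Determinant.det (mat k k (\<lambda>(i, b). (1 / a b) ^ i * (B b * a b ^ b)))"
  have "K = Determinant.det (mat k k (\<lambda>(i, b). (1 / a b) ^ i)) * (\<Prod>b<k. B b * a b ^ b)"
    unfolding K_def by (subst det_mat_scale_columns[symmetric]) simp
  moreover have "Determinant.det (mat k k (\<lambda>(i, b). (1 / a b) ^ i)) \<noteq> 0"
    by (rule det_vandermonde_nonzero) (use inj nz in \<open>auto simp: inj_on_def inj_def divide_simps\<close>)
  ultimately have K: "K \<noteq> 0" using B nz by simp
  have "(\<lambda>m. Determinant.det (mat k k (\<lambda>(i, b). f b (m + b - i) / a b ^ m))) \<longlonglongrightarrow> K"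
    unfolding K_def
  proof (rule tendsto_det_mat)
    fix i b assume ib: "i < k" "b < k"
    have "filterlim (\<lambda>m. m + b - i) at_top sequentially"
      unfolding filterlim_at_top
    proof
      fix N
      show "\<forall>\<^sub>F m in sequentially. N \<le> m + b - i"
        using eventually_ge_at_top[of "N + i"] by eventually_elim auto
    qed
    then have "(\<lambda>m. f b (m + b - i) / a b ^ (m + b - i)) \<longlonglongrightarrow> B b"
      unfolding f_def by (rule filterlim_compose[OF lim])
    then have "(\<lambda>m. (1 / a b) ^ i * (f b (m + b - i) / a b ^ (m + b - i) * a b ^ b)) \<longlonglongrightarrow> (1 / a b) ^ i * (B b * a b ^ b)"
      by (intro tendsto_intros)
    moreover have "\<forall>\<^sub>F m in sequentially. (1 / a b) ^ i * (f b (m + b - i) / a b ^ (m + b - i) * a b ^ b) = f b (m + b - i) / a b ^ m"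
      using eventually_ge_at_top[of i]
    proof eventually_elim
      case (elim m)
      then have "a b ^ (m + b - i) * a b ^ i = a b ^ m * a b ^ b"
        by (simp flip: power_add)
      then show ?case using nz[of b] by (simp add: power_one_over field_simps)
    qed
    ultimately show "(\<lambda>m. (\<lambda>(i, b). f b (m + b - i) / a b ^ m) (i, b)) \<longlonglongrightarrow> (\<lambda>(i, b). (1 / a b) ^ i * (B b * a b ^ b)) (i, b)"
      by (simp add: tendsto_cong)
  qed
  moreover have "\<forall>\<^sub>F m in sequentially. Determinant.det (mat k k (\<lambda>(i, b). f b (m + b - i) / a b ^ m))
      = toeplitz_minor d k m / (\<Prod>b<k. a b) ^ m"
    using eventually_ge_at_top[of k]
  proof eventually_elim
    case (elim m)
    have "Determinant.det (mat k k (\<lambda>(i, b). f b (m + b - i) / a b ^ m))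
        = Determinant.det (mat k k (\<lambda>(i, b). f b (m + b - i))) * (\<Prod>b<k. 1 / a b ^ m)"
      by (subst det_mat_scale_columns[symmetric]) simp
    also have "Determinant.det (mat k k (\<lambda>(i, b). f b (m + b - i))) = toeplitz_minor d k m"
      unfolding f_def by (rule toeplitz_minor_column_reduce[OF elim, symmetric])
    finally show ?case by (simp add: prod_dividef prod_power_distrib)
  qed
  ultimately have L: "(\<lambda>m. toeplitz_minor d k m / (\<Prod>b<k. a b) ^ m) \<longlonglongrightarrow> K"
    by (rule Lim_transform_eventually)
  have s: "(\<Prod>b<k. a b) \<noteq> 0" using nz by simp
  have "(\<lambda>m. (\<Prod>b<k. a b) * ((toeplitz_minor d k (Suc m) / (\<Prod>b<k. a b) ^ Suc m) / (toeplitz_minor d k m / (\<Prod>b<k. a b) ^ m)))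
      \<longlonglongrightarrow> (\<Prod>b<k. a b) * (K / K)"
    by (intro tendsto_intros L LIMSEQ_Suc[OF L] K)
  with s K show ?thesis by (simp add: field_simps)
qed

section \<open>Schoenberg parameters and pole asymptotics\<close>

text \<open>For positive summable \<open>a\<close>, the genus-0 Weierstrass product with zeros -1 /
  a_i. It gives the numerator of the generating function and, at -z, the denominator.\<close>

definition lin_prod :: "(nat \<Rightarrow> real) \<Rightarrow> complex \<Rightarrow> complex" where
  "lin_prod a z = prodinf (\<lambda>i. 1 + of_real (a i) * z)"

lemma lin_prod_weierstrass:
  assumes a: "\<And>i. a i > 0" "summable a"
  shows "(\<lambda>i. 1 + of_real (a i) * z) has_prod lin_prod a z"
    and "lin_prod a holomorphic_on A"
proof -
  interpret weierstrass_product "\<lambda>n. - 1 / of_real (a n)" "\<lambda>_. 0"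
  proof
    fix n show "- 1 / complex_of_real (a n) \<noteq> 0" using a(1)[of n] by simp
  next
    have "filterlim (\<lambda>n. inverse (a n)) at_top sequentially"
      by (rule filterlim_inverse_at_top[OF summable_LIMSEQ_zero[OF a(2)]]) (use a in simp)
    moreover have "norm (- 1 / complex_of_real (a n)) = inverse (a n)" for n
      using a(1)[of n] by (simp add: norm_divide inverse_eq_divide)
    ultimately show "filterlim (\<lambda>n. - 1 / complex_of_real (a n)) at_infinity sequentially"
      by (simp add: filterlim_at_infinity_conv_norm_at_top)
  next
    fix r :: real assume "r > 0"
    have "(r / norm (- 1 / complex_of_real (a n))) ^ Suc 0 = r * a n" for n
      using a(1)[of n] by (simp add: norm_divide)
    then show "summable (\<lambda>n. (r / norm (- 1 / complex_of_real (a n))) ^ Suc 0)"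
      using a(2) by (simp add: summable_mult)
  qed
  have fac: "weierstrass_factor 0 (w / (- 1 / of_real (a n))) = 1 + of_real (a n) * w" for w n
    using a(1)[of n] by (simp add: weierstrass_factor_def mult.commute)
  have eq: "f = lin_prod a"
    by (rule ext) (simp only: f_def lin_prod_def fac)
  show "(\<lambda>i. 1 + of_real (a i) * z) has_prod lin_prod a z"
    using has_prod[of z] by (simp only: fac eq)
  show "lin_prod a holomorphic_on A"
    using holomorphic[of A] by (simp only: eq)
qed

lemma lin_prod_eq_0_iff:
  assumes "\<And>i. a i > 0" "summable a"
  shows "lin_prod a z = 0 \<longleftrightarrow> (\<exists>i. 1 + of_real (a i) * z = 0)"
  using has_prod_eq_0_iff[OF lin_prod_weierstrass(1)[OF assms, of z]] by (simp add: image_iff eq_commute[of 0])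

lemma lin_prod_split:
  assumes a: "\<And>i. a i > 0" "summable a"
  shows "lin_prod a z = (\<Prod>i<b. 1 + of_real (a i) * z) * lin_prod (\<lambda>i. a (i + b)) z"
proof (induction b)
  case (Suc b)
  have s: "summable (\<lambda>i. a (i + b))" "summable (\<lambda>i. a (i + Suc b))"
    using a(2) by (simp_all only: summable_iff_shift)
  have "(\<lambda>i. 1 + of_real (a (Suc i + b)) * z) has_prod lin_prod (\<lambda>i. a (i + Suc b)) z"
    using lin_prod_weierstrass(1)[of "\<lambda>i. a (i + Suc b)" z] a(1) s(2) by simp
  then have "(\<lambda>i. 1 + of_real (a (i + b)) * z) has_prod (lin_prod (\<lambda>i. a (i + Suc b)) z * (1 + of_real (a (0 + b)) * z))"
    by (rule has_prod_Suc_imp)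
  from has_prod_unique2[OF lin_prod_weierstrass(1)[of "\<lambda>i. a (i + b)" z, OF a(1) s(1)] this]
  have "lin_prod (\<lambda>i. a (i + b)) z = (1 + of_real (a b) * z) * lin_prod (\<lambda>i. a (i + Suc b)) z"
    by (simp only: add_0 mult.commute)
  with Suc show ?case by simp
qed simp

text \<open>In \<open>z\<close> the zeros are the points 1 / a_i, and monotonicity makes 1 / a_0 the
  nearest.\<close>

lemma lin_prod_neg_nonzero:
  assumes a: "\<And>i. a i > 0" "summable a" "decseq a" and z: "norm z < 1 / a 0"
  shows "lin_prod a (- z) \<noteq> 0"
proof
  assume "lin_prod a (- z) = 0"
  then obtain i where "1 + of_real (a i) * (- z) = 0"
    using lin_prod_eq_0_iff[OF a(1,2)] by blast
  then have "of_real (a i) * z = 1" by simp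
  then have "norm (of_real (a i) * z) = 1" by (simp only: norm_one)
  then have "a i * norm z = 1"
    using a(1)[of i] by (simp only: norm_mult norm_of_real abs_of_pos)
  moreover have "a i * norm z \<le> a 0 * norm z"
    using a(3) by (intro mult_right_mono) (auto simp: decseq_def)
  moreover have "a 0 * norm z < 1"
    using mult_strict_left_mono[OF z a(1)[of 0]] a(1)[of 0] by simp
  ultimately show False by linarith
qed

lemma has_fps_expansionI:
  fixes f :: "complex \<Rightarrow> complex"
  assumes "r > 0" "\<And>z. norm z < r \<Longrightarrow> (\<lambda>k. d k * z ^ k) sums f z"
  shows "f has_fps_expansion Abs_fps d"
  unfolding has_fps_expansion_def
proof
  define w :: complex where "w = of_real (r / 2)"
  have "norm w = r / 2" unfolding w_def norm_of_real using assms(1) by (intro abs_of_pos) simp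
  then have w: "norm w < r" "0 < norm w" using assms(1) by linarith+
  have "ereal (norm w) \<le> conv_radius d"
    by (rule conv_radius_geI) (rule sums_summable[OF assms(2)[OF w(1)]])
  moreover have "0 < ereal (norm w)" using w(2) by simp
  ultimately have "0 < conv_radius d" by (rule less_le_trans[rotated])
  then show "0 < fps_conv_radius (Abs_fps d)" by (simp add: fps_conv_radius_def)
  have "\<forall>\<^sub>F z in nhds 0. z \<in> ball (0::complex) r"
    using assms(1) by (intro eventually_nhds_in_open) auto
  then show "\<forall>\<^sub>F z in nhds 0. eval_fps (Abs_fps d) z = f z"
  proof eventually_elim
    case (elim z)
    then have "(\<lambda>k. d k * z ^ k) sums f z" by (intro assms(2)) simp
    then show ?case by (simp add: eval_fps_def sums_iff)
  qed
qed

lemma has_fps_expansion_prod_linear: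
  fixes b :: nat
  shows "(\<lambda>z. \<Prod>l<b. 1 - a l * z) has_fps_expansion (\<Prod>l<b. 1 - fps_const (a l :: complex) * fps_X)"
proof (induction b)
  case (Suc b)
  have "(\<lambda>z. 1 - a b * z) has_fps_expansion (1 - fps_const (a b) * fps_X)"
    by (intro fps_expansion_intros)
  from has_fps_expansion_mult[OF Suc this] show ?case by simp
qed (auto intro: fps_expansion_intros)

text \<open>After the first \<open>b\<close> poles are removed, the nearest one is 1 / a_b.
  Multiplying by 1 - a_b z removes it too, and the partial sums of the new series at
  \<open>z0\<close>, the point 1 / a_b, telescope to the normalised coefficients. They converge
  because a_{b+1} < a_b puts \<open>z0\<close> inside the disc of holomorphy.\<close>

lemma simple_pole_coefficient_limit:
  fixes a :: "nat \<Rightarrow> real" and d :: "nat \<Rightarrow> complex" and g :: "complex \<Rightarrow> complex"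
  assumes a: "\<And>i. a i > 0" "summable a" "\<And>i. a (Suc i) < a i"
    and g: "g holomorphic_on UNIV" "\<And>i. g (of_real (1 / a i)) \<noteq> 0"
    and exp: "(\<lambda>z. g z / lin_prod a (- z)) has_fps_expansion Abs_fps d"
  shows "\<exists>B. B \<noteq> 0 \<and> (\<lambda>m. fps_nth ((\<Prod>l<b. 1 - fps_const (of_real (a l)) * fps_X) * Abs_fps d) m / of_real (a b) ^ m) \<longlonglongrightarrow> B"
proof -
  define F where "F b = (\<Prod>l<b. 1 - fps_const (of_real (a l)) * fps_X) * Abs_fps d" for b
  define h where "h b z = g z / lin_prod (\<lambda>i. a (i + b)) (- z)" for b z
  have dec: "decseq (\<lambda>i. a (i + b))" for b
    by (rule decseq_SucI) (use a(3) less_imp_le in auto)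
  have sm: "summable (\<lambda>i. a (i + b))" for b using a(2) by (simp only: summable_iff_shift)
  have hF: "h b has_fps_expansion F b" for b
  proof -
    have "(\<lambda>z. (\<Prod>l<b. 1 - of_real (a l) * z) * (g z / lin_prod a (- z))) has_fps_expansion F b"
      unfolding F_def by (intro has_fps_expansion_mult has_fps_expansion_prod_linear exp)
    moreover have "\<forall>\<^sub>F z in nhds 0. (\<Prod>l<b. 1 - of_real (a l) * z) * (g z / lin_prod a (- z)) = h b z"
    proof -
      have "((\<lambda>z. \<Prod>l<b. 1 - of_real (a l) * z) \<longlongrightarrow> (\<Prod>l<b. 1 - of_real (a l) * 0)) (nhds (0::complex))"
        by (intro tendsto_intros filterlim_ident)
      then have "\<forall>\<^sub>F z in nhds 0. (\<Prod>l<b. 1 - of_real (a l) * z) \<noteq> (0::complex)"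
        by (rule tendsto_imp_eventually_ne) simp
      then show ?thesis
        by eventually_elim (simp add: lin_prod_split[OF a(1,2), of _ b] h_def)
    qed
    ultimately show ?thesis by (subst (asm) has_fps_expansion_cong) auto
  qed
  define z0 :: complex where "z0 = of_real (1 / a b)"
  have hol: "h (Suc b) holomorphic_on ball 0 (1 / a (Suc b))"
    unfolding h_def
  proof (intro holomorphic_intros)
    show "g holomorphic_on ball 0 (1 / a (Suc b))" using g(1) holomorphic_on_subset by blast
    have "lin_prod (\<lambda>i. a (i + Suc b)) \<circ> uminus holomorphic_on ball 0 (1 / a (Suc b))"
      by (intro holomorphic_on_compose holomorphic_intros lin_prod_weierstrass(2)[OF a(1) sm])
    then show "(\<lambda>z. lin_prod (\<lambda>i. a (i + Suc b)) (- z)) holomorphic_on ball 0 (1 / a (Suc b))"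
      by (simp add: comp_def)
    fix z :: complex assume "z \<in> ball 0 (1 / a (Suc b))"
    then show "lin_prod (\<lambda>i. a (i + Suc b)) (- z) \<noteq> 0"
      by (intro lin_prod_neg_nonzero a(1) sm dec) simp
  qed
  have z0: "z0 \<in> ball 0 (1 / a (Suc b))"
    using a(1)[of b] a(1)[of "Suc b"] a(3)[of b] by (simp add: z0_def norm_divide divide_strict_left_mono)
  have "fps_expansion (h (Suc b)) 0 = F (Suc b)" by (rule fps_expansion_eqI[OF hF])
  then have "fps_nth (F (Suc b)) n = (deriv ^^ n) (h (Suc b)) 0 / fact n" for n
    by (simp add: fps_expansion_def flip: \<open>fps_expansion (h (Suc b)) 0 = F (Suc b)\<close>)
  with holomorphic_power_series[OF hol z0]
  have "(\<lambda>n. fps_nth (F (Suc b)) n * z0 ^ n) sums h (Suc b) z0"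
    by simp
  then have lim: "(\<lambda>m. \<Sum>n\<le>m. fps_nth (F (Suc b)) n * z0 ^ n) \<longlonglongrightarrow> h (Suc b) z0"
    by (simp add: sums_def_le)
  have FS: "F (Suc b) = (1 - fps_const (of_real (a b)) * fps_X) * F b"
    by (simp add: F_def mult_ac)
  have ab: "of_real (a b) * z0 = 1" using a(1)[of b] by (simp add: z0_def)
  have "(\<Sum>n\<le>m. fps_nth (F (Suc b)) n * z0 ^ n) = fps_nth (F b) m * z0 ^ m" for m
  proof (induction m)
    case 0
    then show ?case by (simp add: FS fps_mult_nth_0)
  next
    case (Suc m)
    have "fps_nth (F (Suc b)) (Suc m) = fps_nth (F b) (Suc m) - of_real (a b) * fps_nth (F b) m"
      by (simp add: FS left_diff_distrib mult.assoc)
    moreover have "of_real (a b) * fps_nth (F b) m * z0 ^ Suc m = fps_nth (F b) m * z0 ^ m * (of_real (a b) * z0)"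
      by (simp add: mult_ac)
    ultimately show ?case using Suc by (simp add: ab left_diff_distrib)
  qed
  with lim have "(\<lambda>m. fps_nth (F b) m / of_real (a b) ^ m) \<longlonglongrightarrow> h (Suc b) z0"
    by (simp add: z0_def power_divide)
  moreover have "h (Suc b) z0 \<noteq> 0"
  proof -
    have "lin_prod (\<lambda>i. a (i + Suc b)) (- z0) \<noteq> 0"
      by (intro lin_prod_neg_nonzero a(1) sm dec) (use z0 in simp)
    then show ?thesis using g(2)[of b] by (simp add: h_def z0_def)
  qed
  ultimately show ?thesis unfolding F_def by blast
qed

lemma toeplitz_minor_of_real:
  "toeplitz_minor (\<lambda>m. complex_of_real (c m)) k m = of_real (toeplitz_minor c k m)"
proof -
  have "toeplitz_minor (\<lambda>m. complex_of_real (c m)) k m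
      = Determinant.det (map_mat complex_of_real (mat k k (\<lambda>(a, b). if a \<le> m + b then c (m + b - a) else 0)))"
    unfolding toeplitz_minor_def by (rule arg_cong[where f = Determinant.det], rule eq_matI) auto
  then show ?thesis by (simp add: of_real_hom.hom_det toeplitz_minor_def)
qed

lemma toeplitz_minor_ratio_limit_real:
  fixes a :: "nat \<Rightarrow> real" and d :: "nat \<Rightarrow> real"
  assumes a: "\<And>i. a i > 0" "summable a" "\<And>i. a (Suc i) < a i"
    and g: "g holomorphic_on UNIV" "\<And>i. g (of_real (1 / a i)) \<noteq> 0"
    and exp: "(\<lambda>z. g z / lin_prod a (- z)) has_fps_expansion Abs_fps (\<lambda>m. complex_of_real (d m))"
  shows "(\<lambda>m. toeplitz_minor d k (Suc m) / toeplitz_minor d k m) \<longlonglongrightarrow> (\<Prod>b<k. a b)"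
proof -
  have "\<forall>b. \<exists>B. B \<noteq> 0 \<and> (\<lambda>m. fps_nth ((\<Prod>l<b. 1 - fps_const (of_real (a l)) * fps_X)
      * Abs_fps (\<lambda>m. complex_of_real (d m))) m / of_real (a b) ^ m) \<longlonglongrightarrow> B"
    by (rule allI, rule simple_pole_coefficient_limit[OF a g exp])
  from choice[OF this] obtain B where B: "\<And>b. B b \<noteq> 0"
    "\<And>b. (\<lambda>m. fps_nth ((\<Prod>l<b. 1 - fps_const (of_real (a l)) * fps_X)
      * Abs_fps (\<lambda>m. complex_of_real (d m))) m / of_real (a b) ^ m) \<longlonglongrightarrow> B b" by blast
  have "(\<lambda>m. toeplitz_minor (\<lambda>m. complex_of_real (d m)) k (Suc m) / toeplitz_minor (\<lambda>m. complex_of_real (d m)) k m)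
      \<longlonglongrightarrow> (\<Prod>b<k. of_real (a b))"
  proof (rule toeplitz_minor_ratio_limit[OF _ _ B])
    have "inj a"
    proof (rule linorder_injI)
      fix x y :: nat assume "x < y"
      then have "a y < a x" by (induction y rule: less_Suc_induct) (use a(3) in auto)
      then show "a x \<noteq> a y" by simp
    qed
    then show "inj (\<lambda>l. complex_of_real (a l))" by (simp add: inj_def)
    show "complex_of_real (a l) \<noteq> 0" for l using a(1)[of l] by simp
  qed
  then have "(\<lambda>m. complex_of_real (toeplitz_minor d k (Suc m) / toeplitz_minor d k m)) \<longlonglongrightarrow> of_real (\<Prod>b<k. a b)"
    by (simp add: toeplitz_minor_of_real)
  then show ?thesis by (simp only: tendsto_of_real_iff)
qed

text \<open>The second limit is the first one for 1 / C(-z), which has \<alpha> and \<beta>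
  exchanged and coefficients \<open>d\<close>; \<open>toeplitz_minor_dual\<close> translates its
  minors back.\<close>

lemma schoenberg_minor_ratio_limits:
  fixes c \<alpha> \<beta> :: "nat \<Rightarrow> real"
  assumes c0: "c 0 = 1" and pos: "\<And>k m. toeplitz_minor c k m > 0"
    and sp: "schoenberg_parameters c \<gamma> \<alpha> \<beta>"
    and \<alpha>: "\<And>i. \<alpha> i \<noteq> 0" "\<And>i. \<alpha> (Suc i) < \<alpha> i" and \<beta>: "\<And>i. \<beta> i \<noteq> 0" "\<And>i. \<beta> (Suc i) < \<beta> i"
  shows "(\<lambda>m. toeplitz_minor c k (Suc m) / toeplitz_minor c k m) \<longlonglongrightarrow> (\<Prod>b<k. \<alpha> b)"
    and "(\<lambda>m. toeplitz_minor c (Suc m) k / toeplitz_minor c m k) \<longlonglongrightarrow> (\<Prod>b<k. \<beta> b)"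
proof -
  note S = sp[unfolded schoenberg_parameters_def, THEN conjunct2]
  have sm: "summable \<alpha>" "summable \<beta>"
    by (rule S[THEN conjunct2, THEN conjunct2, THEN conjunct1])
       (rule S[THEN conjunct2, THEN conjunct2, THEN conjunct2, THEN conjunct2, THEN conjunct2, THEN conjunct1])
  have ap: "\<alpha> i > 0" for i
    using S[THEN conjunct1, rule_format, of i] \<alpha>(1)[of i] by linarith
  have bp: "\<beta> i > 0" for i
    using S[THEN conjunct2, THEN conjunct2, THEN conjunct2, THEN conjunct1, rule_format, of i] \<beta>(1)[of i] by linarith
  note L\<alpha> = lin_prod_weierstrass[OF ap sm(1)] and L\<beta> = lin_prod_weierstrass[OF bp sm(2)]
  define C where "C z = exp (of_real \<gamma> * z) * lin_prod \<beta> z / lin_prod \<alpha> (- z)" for z :: complex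
  obtain r where r: "r > 0" "\<forall>z::complex. norm z < r \<longrightarrow>
        (\<exists>P. (\<lambda>i. (1 + of_real (\<beta> i) * z) / (1 - of_real (\<alpha> i) * z)) has_prod P
           \<and> (\<lambda>k. of_real (c k) * z ^ k) sums (exp (of_real \<gamma> * z) * P))"
    using S[THEN conjunct2, THEN conjunct2, THEN conjunct2, THEN conjunct2, THEN conjunct2, THEN conjunct2]
    by (elim exE conjE) (rule that)
  have C: "(\<lambda>k. of_real (c k) * z ^ k) sums C z" if z: "norm z < r" for z
  proof -
    obtain P where P: "(\<lambda>i. (1 + of_real (\<beta> i) * z) / (1 - of_real (\<alpha> i) * z)) has_prod P"
      "(\<lambda>k. of_real (c k) * z ^ k) sums (exp (of_real \<gamma> * z) * P)" using r(2)[rule_format, OF z] by (elim exE conjE) (rule that)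
    have "(\<lambda>i. (1 + of_real (\<beta> i) * z) / (1 + of_real (\<alpha> i) * (- z))) has_prod (lin_prod \<beta> z / lin_prod \<alpha> (- z))"
      by (intro has_prod_divide L\<alpha> L\<beta>)
    with P(1) have "P = lin_prod \<beta> z / lin_prod \<alpha> (- z)" by (simp add: has_prod_unique2)
    with P(2) show ?thesis by (simp add: C_def)
  qed
  \<comment> \<open>The numerators have no positive real zeros, so they cancel no pole.\<close>
  have posprod: "lin_prod a (of_real x) \<noteq> 0" if a: "\<And>i. a i > 0" "summable a" and x: "x > 0" for a x
  proof
    assume "lin_prod a (of_real x) = 0"
    then obtain i where "1 + complex_of_real (a i) * of_real x = 0"
      using lin_prod_eq_0_iff[OF a] by blast
    then have "complex_of_real (1 + a i * x) = 0" by simp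
    then have "1 + a i * x = 0" by (simp only: of_real_eq_0_iff)
    moreover have "a i * x > 0" using a(1) x by simp
    ultimately show False by linarith
  qed
  show "(\<lambda>m. toeplitz_minor c k (Suc m) / toeplitz_minor c k m) \<longlonglongrightarrow> (\<Prod>b<k. \<alpha> b)"
  proof (rule toeplitz_minor_ratio_limit_real[OF ap sm(1) \<alpha>(2)])
    show "(\<lambda>z. exp (of_real \<gamma> * z) * lin_prod \<beta> z) holomorphic_on UNIV"
      by (intro holomorphic_intros L\<beta>)
    show "exp (of_real \<gamma> * of_real (1 / \<alpha> i)) * lin_prod \<beta> (of_real (1 / \<alpha> i)) \<noteq> 0" for i
      using posprod[OF bp sm(2), of "1 / \<alpha> i"] ap[of i] by simp
    show "(\<lambda>z. exp (of_real \<gamma> * z) * lin_prod \<beta> z / lin_prod \<alpha> (- z)) has_fps_expansion Abs_fps (\<lambda>m. complex_of_real (c m))"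
      using has_fps_expansionI[OF r(1) C] unfolding C_def .
  qed
  define d where "d = (\<lambda>m. toeplitz_minor c m 1)"
  have "(\<lambda>m. toeplitz_minor d k (Suc m) / toeplitz_minor d k m) \<longlonglongrightarrow> (\<Prod>b<k. \<beta> b)"
  proof (rule toeplitz_minor_ratio_limit_real[OF bp sm(2) \<beta>(2)])
    show "(\<lambda>z. exp (of_real \<gamma> * z) * lin_prod \<alpha> z) holomorphic_on UNIV"
      by (intro holomorphic_intros L\<alpha>)
    show "exp (of_real \<gamma> * of_real (1 / \<beta> i)) * lin_prod \<alpha> (of_real (1 / \<beta> i)) \<noteq> 0" for i
      using posprod[OF ap sm(1), of "1 / \<beta> i"] bp[of i] by simp
    define N where "N = Abs_fps (\<lambda>m. (- 1) ^ m * complex_of_real (c m))"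
    have "(\<lambda>z. C (- z)) has_fps_expansion N"
      unfolding N_def
    proof (rule has_fps_expansionI[OF r(1)])
      fix z :: complex assume "norm z < r"
      then have "(\<lambda>k. of_real (c k) * (- z) ^ k) sums C (- z)" by (intro C) simp
      then show "(\<lambda>k. (- 1) ^ k * of_real (c k) * z ^ k) sums C (- z)"
        by (simp add: power_minus[of z] mult_ac)
    qed
    moreover have "fps_nth N 0 \<noteq> 0" by (simp add: N_def c0)
    ultimately have "(\<lambda>z. inverse (C (- z))) has_fps_expansion inverse N"
      by (rule has_fps_expansion_inverse)
    moreover have "inverse (C (- z)) = exp (of_real \<gamma> * z) * lin_prod \<alpha> z / lin_prod \<beta> (- z)" for z
      by (simp add: C_def exp_minus field_simps)
    \<comment> \<open>The recursion \<open>toeplitz_minor_hessenberg\<close>, read as a product of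
      power series.\<close>
    moreover have "inverse N = Abs_fps (\<lambda>m. complex_of_real (d m))"
    proof (rule fps_inverse_unique)
      show "N * Abs_fps (\<lambda>m. complex_of_real (d m)) = 1"
      proof (rule fps_ext)
        fix m
        show "fps_nth (N * Abs_fps (\<lambda>m. complex_of_real (d m))) m = fps_nth 1 m"
        proof (cases m)
          case 0
          then show ?thesis by (simp add: N_def d_def c0 fps_mult_nth_0)
        next
          case (Suc l)
          have "(\<Sum>i\<le>Suc l. (- 1) ^ i * c i * d (Suc l - i)) = d (Suc l) - (\<Sum>j<Suc l. (- 1) ^ j * c (Suc j) * d (l - j))"
            unfolding sum.atMost_Suc_shift
            by (simp add: c0 lessThan_Suc_atMost sum_negf)
          also have "\<dots> = 0"
            using toeplitz_minor_hessenberg[of c l, OF c0] by (simp only: d_def diff_self)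
          finally have "complex_of_real (\<Sum>i\<le>Suc l. (- 1) ^ i * c i * d (Suc l - i)) = 0" by simp
          then show ?thesis
            using Suc by (simp add: fps_mult_nth N_def atLeast0AtMost del: sum.atMost_Suc)
        qed
      qed
    qed
    ultimately show "(\<lambda>z. exp (of_real \<gamma> * z) * lin_prod \<alpha> z / lin_prod \<beta> (- z)) has_fps_expansion Abs_fps (\<lambda>m. complex_of_real (d m))"
      by simp
  qed
  moreover have "toeplitz_minor d k m = toeplitz_minor c m k" for m
    unfolding d_def by (rule toeplitz_minor_dual[of c, OF c0]) (rule less_imp_neq[OF pos, symmetric])
  ultimately show "(\<lambda>m. toeplitz_minor c (Suc m) k / toeplitz_minor c m k) \<longlonglongrightarrow> (\<Prod>b<k. \<beta> b)"
    by simp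
qed

section \<open>Limits of quantum Schubert functions\<close>

text \<open>At t = 0 the recurrence reads G_{k+1}(0) = x_{k+1} G_k(0) + q_k G_{k-1}(0). Limits of
  the constant terms thus determine those of the x, since the q_k tend to 0, and the recurrence then
  carries the limit to all coefficients.\<close>

lemma jacobi_poly_limit:
  fixes x q :: "nat \<Rightarrow> nat \<Rightarrow> complex"
  assumes q: "\<And>k. 1 \<le> k \<Longrightarrow> (\<lambda>n. q n k) \<longlonglongrightarrow> 0"
    and const: "\<And>k. (\<lambda>n. Polynomial.coeff (jacobi_poly (x n) (q n) k) 0) \<longlonglongrightarrow> (\<Prod>b<k. a b)"
    and a: "\<And>b. a b \<noteq> 0"
  shows "(\<lambda>n. Polynomial.coeff (jacobi_poly (x n) (q n) k) j)
    \<longlonglongrightarrow> Polynomial.coeff (jacobi_poly (\<lambda>i. a (i - 1)) (\<lambda>_. 0) k) j"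
proof -
  let ?G0 = "\<lambda>n k. Polynomial.coeff (jacobi_poly (x n) (q n) k) 0"
  have x_lim: "(\<lambda>n. x n (Suc k)) \<longlonglongrightarrow> a k" for k
  proof (cases k)
    case 0
    then show ?thesis using const[of 1] by simp
  next
    case (Suc l)
    have "(\<Prod>b<k. a b) \<noteq> 0" using a by simp
    then have nz: "\<forall>\<^sub>F n in sequentially. ?G0 n k \<noteq> 0"
      using tendsto_imp_eventually_ne[OF const] by blast
    have "(\<lambda>n. (?G0 n (Suc k) - q n k * ?G0 n l) / ?G0 n k)
        \<longlonglongrightarrow> ((\<Prod>b<Suc k. a b) - 0 * (\<Prod>b<l. a b)) / (\<Prod>b<k. a b)"
      using Suc a by (intro tendsto_intros const q) auto
    also have "((\<Prod>b<Suc k. a b) - 0 * (\<Prod>b<l. a b)) / (\<Prod>b<k. a b) = a k"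
      using a by simp
    finally show ?thesis
      by (rule Lim_transform_eventually)
         (use nz in eventually_elim, simp add: Suc coeff_linear_mult field_simps)
  qed
  show ?thesis
  proof (induction k arbitrary: j rule: induct_nat_012)
    case 1
    show ?case using x_lim[of 0] by (auto simp: coeff_pCons split: nat.split)
  next
    case (ge2 k)
    have shift: "(\<lambda>n. if 1 \<le> j then Polynomial.coeff (jacobi_poly (x n) (q n) (Suc k)) (j - 1) else 0)
        \<longlonglongrightarrow> (if 1 \<le> j then Polynomial.coeff (jacobi_poly (\<lambda>i. a (i - 1)) (\<lambda>_. 0) (Suc k)) (j - 1) else 0)"
      using ge2.IH(2) by (cases "j \<ge> 1") simp_all
    have "(\<lambda>n. x n (Suc (Suc k)) * Polynomial.coeff (jacobi_poly (x n) (q n) (Suc k)) j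
          + (if 1 \<le> j then Polynomial.coeff (jacobi_poly (x n) (q n) (Suc k)) (j - 1) else 0)
          + q n (Suc k) * Polynomial.coeff (jacobi_poly (x n) (q n) k) j)
        \<longlonglongrightarrow> a (Suc k) * Polynomial.coeff (jacobi_poly (\<lambda>i. a (i - 1)) (\<lambda>_. 0) (Suc k)) j
          + (if 1 \<le> j then Polynomial.coeff (jacobi_poly (\<lambda>i. a (i - 1)) (\<lambda>_. 0) (Suc k)) (j - 1) else 0)
          + 0 * Polynomial.coeff (jacobi_poly (\<lambda>i. a (i - 1)) (\<lambda>_. 0) k) j"
      by (intro tendsto_add tendsto_mult x_lim q ge2.IH shift) simp
    then show ?case
      by (simp only: jacobi_poly.simps coeff_add coeff_smult coeff_linear_mult diff_Suc_1)
  qed simp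
qed

lemma tendsto_e_value:
  assumes "Poly_Mapping.keys p \<subseteq> e_indices" "\<And>k i. i \<le> k \<Longrightarrow> (\<lambda>n. E n k i) \<longlonglongrightarrow> E' k i"
  shows "(\<lambda>n. e_value p (E n)) \<longlonglongrightarrow> e_value p E'"
  unfolding e_value_def
  by (intro tendsto_sum tendsto_mult tendsto_const tendsto_prod assms(2))
     (use assms(1) in \<open>auto simp: e_indices_def\<close>)

text \<open>The common form of both limits: \<open>Z\<close> is the array of minors for \<alpha> and
  its transpose for \<beta>.\<close>

lemma schubert_e_value_limit:
  fixes Z :: "nat \<Rightarrow> nat \<Rightarrow> nat \<Rightarrow> real" and a :: "nat \<Rightarrow> real" and x q :: "nat \<Rightarrow> nat \<Rightarrow> complex"
  assumes pos: "\<And>n k m. \<lbrakk>1 \<le> n; k + m \<le> n + 1\<rbrakk> \<Longrightarrow> Z n k m > 0" and Z0: "\<And>n m. Z n 0 m = 1"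
    and jac: "\<And>n k m. \<lbrakk>1 \<le> n; 1 \<le> k; 1 \<le> m; k + m \<le> n\<rbrakk>
        \<Longrightarrow> (Z n k m)\<^sup>2 = Z n k (m - 1) * Z n k (Suc m) + Z n (Suc k) m * Z n (k - 1) m"
    and lim: "\<And>k m. (\<lambda>n. Z n k m) \<longlonglongrightarrow> Zi k m" and Zi_pos: "\<And>k m. Zi k m > 0"
    and rat: "\<And>k. (\<lambda>m. Zi k (Suc m) / Zi k m) \<longlonglongrightarrow> (\<Prod>b<k. a b)"
    and a: "\<And>b. a b > 0" "\<And>b. a (Suc b) < a b"
    and q: "\<And>n k. \<lbrakk>1 \<le> k; k \<le> n\<rbrakk> \<Longrightarrow> q n k
        = of_real (Z n (Suc k) (n - k) * Z n (k - 1) (n + 2 - k) / (Z n k (n + 1 - k))\<^sup>2)"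
    and const: "\<And>n k. \<lbrakk>1 \<le> k; k \<le> n\<rbrakk> \<Longrightarrow> Polynomial.coeff (jacobi_poly (x n) (q n) k) 0
        = of_real (Z n k (n - k) / Z n k (n + 1 - k))"
    and w: "w permutes {1..N}"
  shows "(\<lambda>n. e_value (e_coeffs (schubert w)) (\<lambda>k i. Polynomial.coeff (jacobi_poly (x n) (q n) k) (k - i)))
    \<longlonglongrightarrow> cpoly_eval (\<lambda>i. complex_of_real (1 / a (i - 1))) (schubert w)"
proof -
  have \<sigma>_pos: "(\<Prod>b<k. a b) > 0" for k by (intro prod_pos) (use a in simp)
  have gap: "(\<Prod>b<Suc k. a b) * (\<Prod>b<k - 1. a b) < (\<Prod>b<k. a b)\<^sup>2" if k: "1 \<le> k" for k
  proof -
    obtain l where l: "k = Suc l" using k by (cases k) auto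
    have "(\<Prod>b<l. a b)\<^sup>2 * a l * a (Suc l) < (\<Prod>b<l. a b)\<^sup>2 * a l * a l"
      by (rule mult_strict_left_mono[OF a(2)]) (intro mult_pos_pos zero_less_power \<sigma>_pos a(1))
    then show ?thesis by (simp add: l power2_eq_square mult_ac)
  qed
  note L = corner_ratio_limits[where Z = Z and Zi = Zi and \<sigma> = "\<lambda>k. \<Prod>b<k. a b"]
  have L1: "(\<lambda>n. Z n k (n + 1 - k) / Z n k (n - k)) \<longlonglongrightarrow> (\<Prod>b<k. a b)"
    and L2: "(\<lambda>n. Z n (Suc k) (n - k) * Z n (k - 1) (n + 2 - k) / (Z n k (n + 1 - k))\<^sup>2) \<longlonglongrightarrow> 0"
    if k: "1 \<le> k" for k
    by (rule L(1)[OF pos Z0 jac lim Zi_pos rat \<sigma>_pos gap[OF k] k]; assumption)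
       (rule L(2)[OF pos Z0 jac lim Zi_pos rat \<sigma>_pos gap[OF k] k]; assumption)
  have q_lim: "(\<lambda>n. q n k) \<longlonglongrightarrow> 0" if k: "1 \<le> k" for k
  proof (rule Lim_transform_eventually)
    show "(\<lambda>n. complex_of_real (Z n (Suc k) (n - k) * Z n (k - 1) (n + 2 - k) / (Z n k (n + 1 - k))\<^sup>2)) \<longlonglongrightarrow> 0"
      using tendsto_of_real[OF L2[OF k], where 'a = complex] by simp
    show "\<forall>\<^sub>F n in sequentially. complex_of_real (Z n (Suc k) (n - k) * Z n (k - 1) (n + 2 - k) / (Z n k (n + 1 - k))\<^sup>2) = q n k"
      using eventually_ge_at_top[of k] by eventually_elim (simp only: q[OF k])
  qed
  have const_lim: "(\<lambda>n. Polynomial.coeff (jacobi_poly (x n) (q n) k) 0) \<longlonglongrightarrow> (\<Prod>b<k. complex_of_real (1 / a b))" for k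
  proof (cases "k = 0")
    case False
    then have k: "1 \<le> k" by simp
    show ?thesis
    proof (rule Lim_transform_eventually)
      have "(\<lambda>n. inverse (Z n k (n + 1 - k) / Z n k (n - k))) \<longlonglongrightarrow> inverse (\<Prod>b<k. a b)"
        by (rule tendsto_inverse[OF L1[OF k] less_imp_neq[OF \<sigma>_pos, symmetric]])
      then show "(\<lambda>n. complex_of_real (Z n k (n - k) / Z n k (n + 1 - k))) \<longlonglongrightarrow> (\<Prod>b<k. complex_of_real (1 / a b))"
        unfolding of_real_prod[symmetric] by (intro tendsto_of_real) (simp add: prod_dividef inverse_eq_divide)
      show "\<forall>\<^sub>F n in sequentially. complex_of_real (Z n k (n - k) / Z n k (n + 1 - k))
          = Polynomial.coeff (jacobi_poly (x n) (q n) k) 0"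
        using eventually_ge_at_top[of k] by eventually_elim (simp only: const[OF k])
    qed
  qed simp
  have "(\<lambda>n. e_value (e_coeffs (schubert w)) (\<lambda>k i. Polynomial.coeff (jacobi_poly (x n) (q n) k) (k - i)))
      \<longlonglongrightarrow> e_value (e_coeffs (schubert w)) (esym_at (\<lambda>i. complex_of_real (1 / a (i - 1))))"
  proof (rule tendsto_e_value[OF keys_e_coeffs_schubert(1)[OF w]])
    fix k i :: nat assume "i \<le> k"
    have nz: "complex_of_real (1 / a b) \<noteq> 0" for b using a(1)[of b] by simp
    show "(\<lambda>n. Polynomial.coeff (jacobi_poly (x n) (q n) k) (k - i))
        \<longlonglongrightarrow> esym_at (\<lambda>i. complex_of_real (1 / a (i - 1))) k i"
      unfolding coeff_jacobi_poly_esym[OF \<open>i \<le> k\<close>, symmetric]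
      by (rule jacobi_poly_limit[OF q_lim const_lim nz])
  qed
  then show ?thesis by (simp only: keys_e_coeffs_schubert(2)[OF w, symmetric])
qed

text \<open>Passes through the complex numbers, where \<open>tendsto_det_mat\<close> is
  stated.\<close>

lemma tendsto_toeplitz_minor:
  fixes c :: "nat \<Rightarrow> real"
  assumes "\<And>k. (\<lambda>n. d n k) \<longlonglongrightarrow> c k"
  shows "(\<lambda>n. toeplitz_minor (d n) k m) \<longlonglongrightarrow> toeplitz_minor c k m"
proof -
  have "(\<lambda>n. toeplitz_minor (\<lambda>j. complex_of_real (d n j)) k m) \<longlonglongrightarrow> toeplitz_minor (\<lambda>j. complex_of_real (c j)) k m"
    unfolding toeplitz_minor_def
    by (rule tendsto_det_mat) (simp add: tendsto_of_real assms)
  then show ?thesis by (simp only: toeplitz_minor_of_real tendsto_of_real_iff)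
qed

lemma converges_uniformly_entries:
  assumes conv: "converges_uniformly u (toeplitz c)"
    and u: "\<And>n. 1 \<le> n \<Longrightarrow> u n = truncation (n + 1) (toeplitz (d n))"
    and "\<And>n. d n 0 = 1" "c 0 = 1"
  shows "(\<lambda>n. d n k) \<longlonglongrightarrow> c k"
proof (cases "k = 0")
  case False
  show ?thesis
  proof (rule LIMSEQ_I)
    fix \<epsilon> :: real assume "\<epsilon> > 0"
    then obtain N where N: "\<And>n. n > N \<Longrightarrow> utoep_dist n (u n) (truncation (n + 1) (toeplitz c)) < \<epsilon>"
      using conv unfolding converges_uniformly_def by blast
    have "norm (d n k - c k) < \<epsilon>" if n: "n \<ge> max (Suc N) k" for n
    proof -
      let ?f = "\<lambda>k. u n $$ (0, k) - truncation (n + 1) (toeplitz c) $$ (0, k)"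
      have "\<bar>?f k\<bar> \<le> L2_set (\<lambda>k. \<bar>?f k\<bar>) {1..n}"
        by (rule member_le_L2_set) (use n False in auto)
      moreover have "L2_set (\<lambda>k. \<bar>?f k\<bar>) {1..n} < \<epsilon>"
        using N[of n] n by (simp add: utoep_dist_def L2_set_def)
      moreover have "?f k = d n k - c k"
        using n u[of n] by (simp add: truncation_def toeplitz_def)
      ultimately show ?thesis by simp
    qed
    then show "\<exists>no. \<forall>n\<ge>no. norm (d n k - c k) < \<epsilon>" by blast
  qed
qed (use assms in simp)

theorem theorem2p16:
  fixes c \<alpha> \<beta> :: "nat \<Rightarrow> real" and \<gamma> :: real
    and u :: "nat \<Rightarrow> real mat" and w :: "nat \<Rightarrow> nat"
  assumes "c 0 = 1"
    and "totally_positive UNIV (toeplitz c)"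
    and "schoenberg_parameters c \<gamma> \<alpha> \<beta>"
    and "\<And>i. \<alpha> i \<noteq> 0" and "\<And>j. \<beta> j \<noteq> 0"
    and "\<And>i. \<alpha> i > \<alpha> (Suc i)" and "\<And>j. \<beta> j > \<beta> (Suc j)"
    and "\<And>n. n \<ge> 1 \<Longrightarrow> u n \<in> UToep (n + 1)"
    and "\<And>n. n \<ge> 1 \<Longrightarrow> totally_positive {..<n + 1} (entries (u n))"
    and "converges_uniformly u (toeplitz c)"
    and "\<exists>m. w permutes {1..m}"
  shows "((\<lambda>n. schubert_fun n w (map_mat complex_of_real (u n)))
           \<longlonglongrightarrow> cpoly_eval (\<lambda>i. complex_of_real (1 / \<alpha> (i - 1))) (schubert w)) \<and>
         ((\<lambda>n. schubert_fun n (longest (n + 1) \<circ> w \<circ> longest (n + 1))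
                (map_mat complex_of_real (u n)))
           \<longlonglongrightarrow> cpoly_eval (\<lambda>j. complex_of_real (1 / \<beta> (j - 1))) (schubert w))"
proof -
  obtain N where w: "w permutes {1..N}" using assms(11) by blast
  \<comment> \<open>\<open>u 0\<close> is arbitrary; choosing a sequence with leading entry 1 there
    as well lets facts such as \<open>Z_0\<close> hold for every \<open>n\<close>.\<close>
  have "\<forall>n. \<exists>d. d 0 = 1 \<and> (1 \<le> n \<longrightarrow> u n = truncation (n + 1) (toeplitz d))"
  proof
    fix n show "\<exists>d. d 0 = 1 \<and> (1 \<le> n \<longrightarrow> u n = truncation (n + 1) (toeplitz d))"
    proof (cases "1 \<le> n")
      case True
      from UToepE[OF assms(8)[OF this]] show ?thesis by blast
    qed (use assms(1) in blast)
  qed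
  from choice[OF this] obtain d where d0: "\<And>n. d n 0 = 1"
    and u: "\<And>n. 1 \<le> n \<Longrightarrow> u n = truncation (n + 1) (toeplitz (d n))" by blast
  let ?d = "\<lambda>n m. complex_of_real (d n m)"
  let ?U = "\<lambda>n. truncation (n + 1) (toeplitz (?d n))"
  have U: "map_mat complex_of_real (u n) = ?U n" if "1 \<le> n" for n
    unfolding u[OF that] truncation_def toeplitz_def by (rule eq_matI) auto
  define Z where "Z n k m = toeplitz_minor (d n) k m" for n k m
  have Z_pos: "Z n k m > 0" if "1 \<le> n" "k + m \<le> n + 1" for n k m
    using toeplitz_minor_pos_truncation[of "n + 1" "d n" k m] assms(9)[OF that(1)] that(2)
    unfolding u[OF that(1)] Z_def by blast
  have Z_nz: "Z n k m \<noteq> 0" if "1 \<le> n" "k + m \<le> n + 1" for n k m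
    using Z_pos[OF that] by simp
  have Z_0: "Z n 0 m = 1" "Z n m 0 = 1" for n m
    by (simp_all add: Z_def toeplitz_minor_0_right d0)
  have Z_jac: "(Z n k m)\<^sup>2 = Z n k (m - 1) * Z n k (Suc m) + Z n (Suc k) m * Z n (k - 1) m"
    if "1 \<le> n" "1 \<le> k" "1 \<le> m" "k + m \<le> n" for n k m
    unfolding Z_def by (rule toeplitz_minor_jacobi[OF that(2,3)]; fold Z_def; rule Z_nz) (use that in simp_all)
  have minor_d: "toeplitz_minor (?d n) k m = of_real (Z n k m)" for n k m
    by (simp add: Z_def toeplitz_minor_of_real)
  have \<Delta>: "Delta n k (?U n) = of_real (Z n k (n + 1 - k))" if "k \<le> n + 1" for n k
    by (simp only: Delta_toeplitz[OF that] minor_d)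
  have U_open: "?U n \<in> UToep_open n" if "1 \<le> n" for n
  proof -
    have "?U n \<in> UToep (n + 1)" unfolding UToep_def using d0 by (intro CollectI exI[of _ "?d n"]) simp
    moreover have "Delta n k (?U n) \<noteq> 0" if "k \<in> {1..n}" for k
      using \<Delta>[of k n] Z_nz[OF \<open>1 \<le> n\<close>, of k "n + 1 - k"] that by simp
    ultimately show ?thesis by (simp add: UToep_open_def)
  qed
  have corner: "toeplitz_corner (?d n) n" if "1 \<le> n" for n
    using UToep_open_corner[OF U_open[OF that]] d0 by simp
  have lim: "(\<lambda>n. Z n k m) \<longlonglongrightarrow> toeplitz_minor c k m" for k m
    unfolding Z_def using converges_uniformly_entries[OF assms(10) u d0 assms(1)] by (rule tendsto_toeplitz_minor)
  have Zi_pos: "toeplitz_minor c k m > 0" for k m by (rule toeplitz_minor_pos[OF assms(2)])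
  note rat = schoenberg_minor_ratio_limits[OF assms(1) Zi_pos assms(3,4,6,5,7)]
  have \<alpha>: "\<alpha> i > 0" and \<beta>: "\<beta> i > 0" for i
    using assms(3,4,5) unfolding schoenberg_parameters_def by (simp_all add: order_less_le)
  let ?x = "\<lambda>n k. gen_image n (?U n) (X k)" and ?q = "\<lambda>n k. gen_image n (?U n) (Q k)"
  let ?x' = "\<lambda>n k. - gen_image n (?U n) (X (n + 2 - k))" and ?q' = "\<lambda>n k. gen_image n (?U n) (Q (n + 1 - k))"
  have "(\<lambda>n. e_value (e_coeffs (schubert w)) (\<lambda>k i. Polynomial.coeff (jacobi_poly (?x n) (?q n) k) (k - i)))
      \<longlonglongrightarrow> cpoly_eval (\<lambda>i. complex_of_real (1 / \<alpha> (i - 1))) (schubert w)"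
  proof (rule schubert_e_value_limit[OF Z_pos Z_0(1) Z_jac lim Zi_pos rat(1) \<alpha> assms(6) _ _ w])
    fix n k :: nat assume k: "1 \<le> k" "k \<le> n"
    then have n: "1 \<le> n" by simp
    show "?q n k = of_real (Z n (Suc k) (n - k) * Z n (k - 1) (n + 2 - k) / (Z n k (n + 1 - k))\<^sup>2)"
      using k \<Delta>[of "k + 1" n] \<Delta>[of "k - 1" n] \<Delta>[of k n] by simp
    show "Polynomial.coeff (jacobi_poly (?x n) (?q n) k) 0 = of_real (Z n k (n - k) / Z n k (n + 1 - k))"
      by (simp only: jacobi_poly_gen_image_0[OF corner[OF n] refl k(2)] minor_d of_real_divide)
  qed
  moreover have "\<forall>\<^sub>F n in sequentially. e_value (e_coeffs (schubert w))
      (\<lambda>k i. Polynomial.coeff (jacobi_poly (?x n) (?q n) k) (k - i)) = schubert_fun n w (map_mat complex_of_real (u n))"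
    using eventually_ge_at_top[of 1]
    by eventually_elim (simp only: U schubert_fun_e_value[OF U_open _ w] d0 of_real_1)
  ultimately have 1: "(\<lambda>n. schubert_fun n w (map_mat complex_of_real (u n)))
      \<longlonglongrightarrow> cpoly_eval (\<lambda>i. complex_of_real (1 / \<alpha> (i - 1))) (schubert w)"
    by (rule Lim_transform_eventually)
  \<comment> \<open>The same limit for the transposed array; its Desnanot-Jacobi identity is the
    original one with the two products exchanged.\<close>
  have "(\<lambda>n. e_value (e_coeffs (schubert w)) (\<lambda>k i. Polynomial.coeff (jacobi_poly (?x' n) (?q' n) k) (k - i)))
      \<longlonglongrightarrow> cpoly_eval (\<lambda>i. complex_of_real (1 / \<beta> (i - 1))) (schubert w)"
  proof (rule schubert_e_value_limit[of "\<lambda>n k m. Z n m k" "\<lambda>k m. toeplitz_minor c m k", OF _ Z_0(2) _ lim Zi_pos rat(2) \<beta> assms(7) _ _ w])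
    show "Z n m k > 0" if "1 \<le> n" "k + m \<le> n + 1" for n k m
      using that by (intro Z_pos) simp_all
    show "(Z n m k)\<^sup>2 = Z n (m - 1) k * Z n (Suc m) k + Z n m (Suc k) * Z n m (k - 1)"
      if "1 \<le> n" "1 \<le> k" "1 \<le> m" "k + m \<le> n" for n k m
      using Z_jac[of n m k] that by (simp add: algebra_simps)
    fix n k :: nat assume k: "1 \<le> k" "k \<le> n"
    then have n: "1 \<le> n" by simp
    have "n + 1 - k + 1 = n + 2 - k" "n + 1 - k - 1 = n - k" "n + 1 - (n + 2 - k) = k - 1"
      "n + 1 - (n - k) = Suc k" "n + 1 - (n + 1 - k) = k" using k by auto
    then show "?q' n k = of_real (Z n (n - k) (Suc k) * Z n (n + 2 - k) (k - 1) / (Z n (n + 1 - k) k)\<^sup>2)"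
      using k \<Delta>[of "n + 2 - k" n] \<Delta>[of "n - k" n] \<Delta>[of "n + 1 - k" n] by (simp add: mult.commute)
    show "Polynomial.coeff (jacobi_poly (?x' n) (?q' n) k) 0 = of_real (Z n (n - k) k / Z n (n + 1 - k) k)"
      by (simp only: jacobi_poly_gen_image_dual_0[OF corner[OF n] refl k(2)] minor_d of_real_divide)
  qed
  \<comment> \<open>Duality takes place in S_{n+1}, so \<open>n\<close> has to be large enough for
    this group to contain \<open>w\<close>.\<close>
  moreover have "\<forall>\<^sub>F n in sequentially. e_value (e_coeffs (schubert w))
      (\<lambda>k i. Polynomial.coeff (jacobi_poly (?x' n) (?q' n) k) (k - i))
      = schubert_fun n (longest (n + 1) \<circ> w \<circ> longest (n + 1)) (map_mat complex_of_real (u n))"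
    using eventually_ge_at_top[of "max 1 N"]
  proof eventually_elim
    case (elim n)
    then have n: "1 \<le> n" and "{1..N} \<subseteq> {1..n + 1}" by auto
    with w have "w permutes {1..n + 1}" using permutes_subset by blast
    then show ?case
      using schubert_fun_flip_e_value[OF U_open[OF n]] d0 by (simp only: U[OF n] of_real_1)
  qed
  ultimately have "(\<lambda>n. schubert_fun n (longest (n + 1) \<circ> w \<circ> longest (n + 1)) (map_mat complex_of_real (u n)))
      \<longlonglongrightarrow> cpoly_eval (\<lambda>j. complex_of_real (1 / \<beta> (j - 1))) (schubert w)"
    by (rule Lim_transform_eventually)
  with 1 show ?thesis by blast
qed

end
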